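(* Let $G$ be a finite group and $\chi\in\mathrm{Irr}_K(G)$. Suppose that the $\mathcal{O}$-algebra $\mathcal{O}Ge(\chi)$ is symmetric. Then either $\chi$ lifts an irreducible Brauer character, or the decomposition number $d^\chi_\varphi$ is divisible by $p$ for all $\varphi\in\mathrm{IBr}_k(G)$.
   Context: Let $p$ be a prime and $\mathcal{O}$ a complete discrete valuation ring with residue field $k$ of characteristic $p$ and quotient field $K$ of characteristic zero; $K$ and $k$ are assumed to be splitting fields for all finite groups under consideration. $\mathrm{Irr}_K(G)$ is the set of irreducible $K$-valued characters of $G$, and $\mathrm{IBr}_k(G)$ the set of irreducible Brauer characters of $G$. For $\chi\in\mathrm{Irr}_K(G)$, $e(\chi)=\frac{\chi(1)}{|G|}\sum_{x\in G}\chi(x^{-1})x$ is the primitive idempotent of $Z(KG)$ corresponding to $\chi$, and $\mathcal{O}Ge(\chi)\subseteq KG$ is the image of $\mathcal{O}G$ under multiplication by $e(\chi)$, an $\mathcal{O}$-algebra with unit $e(\chi)$. The decomposition numbers $d^\chi_\varphi$ are the nonnegative integers such that the restriction of $\chi$ to the set of $p'$-elements of $G$ equals $\sum_{\varphi\in\mathrm{IBr}_k(G)}d^\chi_\varphi\,\varphi$. We say that $\chi$ lifts $\varphi\in\mathrm{IBr}_k(G)$ if the restriction of $\chi$ to the $p'$-elements of $G$ equals $\varphi$, equivalently $d^\chi_\varphi=1$ and $d^\chi_{\varphi'}=0$ for all $\varphi'\neq\varphi$. An $\mathcal{O}$-algebra $A$ is symmetric if $A$ is finitely generated projective as an $\mathcal{O}$-module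 and $A\cong\mathrm{Hom}_{\mathcal{O}}(A,\mathcal{O})$ as $A$-$A$-bimodules. *)

theory Defs
  imports
    "Jordan_Normal_Form.Char_Poly"
    "Jordan_Normal_Form.VS_Connect"
    "HOL-Algebra.Multiplicative_Group"
    "HOL-Algebra.Ring_Divisibility"
    "HOL-Algebra.Ideal_Product"
    "HOL-Algebra.Subrings"
begin

section \<open>Complete discrete valuation rings and \<open>p\<close>-modular systems\<close>

definition discrete_valuation_ring :: "('a, 'm) ring_scheme \<Rightarrow> bool" where
  "discrete_valuation_ring R \<longleftrightarrow>
     principal_domain R \<and> (\<exists>!M. maximalideal M R) \<and> \<not> field R"

definition max_ideal :: "('a, 'm) ring_scheme \<Rightarrow> 'a set" where
  "max_ideal R = (THE M. maximalideal M R)"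

text \<open>Completeness is with respect to the topology given by the powers of the maximal ideal;
  \<^term>\<open>ideals_set R\<close> is the structure of ideals of \<open>R\<close> under ideal product.\<close>

definition complete_dvr :: "('a, 'm) ring_scheme \<Rightarrow> bool" where
  "complete_dvr R \<longleftrightarrow> discrete_valuation_ring R \<and>
     (\<forall>s :: nat \<Rightarrow> 'a.
        (\<forall>i. s i \<in> carrier R) \<and>
        (\<forall>n::nat. \<exists>N. \<forall>i\<ge>N. \<forall>j\<ge>N. s i \<ominus>\<^bsub>R\<^esub> s j \<in> max_ideal R [^]\<^bsub>ideals_set R\<^esub> n) \<longrightarrow>
        (\<exists>l\<in>carrier R. \<forall>n::nat. \<exists>N. \<forall>i\<ge>N. s i \<ominus>\<^bsub>R\<^esub> l \<in> max_ideal R [^]\<^bsub>ideals_set R\<^esub> n))"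

abbreviation ring_on :: "'a::{times,plus,one,zero} set \<Rightarrow> 'a ring" where
  "ring_on \<O> \<equiv> class_ring\<lparr>carrier := \<O>\<rparr>"

text \<open>The ring \<open>\<O>\<close> is a subset of its quotient field, which is the whole type \<open>'K\<close>. The residue
  field is the whole type \<open>'k\<close>, presented by the reduction map \<open>res\<close>, whose values outside \<open>\<O>\<close>
  are irrelevant. The kernel of \<open>res\<close> on \<open>\<O>\<close> is automatically the maximal ideal of \<open>\<O>\<close>, as
  \<open>res\<close> is onto a field.\<close>

locale p_modular_system =
  fixes p :: nat and \<O> :: "'K::field_char_0 set" and res :: "'K \<Rightarrow> 'k::field"
  assumes prime_p: "Factorial_Ring.prime p"
    and subring_\<O>: "subring \<O> (class_ring :: 'K ring)"
    and complete_dvr_\<O>: "complete_dvr (ring_on \<O>)"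
    and quotient_field: "\<And>x :: 'K. \<exists>a\<in>\<O>. \<exists>b\<in>\<O>. b \<noteq> 0 \<and> x = a / b"
    and res_hom: "res \<in> ring_hom (ring_on \<O>) class_ring"
    and res_surj: "res ` \<O> = UNIV"
    and char_k: "CHAR('k) = p"


section \<open>Matrix representations, irreducible characters, splitting fields\<close>

definition matrix_rep :: "('g, 'm) monoid_scheme \<Rightarrow> nat \<Rightarrow> ('g \<Rightarrow> 'F::field mat) \<Rightarrow> bool" where
  "matrix_rep G n \<rho> \<longleftrightarrow> \<rho> \<in> hom G (units_of (ring_mat TYPE('F) n ()))"

definition irreducible_rep :: "('g, 'm) monoid_scheme \<Rightarrow> nat \<Rightarrow> ('g \<Rightarrow> 'F::field mat) \<Rightarrow> bool" where
  "irreducible_rep G n \<rho> \<longleftrightarrow> matrix_rep G n \<rho> \<and> 0 < n \<and>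
     (\<forall>W. VectorSpace.subspace class_ring W (module_vec TYPE('F) n) \<and>
          (\<forall>x\<in>carrier G. \<forall>v\<in>W. \<rho> x *\<^sub>v v \<in> W) \<longrightarrow>
          W = {0\<^sub>v n} \<or> W = carrier_vec n)"

text \<open>\<open>F\<close> is a splitting field for \<open>G\<close> if every simple \<open>FG\<close>-module has only scalar
  endomorphisms.\<close>

definition splitting_field :: "'F::field itself \<Rightarrow> ('g, 'm) monoid_scheme \<Rightarrow> bool" where
  "splitting_field F G \<longleftrightarrow>
     (\<forall>n (\<rho> :: 'g \<Rightarrow> 'F mat). irreducible_rep G n \<rho> \<longrightarrow>
        (\<forall>A\<in>carrier_mat n n. (\<forall>x\<in>carrier G. A * \<rho> x = \<rho> x * A) \<longrightarrow>
           (\<exists>c. A = c \<cdot>\<^sub>m 1\<^sub>m n)))"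

definition mat_trace :: "'a::comm_monoid_add mat \<Rightarrow> 'a" where
  "mat_trace A = (\<Sum>i<dim_row A. A $$ (i, i))"

definition character :: "('g, 'm) monoid_scheme \<Rightarrow> ('g \<Rightarrow> 'F::field mat) \<Rightarrow> 'g \<Rightarrow> 'F" where
  "character G \<rho> = (\<lambda>x\<in>carrier G. mat_trace (\<rho> x))"

definition Irr :: "('g, 'm) monoid_scheme \<Rightarrow> ('g \<Rightarrow> 'F::field) set" where
  "Irr G = {character G \<rho> | n \<rho>. irreducible_rep G n \<rho>}"


section \<open>Brauer characters and decomposition numbers\<close>

definition p_regular :: "nat \<Rightarrow> ('g, 'm) monoid_scheme \<Rightarrow> 'g set" where
  "p_regular p G = {x \<in> carrier G. \<not> p dvd group.ord G x}"

text \<open>The unique root of unity of order prime to \<open>p\<close> in \<open>\<O>\<close> with residue \<open>a\<close>, for \<open>a\<close> a root of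
  unity in the residue field.\<close>

definition root_lift :: "nat \<Rightarrow> 'K::field set \<Rightarrow> ('K \<Rightarrow> 'k::field) \<Rightarrow> 'k \<Rightarrow> 'K" where
  "root_lift p \<O> res a = (THE z. z \<in> \<O> \<and> (\<exists>m>0. \<not> p dvd m \<and> z ^ m = 1) \<and> res z = a)"

text \<open>The Brauer character of a representation over the residue field sums the lifted eigenvalues,
  counted with algebraic multiplicity. This is meaningful when all eigenvalues of elements of
  order prime to \<open>p\<close> lie in the residue field, which holds if the latter is a splitting field for
  the cyclic subgroups of \<open>G\<close>.\<close>

definition brauer_character ::
  "nat \<Rightarrow> 'K::field set \<Rightarrow> ('K \<Rightarrow> 'k::field) \<Rightarrow> ('g, 'm) monoid_scheme \<Rightarrow> ('g \<Rightarrow> 'k mat) \<Rightarrow> 'g \<Rightarrow> 'K" where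
  "brauer_character p \<O> res G \<rho> =
     (\<lambda>x\<in>p_regular p G. \<Sum>a\<in>#proots (char_poly (\<rho> x)). root_lift p \<O> res a)"

definition IBr ::
  "nat \<Rightarrow> 'K::field set \<Rightarrow> ('K \<Rightarrow> 'k::field) \<Rightarrow> ('g, 'm) monoid_scheme \<Rightarrow> ('g \<Rightarrow> 'K) set" where
  "IBr p \<O> res G = {brauer_character p \<O> res G \<rho> | n \<rho>. irreducible_rep G n \<rho>}"

text \<open>As a function of \<open>\<phi>\<close>, the decomposition numbers are made unique by letting them vanish
  outside \<open>IBr\<close>.\<close>

definition decomposition_number ::
  "nat \<Rightarrow> 'K::field set \<Rightarrow> ('K \<Rightarrow> 'k::field) \<Rightarrow> ('g, 'm) monoid_scheme \<Rightarrow>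
   ('g \<Rightarrow> 'K) \<Rightarrow> ('g \<Rightarrow> 'K) \<Rightarrow> nat" where
  "decomposition_number p \<O> res G \<chi> =
     (THE d. (\<forall>\<phi>. \<phi> \<notin> IBr p \<O> res G \<longrightarrow> d \<phi> = 0) \<and>
             (\<forall>x\<in>p_regular p G. \<chi> x = (\<Sum>\<phi>\<in>IBr p \<O> res G. of_nat (d \<phi>) * \<phi> x)))"

definition lifts :: "nat \<Rightarrow> ('g, 'm) monoid_scheme \<Rightarrow> ('g \<Rightarrow> 'K) \<Rightarrow> ('g \<Rightarrow> 'K) \<Rightarrow> bool" where
  "lifts p G \<chi> \<phi> \<longleftrightarrow> (\<forall>x\<in>p_regular p G. \<chi> x = \<phi> x)"


section \<open>Symmetric algebras\<close>

text \<open>The locale \<^locale>\<open>algebra\<close> of the library is restricted to commutative algebras.\<close>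

locale assoc_algebra = module R A + ring A for R and A (structure) +
  assumes smult_mult_l: "\<lbrakk>c \<in> carrier R; x \<in> carrier A; y \<in> carrier A\<rbrakk>
      \<Longrightarrow> (c \<odot>\<^bsub>A\<^esub> x) \<otimes>\<^bsub>A\<^esub> y = c \<odot>\<^bsub>A\<^esub> (x \<otimes>\<^bsub>A\<^esub> y)"
    and smult_mult_r: "\<lbrakk>c \<in> carrier R; x \<in> carrier A; y \<in> carrier A\<rbrakk>
      \<Longrightarrow> x \<otimes>\<^bsub>A\<^esub> (c \<odot>\<^bsub>A\<^esub> y) = c \<odot>\<^bsub>A\<^esub> (x \<otimes>\<^bsub>A\<^esub> y)"

text \<open>Finitely generated projective: a direct summand of some free module \<open>R\<^sup>n\<close>.\<close>

definition fg_projective :: "('r, 'c) ring_scheme \<Rightarrow> ('r, 'a, 'd) module_scheme \<Rightarrow> bool" where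
  "fg_projective R M \<longleftrightarrow>
     (\<exists>n. \<exists>i \<in> module_hom R M (ring.func_space R {..<n::nat}).
          \<exists>q \<in> module_hom R (ring.func_space R {..<n}) M. \<forall>x\<in>carrier M. q (i x) = x)"

definition regular_module :: "('r, 'c) ring_scheme \<Rightarrow> ('r, 'r) module" where
  "regular_module R = \<lparr>carrier = carrier R, mult = mult R, one = one R,
     zero = zero R, add = add R, smult = mult R\<rparr>"

text \<open>The dual consists of the linear forms, with value \<^term>\<open>undefined\<close> outside the
  carrier, so that linear forms agreeing on the carrier are equal. The ring multiplication fields
  of the record play no role.\<close>

definition dual_module :: "('r, 'c) ring_scheme \<Rightarrow> ('r, 'a, 'd) module_scheme \<Rightarrow> ('r, 'a \<Rightarrow> 'r) module" where
  "dual_module R M = \<lparr>carrier = module_hom R M (regular_module R) \<inter> extensional (carrier M),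
     mult = undefined, one = undefined,
     zero = (\<lambda>x\<in>carrier M. \<zero>\<^bsub>R\<^esub>),
     add = (\<lambda>f g. \<lambda>x\<in>carrier M. f x \<oplus>\<^bsub>R\<^esub> g x),
     smult = (\<lambda>c f. \<lambda>x\<in>carrier M. c \<otimes>\<^bsub>R\<^esub> f x)\<rparr>"

text \<open>The bimodule structure on the dual is \<open>(a f b)(y) = f (b y a)\<close>.\<close>

definition symmetric_algebra :: "('r, 'c) ring_scheme \<Rightarrow> ('r, 'a, 'd) module_scheme \<Rightarrow> bool" where
  "symmetric_algebra R A \<longleftrightarrow> assoc_algebra R A \<and> fg_projective R A \<and>
     (\<exists>\<Phi> \<in> module_hom R A (dual_module R A).
        bij_betw \<Phi> (carrier A) (carrier (dual_module R A)) \<and>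
        (\<forall>a\<in>carrier A. \<forall>x\<in>carrier A. \<forall>b\<in>carrier A.
           \<Phi> (a \<otimes>\<^bsub>A\<^esub> x \<otimes>\<^bsub>A\<^esub> b) = (\<lambda>y\<in>carrier A. \<Phi> x (b \<otimes>\<^bsub>A\<^esub> y \<otimes>\<^bsub>A\<^esub> a))))"


section \<open>The group algebra and the quotient \<open>\<O>G e(\<chi>)\<close>\<close>

text \<open>An element of the group algebra of a finite group is its coefficient function, extended by
  \<open>0\<close> outside the carrier of \<open>G\<close>.\<close>

definition group_algebra :: "('g, 'm) monoid_scheme \<Rightarrow> ('F::field, 'g \<Rightarrow> 'F) module" where
  "group_algebra G = \<lparr>carrier = {f. \<forall>x. x \<notin> carrier G \<longrightarrow> f x = 0},
     mult = (\<lambda>f g x. if x \<in> carrier G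
                     then \<Sum>y\<in>carrier G. f y * g (inv\<^bsub>G\<^esub> y \<otimes>\<^bsub>G\<^esub> x) else 0),
     one = (\<lambda>x. if x = \<one>\<^bsub>G\<^esub> then 1 else 0),
     zero = (\<lambda>x. 0),
     add = (\<lambda>f g x. f x + g x),
     smult = (\<lambda>c f x. c * f x)\<rparr>"

definition char_idempotent :: "('g, 'm) monoid_scheme \<Rightarrow> ('g \<Rightarrow> 'F::field) \<Rightarrow> 'g \<Rightarrow> 'F" where
  "char_idempotent G \<chi> = (\<lambda>x. if x \<in> carrier G
     then \<chi> \<one>\<^bsub>G\<^esub> / of_nat (card (carrier G)) * \<chi> (inv\<^bsub>G\<^esub> x) else 0)"

definition order_algebra ::
  "'K::field set \<Rightarrow> ('g, 'm) monoid_scheme \<Rightarrow> ('g \<Rightarrow> 'K) \<Rightarrow> ('K, 'g \<Rightarrow> 'K) module" where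
  "order_algebra \<O> G \<chi> = (group_algebra G)
     \<lparr>carrier := {a \<otimes>\<^bsub>group_algebra G\<^esub> char_idempotent G \<chi> | a.
                    a \<in> carrier (group_algebra G) \<and> (\<forall>x\<in>carrier G. a x \<in> \<O>)},
      one := char_idempotent G \<chi>\<rparr>"

end

theory Submission
  imports Defs "HOL-Number_Theory.Residues"
begin

text \<open>
Let \<open>\<rho>\<close> be a representation of degree \<open>n\<close> that affords \<open>\<chi>\<close>. It has a \<open>G\<close>-stable \<open>\<O>\<close>-lattice
(\<open>integral_form\<close>), so its entries may be taken in \<open>\<O>\<close>. Then \<open>\<O>Ge(\<chi>)\<close> is isomorphic to the
\<open>\<O>\<close>-span \<open>\<Lambda>\<close> of the matrices \<open>\<rho> x\<close>. A symmetrizing form on \<open>\<Lambda>\<close> extends to a symmetric form on the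
algebra of all \<open>n\<close> by \<open>n\<close> matrices over \<open>'K\<close>, and these are the multiples of the trace. So there is a scalar \<open>c\<close> such
that \<open>c \<chi>\<close> takes values in \<open>\<O>\<close>, and each linear form on \<open>\<Lambda>\<close> is of the shape \<open>M \<mapsto> c tr (M N)\<close> with \<open>N\<close>
in \<open>\<Lambda>\<close> (\<open>symmetrizing_form_multiple_of_character\<close>). As \<open>\<O>\<close> is a valuation ring, either \<open>c\<close> lies
in \<open>\<O>\<close>, or \<open>1 / c\<close> lies in the maximal ideal (\<open>valuation_cases\<close>). These are the two cases of the theorem.

If \<open>c\<close> lies in \<open>\<O>\<close>, apply this to the linear form that picks a single matrix entry. It is also the form
\<open>M \<mapsto> tr (M U)\<close> for a matrix unit \<open>U\<close>, and the trace form is nondegenerate on the span of the representation, so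
\<open>U = c N\<close> belongs to \<open>\<Lambda>\<close>. Hence \<open>\<Lambda>\<close> consists of all integral matrices, the reduction of \<open>\<rho>\<close> modulo the
maximal ideal is irreducible, and \<open>\<chi>\<close> lifts its Brauer character.

If \<open>1 / c\<close> lies in the maximal ideal, so does \<open>\<chi> x = (1 / c) (c \<chi> x)\<close> for all \<open>x\<close>. Reduced modulo the maximal ideal,
the decomposition of \<open>\<chi>\<close> into irreducible Brauer characters becomes a linear relation between the traces of
pairwise inequivalent irreducible representations in characteristic \<open>p\<close>, whose coefficients are the residues of the
decomposition numbers. Such traces are linearly independent, so \<open>p\<close> divides every decomposition number.

Both the nondegeneracy of the trace form and the independence of the traces are instances of the theorem of
Frobenius and Schur on matrix coefficients (\<open>frobenius_schur\<close>). The independence also shows that the decomposition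
numbers are well defined: an integral relation between Brauer characters can be divided by \<open>p\<close> again and again
(\<open>brauer_characters_independent\<close>). The decomposition itself comes from a composition series of the reduction
(\<open>composition_series_induct\<close>), and the comparison of \<open>\<chi>\<close> with the Brauer character of the reduction from the
fact that all eigenvalues involved are roots of unity, which lift uniquely (\<open>root_of_unity_lifts\<close>,
\<open>root_of_unity_res_inj\<close>).
\<close>

section \<open>Matrix representations\<close>

lemma matrix_rep_carrier:
  assumes "matrix_rep G n \<rho>" "x \<in> carrier G"
  shows "\<rho> x \<in> carrier_mat n n"
  using assms unfolding matrix_rep_def hom_def units_of_def Units_def ring_mat_def by auto

lemma matrix_rep_mult:
  assumes "matrix_rep G n \<rho>" "x \<in> carrier G" "y \<in> carrier G"
  shows "\<rho> (x \<otimes>\<^bsub>G\<^esub> y) = \<rho> x * \<rho> y"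
  using assms unfolding matrix_rep_def hom_def units_of_def ring_mat_def by auto

lemma matrix_rep_one:
  fixes \<rho> :: "'g \<Rightarrow> 'F::field mat"
  assumes "matrix_rep G n \<rho>" "group G"
  shows "\<rho> \<one>\<^bsub>G\<^esub> = 1\<^sub>m n"
proof -
  interpret G: group G by fact
  interpret M: ring "ring_mat TYPE('F) n ()" by (rule ring_mat)
  interpret U: group "units_of (ring_mat TYPE('F) n ())" by (rule M.units_group)
  interpret h: group_hom G "units_of (ring_mat TYPE('F) n ())" \<rho>
    using assms(1) unfolding matrix_rep_def
    by (intro group_hom.intro group_hom_axioms.intro) (auto intro: U.group_axioms G.group_axioms)
  show ?thesis using h.hom_one by (simp add: units_of_def ring_mat_def)
qed

lemma matrix_repI:
  fixes \<rho> :: "'g \<Rightarrow> 'F::field mat"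
  assumes "group G" "\<And>x. x \<in> carrier G \<Longrightarrow> \<rho> x \<in> carrier_mat n n"
    "\<And>x y. x \<in> carrier G \<Longrightarrow> y \<in> carrier G \<Longrightarrow> \<rho> (x \<otimes>\<^bsub>G\<^esub> y) = \<rho> x * \<rho> y"
    "\<rho> \<one>\<^bsub>G\<^esub> = 1\<^sub>m n"
  shows "matrix_rep G n \<rho>"
proof -
  interpret G: group G by fact
  have "\<rho> x \<in> Units (ring_mat TYPE('F) n ())" if x: "x \<in> carrier G" for x
  proof -
    have "\<rho> x * \<rho> (inv\<^bsub>G\<^esub> x) = 1\<^sub>m n" "\<rho> (inv\<^bsub>G\<^esub> x) * \<rho> x = 1\<^sub>m n"
      using assms(3)[OF x G.inv_closed[OF x]] assms(3)[OF G.inv_closed[OF x] x] assms(4) x by auto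
    then show ?thesis using assms(2)[OF x] assms(2)[OF G.inv_closed[OF x]]
      unfolding Units_def ring_mat_def by auto
  qed
  then show ?thesis using assms(3) unfolding matrix_rep_def hom_def
    by (auto simp: units_of_def ring_mat_def)
qed

lemma matrix_rep_pow:
  assumes "matrix_rep G n \<rho>" "group G" "x \<in> carrier G"
  shows "\<rho> (x [^]\<^bsub>G\<^esub> (j::nat)) = \<rho> x ^\<^sub>m j"
proof -
  interpret G: group G by fact
  show ?thesis
    by (induction j) (use assms matrix_rep_carrier[OF assms(1,3)] in
        \<open>auto simp: matrix_rep_one matrix_rep_mult\<close>)
qed

lemma matrix_rep_subgroup:
  assumes "matrix_rep G n \<rho>" "group G" "subgroup H G"
  shows "matrix_rep (G\<lparr>carrier := H\<rparr>) n \<rho>"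
  using subgroup.subset[OF assms(3)] assms(1) unfolding matrix_rep_def hom_def by (auto simp: Pi_def)

lemma subspace_module_vec_iff:
  "VectorSpace.subspace class_ring W (module_vec TYPE('F::field) n) \<longleftrightarrow>
     W \<subseteq> carrier_vec n \<and> 0\<^sub>v n \<in> W \<and> (\<forall>v\<in>W. \<forall>w\<in>W. v + w \<in> W) \<and> (\<forall>c. \<forall>v\<in>W. c \<cdot>\<^sub>v v \<in> W)"
  (is "?L \<longleftrightarrow> ?R")
proof
  assume ?L
  then interpret s: submodule class_ring W "module_vec TYPE('F) n" by (rule subspace.submod)
  show ?R using s.subset s.m_closed s.zero_closed s.smult_closed
    by (auto simp: module_vec_simps)
next
  assume ?R
  then show ?L
    by (intro subspace.intro vec_vs submodule.intro vec_module) (auto simp: module_vec_simps)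
qed

lemma irreducible_rep_iff:
  fixes \<rho> :: "'g \<Rightarrow> 'F::field mat"
  shows "irreducible_rep G n \<rho> \<longleftrightarrow> matrix_rep G n \<rho> \<and> 0 < n \<and>
    (\<forall>W. W \<subseteq> carrier_vec n \<and> 0\<^sub>v n \<in> W \<and> (\<forall>v\<in>W. \<forall>w\<in>W. v + w \<in> W) \<and> (\<forall>c. \<forall>v\<in>W. c \<cdot>\<^sub>v v \<in> W) \<and>
      (\<forall>x\<in>carrier G. \<forall>v\<in>W. \<rho> x *\<^sub>v v \<in> W) \<longrightarrow> W = {0\<^sub>v n} \<or> W = carrier_vec n)"
  unfolding irreducible_rep_def subspace_module_vec_iff by (simp only: conj_assoc)

lemma irreducible_repD:
  fixes \<rho> :: "'g \<Rightarrow> 'F::field mat"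
  assumes "irreducible_rep G n \<rho>"
  shows "matrix_rep G n \<rho>" "0 < n"
    "\<lbrakk>W \<subseteq> carrier_vec n; 0\<^sub>v n \<in> W; \<And>v w. v \<in> W \<Longrightarrow> w \<in> W \<Longrightarrow> v + w \<in> W;
      \<And>c v. v \<in> W \<Longrightarrow> c \<cdot>\<^sub>v v \<in> W; \<And>x v. x \<in> carrier G \<Longrightarrow> v \<in> W \<Longrightarrow> \<rho> x *\<^sub>v v \<in> W\<rbrakk>
     \<Longrightarrow> W = {0\<^sub>v n} \<or> W = carrier_vec n"
proof -
  note a = assms[unfolded irreducible_rep_iff]
  show "matrix_rep G n \<rho>" "0 < n" using a by simp_all
  assume "W \<subseteq> carrier_vec n" "0\<^sub>v n \<in> W" "\<And>v w. v \<in> W \<Longrightarrow> w \<in> W \<Longrightarrow> v + w \<in> W"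
      "\<And>c v. v \<in> W \<Longrightarrow> c \<cdot>\<^sub>v v \<in> W" "\<And>x v. x \<in> carrier G \<Longrightarrow> v \<in> W \<Longrightarrow> \<rho> x *\<^sub>v v \<in> W"
  then show "W = {0\<^sub>v n} \<or> W = carrier_vec n"
    by (intro a[THEN conjunct2, THEN conjunct2, rule_format]) simp
qed

lemma irreducible_repI:
  fixes \<rho> :: "'g \<Rightarrow> 'F::field mat"
  assumes "matrix_rep G n \<rho>" "0 < n"
    "\<And>W. \<lbrakk>W \<subseteq> carrier_vec n; 0\<^sub>v n \<in> W; \<And>v w. v \<in> W \<Longrightarrow> w \<in> W \<Longrightarrow> v + w \<in> W;
      \<And>c v. v \<in> W \<Longrightarrow> c \<cdot>\<^sub>v v \<in> W; \<And>x v. x \<in> carrier G \<Longrightarrow> v \<in> W \<Longrightarrow> \<rho> x *\<^sub>v v \<in> W\<rbrakk>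
     \<Longrightarrow> W = {0\<^sub>v n} \<or> W = carrier_vec n"
  shows "irreducible_rep G n \<rho>"
  unfolding irreducible_rep_iff using assms(1,2) by (intro conjI allI impI assms(3)) simp_all

lemma mat_trace_mult_comm:
  fixes A B :: "'a::comm_semiring_0 mat"
  assumes "A \<in> carrier_mat m n" "B \<in> carrier_mat n m"
  shows "mat_trace (A * B) = mat_trace (B * A)"
proof -
  have "mat_trace (A * B) = (\<Sum>i<m. \<Sum>k<n. A $$ (i,k) * B $$ (k,i))"
    using assms by (auto simp: mat_trace_def scalar_prod_def atLeast0LessThan intro!: sum.cong)
  also have "\<dots> = (\<Sum>k<n. \<Sum>i<m. B $$ (k,i) * A $$ (i,k))"
    by (subst sum.swap) (simp add: mult.commute)
  also have "\<dots> = mat_trace (B * A)"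
    using assms by (auto simp: mat_trace_def scalar_prod_def atLeast0LessThan intro!: sum.cong)
  finally show ?thesis .
qed

lemma mat_trace_conj:
  fixes A :: "'a::comm_ring_1 mat"
  assumes "A \<in> carrier_mat n n" "P \<in> carrier_mat n n" "Q \<in> carrier_mat n n" "Q * P = 1\<^sub>m n"
  shows "mat_trace (P * A * Q) = mat_trace A"
proof -
  have "mat_trace (P * A * Q) = mat_trace (Q * (P * A))"
    using assms by (intro mat_trace_mult_comm[of _ n n]) auto
  also have "Q * (P * A) = (Q * P) * A" using assms assoc_mult_mat[of Q n n P n A n] by simp
  finally show ?thesis using assms by simp
qed

lemma mat_trace_smult:
  assumes "A \<in> carrier_mat n n"
  shows "mat_trace (c \<cdot>\<^sub>m A) = (c::'a::comm_ring_1) * mat_trace A"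
  using assms by (auto simp: mat_trace_def sum_distrib_left)

lemma mat_trace_one: "mat_trace (1\<^sub>m n :: 'a::comm_ring_1 mat) = of_nat n"
  by (simp add: mat_trace_def)

section \<open>Schur's lemma\<close>

lemma linear_fun_is_matrix:
  fixes f :: "'F::field vec \<Rightarrow> 'F vec"
  assumes car: "\<And>v. v \<in> carrier_vec n \<Longrightarrow> f v \<in> carrier_vec m"
    and add: "\<And>v w. v \<in> carrier_vec n \<Longrightarrow> w \<in> carrier_vec n \<Longrightarrow> f (v + w) = f v + f w"
    and smult: "\<And>c v. v \<in> carrier_vec n \<Longrightarrow> f (c \<cdot>\<^sub>v v) = c \<cdot>\<^sub>v f v"
  shows "\<exists>A\<in>carrier_mat m n. \<forall>v\<in>carrier_vec n. f v = A *\<^sub>v v"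
proof -
  define A where "A = mat m n (\<lambda>(i,j). f (unit_vec n j) $ i)"
  have A: "A \<in> carrier_mat m n" by (simp add: A_def)
  have "f v = A *\<^sub>v v" if "k \<le> n" "v \<in> carrier_vec n" "\<And>i. k \<le> i \<Longrightarrow> i < n \<Longrightarrow> v $ i = 0" for k v
    using that
  proof (induction k arbitrary: v)
    case 0
    then have v: "v = 0\<^sub>v n" by (intro eq_vecI) auto
    have "f (0 \<cdot>\<^sub>v v) = 0 \<cdot>\<^sub>v f v" using smult 0 by blast
    moreover have "0 \<cdot>\<^sub>v v = v" using v by auto
    moreover have "0 \<cdot>\<^sub>v f v = 0\<^sub>v m" using car[OF 0(2)] by auto
    moreover have "A *\<^sub>v v = 0\<^sub>v m" using A v by auto
    ultimately show ?case by simp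
  next
    case (Suc k)
    define v' where "v' = vec n (\<lambda>i. if i = k then 0 else v $ i)"
    have v': "v' \<in> carrier_vec n" by (simp add: v'_def)
    have dec: "v = v' + v $ k \<cdot>\<^sub>v unit_vec n k"
      using Suc.prems by (intro eq_vecI) (auto simp: v'_def)
    have "f v' = A *\<^sub>v v'"
      using Suc.prems by (intro Suc.IH) (auto simp: v'_def)
    moreover have "f (unit_vec n k) = A *\<^sub>v unit_vec n k"
      using Suc.prems car[of "unit_vec n k"]
      by (intro eq_vecI) (auto simp: A_def)
    moreover have "A *\<^sub>v (v' + v $ k \<cdot>\<^sub>v unit_vec n k) = A *\<^sub>v v' + v $ k \<cdot>\<^sub>v (A *\<^sub>v unit_vec n k)"
      using A v' by (simp add: mult_add_distrib_mat_vec[OF A] mult_mat_vec[OF A])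
    moreover have "f (v' + v $ k \<cdot>\<^sub>v unit_vec n k) = f v' + v $ k \<cdot>\<^sub>v f (unit_vec n k)"
      using add smult v' by simp
    ultimately show ?case using dec by metis
  qed
  from this[of n] A show ?thesis by auto
qed

lemma mat_eqI_mult_vec:
  fixes A B :: "'F::field mat"
  assumes "A \<in> carrier_mat m n" "B \<in> carrier_mat m n"
    "\<And>v. v \<in> carrier_vec n \<Longrightarrow> A *\<^sub>v v = B *\<^sub>v v"
  shows "A = B"
proof (rule eq_matI)
  fix i j assume ij: "i < dim_row B" "j < dim_col B"
  have "(A *\<^sub>v unit_vec n j) $ i = (B *\<^sub>v unit_vec n j) $ i" using assms(3) by simp
  then show "A $$ (i, j) = B $$ (i, j)" using assms(1,2) ij by simp
qed (use assms in auto)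

text \<open>Padded with zero rows, the matrix becomes square and singular.\<close>

lemma wide_matrix_kernel:
  fixes A :: "'F::field mat"
  assumes A: "A \<in> carrier_mat m n" and "m < n"
  shows "\<exists>v\<in>carrier_vec n. v \<noteq> 0\<^sub>v n \<and> A *\<^sub>v v = 0\<^sub>v m"
proof -
  define A' where "A' = mat n n (\<lambda>(i,j). if i < m then A $$ (i,j) else 0)"
  have A': "A' \<in> carrier_mat n n" by (simp add: A'_def)
  have "transpose_mat A' *\<^sub>v unit_vec n m = 0\<^sub>v n"
    using assms A' by (intro eq_vecI) (auto simp: A'_def)
  moreover have "unit_vec n m \<noteq> (0\<^sub>v n :: 'F vec)"
    using \<open>m < n\<close> by (metis index_unit_vec(2) index_zero_vec(1) zero_neq_one)
  ultimately have "det (transpose_mat A') = 0"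
    using det_0_iff_vec_prod_zero_field[of "transpose_mat A'" n] A' by (auto intro!: unit_vec_carrier)
  then have "det A' = 0" using det_transpose[OF A'] by simp
  then obtain v where v: "v \<in> carrier_vec n" "v \<noteq> 0\<^sub>v n" "A' *\<^sub>v v = 0\<^sub>v n"
    using det_0_iff_vec_prod_zero_field[OF A'] by auto
  have "A *\<^sub>v v = 0\<^sub>v m"
  proof (rule eq_vecI)
    fix i assume "i < dim_vec (0\<^sub>v m :: 'F vec)"
    then have i: "i < m" by simp
    have "(A' *\<^sub>v v) $ i = 0" using v(3) i assms(2) by simp
    moreover have "(A' *\<^sub>v v) $ i = (A *\<^sub>v v) $ i"
      using i assms v(1) by (auto simp: A'_def scalar_prod_def)
    ultimately show "(A *\<^sub>v v) $ i = (0\<^sub>v m :: 'F vec) $ i" using i by simp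
  qed (use A in auto)
  with v show ?thesis by auto
qed

definition equivalent_reps ::
  "('g, 'm) monoid_scheme \<Rightarrow> nat \<Rightarrow> ('g \<Rightarrow> 'F::field mat) \<Rightarrow> ('g \<Rightarrow> 'F mat) \<Rightarrow> bool" where
  "equivalent_reps G n \<rho> \<sigma> \<longleftrightarrow> (\<exists>A\<in>carrier_mat n n. \<exists>B\<in>carrier_mat n n.
     A * B = 1\<^sub>m n \<and> B * A = 1\<^sub>m n \<and> (\<forall>x\<in>carrier G. \<sigma> x = A * \<rho> x * B))"

text \<open>Kernel and image of a nonzero intertwiner are invariant subspaces, so it is bijective, and its
  inverse is again given by a matrix. A matrix that is not square has a kernel on one of the two
  sides, which rules out different dimensions.\<close>

lemma schur_intertwiner:
  fixes A :: "'F::field mat"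
  assumes \<rho>: "irreducible_rep G n \<rho>" and \<sigma>: "irreducible_rep G m \<sigma>"
    and A: "A \<in> carrier_mat m n" and int: "\<And>x. x \<in> carrier G \<Longrightarrow> A * \<rho> x = \<sigma> x * A"
    and nz: "A \<noteq> 0\<^sub>m m n"
  shows "m = n \<and> equivalent_reps G n \<rho> \<sigma>"
proof -
  note r = matrix_rep_carrier[OF irreducible_repD(1)[OF \<rho>]]
  note s = matrix_rep_carrier[OF irreducible_repD(1)[OF \<sigma>]]
  have int': "A *\<^sub>v (\<rho> x *\<^sub>v v) = \<sigma> x *\<^sub>v (A *\<^sub>v v)" if "x \<in> carrier G" "v \<in> carrier_vec n" for x v
    using int[OF that(1)] that A r s
    by (metis assoc_mult_mat_vec)
  let ?K = "{v \<in> carrier_vec n. A *\<^sub>v v = 0\<^sub>v m}"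
  let ?I = "(\<lambda>v. A *\<^sub>v v) ` carrier_vec n"
  have "?K = {0\<^sub>v n} \<or> ?K = carrier_vec n"
  proof (rule irreducible_repD(3)[OF \<rho>])
    show "\<rho> x *\<^sub>v v \<in> ?K" if "x \<in> carrier G" "v \<in> ?K" for x v
      using that int'[of x v] r[of x] s[of x] by auto
  qed (use A in \<open>auto simp: mult_add_distrib_mat_vec[OF A] mult_mat_vec[OF A]\<close>)
  moreover have "?K \<noteq> carrier_vec n"
  proof
    assume K: "?K = carrier_vec n"
    have "A *\<^sub>v v = 0\<^sub>m m n *\<^sub>v v" if "v \<in> carrier_vec n" for v
    proof -
      have "v \<in> ?K" using that K by simp
      then show ?thesis using that by (intro eq_vecI) auto
    qed
    then have "A = 0\<^sub>m m n" by (intro mat_eqI_mult_vec[OF A]) auto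
    with nz show False by simp
  qed
  ultimately have ker: "?K = {0\<^sub>v n}" by blast
  have "?I = {0\<^sub>v m} \<or> ?I = carrier_vec m"
  proof (rule irreducible_repD(3)[OF \<sigma>])
    show "?I \<subseteq> carrier_vec m" using A by auto
    show "0\<^sub>v m \<in> ?I" using A by (intro image_eqI[of _ _ "0\<^sub>v n"]) auto
    show "v + w \<in> ?I" if "v \<in> ?I" "w \<in> ?I" for v w
      using that by (auto simp: mult_add_distrib_mat_vec[OF A, symmetric])
    show "c \<cdot>\<^sub>v v \<in> ?I" if "v \<in> ?I" for c v
      using that by (auto simp: mult_mat_vec[OF A, symmetric])
    show "\<sigma> x *\<^sub>v v \<in> ?I" if x: "x \<in> carrier G" and v: "v \<in> ?I" for x v
    proof -
      from v obtain u where u: "u \<in> carrier_vec n" "v = A *\<^sub>v u" by auto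
      then show ?thesis using int'[OF x u(1)] r[OF x] by (intro image_eqI[of _ _ "\<rho> x *\<^sub>v u"]) auto
    qed
  qed
  moreover have "?I \<noteq> {0\<^sub>v m}"
  proof
    assume "?I = {0\<^sub>v m}"
    then have "?K = carrier_vec n" by auto
    then show False using \<open>?K \<noteq> carrier_vec n\<close> by simp
  qed
  ultimately have im: "?I = carrier_vec m" by blast
  have inj: "v = w" if "v \<in> carrier_vec n" "w \<in> carrier_vec n" "A *\<^sub>v v = A *\<^sub>v w" for v w
  proof -
    have "A *\<^sub>v w \<in> carrier_vec m" using A that by auto
    then have "A *\<^sub>v (v - w) = 0\<^sub>v m" using that A
      by (simp add: mult_minus_distrib_mat_vec[OF A])
    then have "v - w \<in> ?K" using that by auto
    then have 0: "v - w = 0\<^sub>v n" unfolding ker by simp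
    show ?thesis
    proof (rule eq_vecI)
      fix i assume "i < dim_vec w"
      then show "v $ i = w $ i" using arg_cong[OF 0, of "\<lambda>u. u $ i"] that by auto
    qed (use that in auto)
  qed
  define g where "g w = (SOME v. v \<in> carrier_vec n \<and> A *\<^sub>v v = w)" for w
  have g: "g w \<in> carrier_vec n \<and> A *\<^sub>v g w = w" if w: "w \<in> carrier_vec m" for w
  proof -
    from w im have "w \<in> ?I" by blast
    then have "\<exists>v. v \<in> carrier_vec n \<and> A *\<^sub>v v = w" by blast
    then show ?thesis unfolding g_def by (rule someI_ex)
  qed
  have "\<exists>B\<in>carrier_mat n m. \<forall>v\<in>carrier_vec m. g v = B *\<^sub>v v"
  proof (rule linear_fun_is_matrix)
    show "g (v + w) = g v + g w" if "v \<in> carrier_vec m" "w \<in> carrier_vec m" for v w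
      by (rule inj) (use g that in \<open>auto simp: mult_add_distrib_mat_vec[OF A]\<close>)
    show "g (c \<cdot>\<^sub>v v) = c \<cdot>\<^sub>v g v" if "v \<in> carrier_vec m" for c v
      by (rule inj) (use g that in \<open>auto simp: mult_mat_vec[OF A]\<close>)
  qed (use g in auto)
  then obtain B where B: "B \<in> carrier_mat n m" "\<And>v. v \<in> carrier_vec m \<Longrightarrow> g v = B *\<^sub>v v" by auto
  have ABv: "A *\<^sub>v (B *\<^sub>v v) = v" if "v \<in> carrier_vec m" for v
    using g[OF that] B(2)[OF that] by simp
  have AB: "A * B = 1\<^sub>m m"
    using A B(1) ABv
    by (intro mat_eqI_mult_vec[of _ m m]) (auto simp: assoc_mult_mat_vec[OF A B(1)])
  have BA: "B * A = 1\<^sub>m n"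
  proof (rule mat_eqI_mult_vec[of _ n n])
    fix v :: "'F vec" assume v: "v \<in> carrier_vec n"
    have Av: "A *\<^sub>v v \<in> carrier_vec m" using A v by auto
    have "B *\<^sub>v (A *\<^sub>v v) = v" by (rule inj) (use v B(1) Av ABv[OF Av] in auto)
    then show "B * A *\<^sub>v v = 1\<^sub>m n *\<^sub>v v"
      using v by (auto simp: assoc_mult_mat_vec[OF B(1) A v])
  qed (use A B in auto)
  have "m = n"
  proof (rule ccontr)
    assume "m \<noteq> n"
    then consider "m < n" | "n < m" by linarith
    then show False
    proof cases
      case 1
      then show False using wide_matrix_kernel[OF A] ker by blast
    next
      case 2
      then obtain v where v: "v \<in> carrier_vec m" "v \<noteq> 0\<^sub>v m" "B *\<^sub>v v = 0\<^sub>v n"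
        using wide_matrix_kernel[OF B(1)] by blast
      have "v = A *\<^sub>v (B *\<^sub>v v)" using ABv[OF v(1)] by simp
      moreover have "A *\<^sub>v 0\<^sub>v n = 0\<^sub>v m" using A by (intro eq_vecI) auto
      ultimately show False using v by simp
    qed
  qed
  moreover have "\<sigma> x = A * \<rho> x * B" if "x \<in> carrier G" for x
  proof -
    have "A * \<rho> x * B = \<sigma> x * A * B" using int[OF that] by simp
    also have "\<dots> = \<sigma> x * (A * B)" using A B s[OF that] by simp
    finally show ?thesis using AB s[OF that] by simp
  qed
  ultimately show ?thesis using A B AB BA unfolding equivalent_reps_def by blast
qed

section \<open>The theorem of Frobenius and Schur\<close>

text \<open>The theorem of Frobenius and Schur: the matrix coefficients of pairwise inequivalent absolutely
  irreducible representations are linearly independent. For one representation this is Burnside's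
  theorem, for scalar matrices \<open>M i\<close> it is the independence of irreducible traces in any
  characteristic.

  The families \<open>M\<close> that satisfy the relation form a subspace on which the group acts by multiplication
  from the left. A family is viewed here as a family of column vectors, indexed by the pairs of a representation and a column
  number. In a nonzero family with as few nonzero columns as possible, each nonzero column determines
  all the others, and does so through an intertwiner. By Schur's lemma the nonzero columns then belong
  to a single representation and are fixed multiples of one vector, which can be chosen at will; the
  relation at the identity of \<open>G\<close> cannot hold for every choice.\<close>

theorem frobenius_schur:
  fixes \<rho> :: "'i \<Rightarrow> 'g \<Rightarrow> 'F::field mat"
  assumes G: "group G" and fin: "finite I"
    and irr: "\<And>i. i \<in> I \<Longrightarrow> irreducible_rep G (n i) (\<rho> i)"
    and schur: "\<And>i A. i \<in> I \<Longrightarrow> A \<in> carrier_mat (n i) (n i) \<Longrightarrow>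
      (\<And>x. x \<in> carrier G \<Longrightarrow> A * \<rho> i x = \<rho> i x * A) \<Longrightarrow> \<exists>c. A = c \<cdot>\<^sub>m 1\<^sub>m (n i)"
    and ineq: "\<And>i j. i \<in> I \<Longrightarrow> j \<in> I \<Longrightarrow> n i = n j \<Longrightarrow> equivalent_reps G (n i) (\<rho> i) (\<rho> j) \<Longrightarrow> i = j"
    and M: "\<And>i. i \<in> I \<Longrightarrow> M i \<in> carrier_mat (n i) (n i)"
    and rel: "\<And>x. x \<in> carrier G \<Longrightarrow> (\<Sum>i\<in>I. mat_trace (\<rho> i x * M i)) = 0"
    and i: "i \<in> I"
  shows "M i = 0\<^sub>m (n i) (n i)"
proof -
  interpret G: group G by fact
  define J where "J = Sigma I (\<lambda>i. {..<n i})"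
  define N where "N c = n (fst c)" for c :: "'i \<times> nat"
  define R where "R c = \<rho> (fst c)" for c :: "'i \<times> nat"
  have finJ: "finite J" using fin by (simp add: J_def)
  have J: "irreducible_rep G (N c) (R c)" "snd c < N c" if "c \<in> J" for c
    using that irr by (auto simp: J_def N_def R_def)
  note RJ = irreducible_repD(1)[OF J(1)]
  note Rc = matrix_rep_carrier[OF RJ]
  \<comment> \<open>The space of relations, written in columns.\<close>
  define Rel where "Rel = {X. (\<forall>c\<in>J. X c \<in> carrier_vec (N c)) \<and>
     (\<forall>x\<in>carrier G. (\<Sum>c\<in>J. (R c x *\<^sub>v X c) $ snd c) = 0)}"
  define supp where "supp X = {c \<in> J. X c \<noteq> 0\<^sub>v (N c)}" for X :: "'i \<times> nat \<Rightarrow> 'F vec"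
  have finsupp: "finite (supp X)" for X using finJ by (simp add: supp_def)
  have RelD: "X c \<in> carrier_vec (N c)" "x \<in> carrier G \<Longrightarrow> (\<Sum>c\<in>J. (R c x *\<^sub>v X c) $ snd c) = 0"
    if "X \<in> Rel" "c \<in> J" for X c x using that by (auto simp: Rel_def)
  have Rel_add: "(\<lambda>c. X c + Y c) \<in> Rel" if X: "X \<in> Rel" and Y: "Y \<in> Rel" for X Y
  proof -
    have "(\<Sum>c\<in>J. (R c x *\<^sub>v (X c + Y c)) $ snd c) = 0" if x: "x \<in> carrier G" for x
    proof -
      have "(\<Sum>c\<in>J. (R c x *\<^sub>v (X c + Y c)) $ snd c) =
          (\<Sum>c\<in>J. (R c x *\<^sub>v X c) $ snd c + (R c x *\<^sub>v Y c) $ snd c)"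
      proof (rule sum.cong)
        fix c assume c: "c \<in> J"
        show "(R c x *\<^sub>v (X c + Y c)) $ snd c = (R c x *\<^sub>v X c) $ snd c + (R c x *\<^sub>v Y c) $ snd c"
          using Rc[OF c x] J(2)[OF c]
          by (simp add: mult_add_distrib_mat_vec[OF Rc[OF c x] RelD(1)[OF X c] RelD(1)[OF Y c]])
      qed simp
      then show ?thesis using X Y x by (simp add: sum.distrib Rel_def)
    qed
    then show ?thesis using X Y by (auto simp: Rel_def)
  qed
  have Rel_smult: "(\<lambda>c. a \<cdot>\<^sub>v X c) \<in> Rel" if X: "X \<in> Rel" for X a
  proof -
    have "(\<Sum>c\<in>J. (R c x *\<^sub>v (a \<cdot>\<^sub>v X c)) $ snd c) = 0" if x: "x \<in> carrier G" for x
    proof -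
      have "(\<Sum>c\<in>J. (R c x *\<^sub>v (a \<cdot>\<^sub>v X c)) $ snd c) = (\<Sum>c\<in>J. a * (R c x *\<^sub>v X c) $ snd c)"
      proof (rule sum.cong)
        fix c assume c: "c \<in> J"
        show "(R c x *\<^sub>v (a \<cdot>\<^sub>v X c)) $ snd c = a * (R c x *\<^sub>v X c) $ snd c"
          using Rc[OF c x] J(2)[OF c] by (simp add: mult_mat_vec[OF Rc[OF c x] RelD(1)[OF X c]])
      qed simp
      then show ?thesis using X x by (simp add: sum_distrib_left[symmetric] Rel_def)
    qed
    then show ?thesis using X by (auto simp: Rel_def)
  qed
  have Rel_act: "(\<lambda>c. R c y *\<^sub>v X c) \<in> Rel" if X: "X \<in> Rel" and y: "y \<in> carrier G" for X y
  proof -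
    have "(\<Sum>c\<in>J. (R c x *\<^sub>v (R c y *\<^sub>v X c)) $ snd c) = 0" if x: "x \<in> carrier G" for x
    proof -
      have "(\<Sum>c\<in>J. (R c x *\<^sub>v (R c y *\<^sub>v X c)) $ snd c) = (\<Sum>c\<in>J. (R c (x \<otimes>\<^bsub>G\<^esub> y) *\<^sub>v X c) $ snd c)"
      proof (rule sum.cong)
        fix c assume c: "c \<in> J"
        show "(R c x *\<^sub>v (R c y *\<^sub>v X c)) $ snd c = (R c (x \<otimes>\<^bsub>G\<^esub> y) *\<^sub>v X c) $ snd c"
          by (simp add: matrix_rep_mult[OF RJ[OF c] x y]
              assoc_mult_mat_vec[OF Rc[OF c x] Rc[OF c y] RelD(1)[OF X c]])
      qed simp
      then show ?thesis using X x y by (simp add: Rel_def)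
    qed
    moreover have "R c y *\<^sub>v X c \<in> carrier_vec (N c)" if "c \<in> J" for c
      by (rule mult_mat_vec_carrier[OF Rc[OF that y] RelD(1)[OF X that]])
    ultimately show ?thesis unfolding Rel_def by simp
  qed
  have empty: "supp X = {}" if "X \<in> Rel" for X
  proof (rule ccontr)
    assume "supp X \<noteq> {}"
    with that obtain X0 where X0: "X0 \<in> Rel" "supp X0 \<noteq> {}"
      and min: "\<And>Y. Y \<in> Rel \<Longrightarrow> supp Y \<noteq> {} \<Longrightarrow> card (supp X0) \<le> card (supp Y)"
      using ex_has_least_nat[of "\<lambda>X. X \<in> Rel \<and> supp X \<noteq> {}" X "\<lambda>X. card (supp X)"] by blast
    define C where "C = supp X0"
    have CJ: "C \<subseteq> J" by (auto simp: C_def supp_def)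
    obtain c0 where c0: "c0 \<in> C" using X0(2) by (auto simp: C_def)
    then have c0J: "c0 \<in> J" using CJ by auto
    \<comment> \<open>A relation supported on the minimal support \<open>C\<close> is determined by its column at \<open>c0\<close>.\<close>
    define D where "D = {X \<in> Rel. supp X \<subseteq> C}"
    have DRel: "X \<in> Rel" if "X \<in> D" for X using that by (simp add: D_def)
    have Dout: "X c = 0\<^sub>v (N c)" if "X \<in> D" "c \<in> J" "c \<notin> C" for X c
      using that by (auto simp: D_def supp_def)
    have D_zero: "X c = 0\<^sub>v (N c)" if "X \<in> D" "X c0 = 0\<^sub>v (N c0)" "c \<in> J" for X c
    proof -
      have "supp X \<subset> C" using that c0 by (auto simp: D_def supp_def)
      then have "card (supp X) < card C" using finsupp[of X0] unfolding C_def by (intro psubset_card_mono)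
      then have "supp X = {}" using min[OF DRel[OF that(1)]] unfolding C_def by linarith
      then show ?thesis using that(3) unfolding supp_def by blast
    qed
    have DI: "X \<in> D" if "X \<in> Rel" "\<And>c. c \<in> J \<Longrightarrow> c \<notin> C \<Longrightarrow> X c = 0\<^sub>v (N c)" for X
      using that unfolding D_def supp_def by blast
    have D_add: "(\<lambda>c. X c + Y c) \<in> D" if "X \<in> D" "Y \<in> D" for X Y
      by (rule DI[OF Rel_add]) (simp_all add: DRel that Dout[OF that(1)] Dout[OF that(2)])
    have D_smult: "(\<lambda>c. a \<cdot>\<^sub>v X c) \<in> D" if "X \<in> D" for X a
    proof (rule DI[OF Rel_smult])
      fix c assume "c \<in> J" "c \<notin> C"
      then show "a \<cdot>\<^sub>v X c = 0\<^sub>v (N c)"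
        using that Dout[of X c] by (intro eq_vecI) auto
    qed (use that DRel in simp_all)
    have D_act: "(\<lambda>c. R c y *\<^sub>v X c) \<in> D" if "X \<in> D" "y \<in> carrier G" for X y
    proof (rule DI[OF Rel_act])
      fix c assume "c \<in> J" "c \<notin> C"
      then show "R c y *\<^sub>v X c = 0\<^sub>v (N c)"
        using that Dout[of X c] Rc[of c y] by (intro eq_vecI) auto
    qed (use that DRel in simp_all)
    have D_uniq: "X c = Y c" if "X \<in> D" "Y \<in> D" "X c0 = Y c0" "c \<in> J" for X Y c
    proof -
      note XY = RelD(1)[OF DRel[OF that(1)]] RelD(1)[OF DRel[OF that(2)]]
      have "(\<lambda>c. X c + (-1) \<cdot>\<^sub>v Y c) \<in> D" using that by (intro D_add D_smult)
      moreover have "X c0 + (-1) \<cdot>\<^sub>v Y c0 = 0\<^sub>v (N c0)"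
        unfolding that(3) using XY(2)[OF c0J] by (intro eq_vecI) auto
      ultimately have 0: "X c + (-1) \<cdot>\<^sub>v Y c = 0\<^sub>v (N c)" using that(4) by (rule D_zero)
      show ?thesis
      proof (rule eq_vecI)
        fix j assume "j < dim_vec (Y c)"
        then show "X c $ j = Y c $ j" using arg_cong[OF 0, of "\<lambda>u. u $ j"] XY[OF that(4)] by auto
      qed (use XY[OF that(4)] in auto)
    qed
    have X0D: "X0 \<in> D" using X0 by (simp add: D_def C_def)
    let ?V = "(\<lambda>X. X c0) ` D"
    have "?V = {0\<^sub>v (N c0)} \<or> ?V = carrier_vec (N c0)"
    proof (rule irreducible_repD(3)[OF J(1)[OF c0J]])
      show "?V \<subseteq> carrier_vec (N c0)" using RelD(1)[OF DRel c0J] by blast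
      show "0\<^sub>v (N c0) \<in> ?V"
        using RelD(1)[OF X0(1) c0J] by (intro image_eqI[OF _ D_smult[OF X0D, of 0]]) auto
      show "v + w \<in> ?V" if "v \<in> ?V" "w \<in> ?V" for v w
      proof -
        from that obtain X Y where "X \<in> D" "Y \<in> D" "v = X c0" "w = Y c0" by auto
        then show ?thesis by (intro image_eqI[OF _ D_add[of X Y]]) auto
      qed
      show "a \<cdot>\<^sub>v v \<in> ?V" if "v \<in> ?V" for a v
      proof -
        from that obtain X where "X \<in> D" "v = X c0" by auto
        then show ?thesis by (intro image_eqI[OF _ D_smult[of X a]]) auto
      qed
      show "R c0 y *\<^sub>v v \<in> ?V" if "y \<in> carrier G" "v \<in> ?V" for y v
      proof -
        from that obtain X where "X \<in> D" "v = X c0" by auto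
        then show ?thesis using that(1) by (intro image_eqI[OF _ D_act[of X y]]) auto
      qed
    qed
    moreover have "X0 c0 \<noteq> 0\<^sub>v (N c0)" using c0 by (simp add: C_def supp_def)
    ultimately have V: "?V = carrier_vec (N c0)" using X0D by blast
    \<comment> \<open>\<open>g v\<close> is the relation in \<open>D\<close> with column \<open>v\<close> at \<open>c0\<close>; its column at \<open>c\<close> is \<open>A c\<close> applied to \<open>v\<close>.\<close>
    define g where "g v = (SOME X. X \<in> D \<and> X c0 = v)" for v
    have g: "g v \<in> D \<and> g v c0 = v" if v: "v \<in> carrier_vec (N c0)" for v
    proof -
      have "v \<in> ?V" using v V by simp
      then have "\<exists>X. X \<in> D \<and> X c0 = v" by blast
      then show ?thesis unfolding g_def by (rule someI_ex)
    qed
    have "\<exists>A\<in>carrier_mat (N c) (N c0). \<forall>v\<in>carrier_vec (N c0). g v c = A *\<^sub>v v" if c: "c \<in> J" for c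
    proof (rule linear_fun_is_matrix)
      show "g v c \<in> carrier_vec (N c)" if "v \<in> carrier_vec (N c0)" for v
        using g[OF that] RelD(1)[OF DRel _] c by auto
      show "g (v + w) c = g v c + g w c" if "v \<in> carrier_vec (N c0)" "w \<in> carrier_vec (N c0)" for v w
        by (rule D_uniq[OF _ D_add[of "g v" "g w"] _ c]) (use g[OF that(1)] g[OF that(2)] g[of "v + w"] that in auto)
      show "g (a \<cdot>\<^sub>v v) c = a \<cdot>\<^sub>v g v c" if "v \<in> carrier_vec (N c0)" for a v
        by (rule D_uniq[OF _ D_smult[of "g v" a] _ c]) (use g[OF that(1)] g[of "a \<cdot>\<^sub>v v"] that in auto)
    qed
    then obtain A where A: "\<And>c. c \<in> J \<Longrightarrow> A c \<in> carrier_mat (N c) (N c0)"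
      and gA: "\<And>c v. c \<in> J \<Longrightarrow> v \<in> carrier_vec (N c0) \<Longrightarrow> g v c = A c *\<^sub>v v" by metis
    have int: "A c * R c0 x = R c x * A c" if c: "c \<in> J" and x: "x \<in> carrier G" for c x
    proof (rule mat_eqI_mult_vec)
      fix v :: "'F vec" assume v: "v \<in> carrier_vec (N c0)"
      have Rv: "R c0 x *\<^sub>v v \<in> carrier_vec (N c0)" using Rc[OF c0J x] v by auto
      have "g (R c0 x *\<^sub>v v) c = R c x *\<^sub>v g v c"
        by (rule D_uniq[OF _ D_act[of "g v" x] _ c]) (use g[OF v] g[OF Rv] x in auto)
      then show "A c * R c0 x *\<^sub>v v = R c x * A c *\<^sub>v v"
        using gA[OF c v] gA[OF c Rv] assoc_mult_mat_vec[OF A[OF c] Rc[OF c0J x] v]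
          assoc_mult_mat_vec[OF Rc[OF c x] A[OF c] v] by simp
    qed (use A[OF c] Rc[OF c x] Rc[OF c0J x] in auto)
    have scalar: "fst c = fst c0 \<and> (\<exists>a. A c = a \<cdot>\<^sub>m 1\<^sub>m (N c0))" if c: "c \<in> C" for c
    proof -
      have cJ: "c \<in> J" using c CJ by auto
      note X0c = RelD(1)[OF X0(1) c0J]
      have "X0 c = g (X0 c0) c" by (rule D_uniq[OF X0D _ _ cJ]) (use g[OF X0c] in auto)
      then have "X0 c = A c *\<^sub>v X0 c0" using gA[OF cJ X0c] by simp
      moreover have "X0 c \<noteq> 0\<^sub>v (N c)" using c by (simp add: C_def supp_def)
      moreover have "0\<^sub>m (N c) (N c0) *\<^sub>v X0 c0 = 0\<^sub>v (N c)" using X0c by (intro eq_vecI) auto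
      ultimately have "A c \<noteq> 0\<^sub>m (N c) (N c0)" by metis
      from schur_intertwiner[OF J(1)[OF c0J] J(1)[OF cJ] A[OF cJ] int[OF cJ] this]
      have eq: "N c = N c0" "equivalent_reps G (N c0) (R c0) (R c)" by auto
      have f: "fst c0 = fst c"
      proof (rule ineq)
        show "fst c0 \<in> I" "fst c \<in> I" using c0J cJ by (auto simp: J_def)
      qed (use eq in \<open>simp_all add: N_def R_def\<close>)
      have "\<exists>a. A c = a \<cdot>\<^sub>m 1\<^sub>m (n (fst c0))"
      proof (rule schur)
        show "fst c0 \<in> I" using c0J by (auto simp: J_def)
        show "A c \<in> carrier_mat (n (fst c0)) (n (fst c0))" using A[OF cJ] eq(1) by (simp add: N_def)
        show "A c * \<rho> (fst c0) x = \<rho> (fst c0) x * A c" if "x \<in> carrier G" for x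
          using int[OF cJ that] f by (simp add: R_def)
      qed
      then show ?thesis using f by (simp add: N_def)
    qed
    \<comment> \<open>For this \<open>v\<close> only the column \<open>c0\<close> contributes to the relation at the identity, and it contributes \<open>1\<close>.\<close>
    define v where "v = (unit_vec (N c0) (snd c0) :: 'F vec)"
    have v: "v \<in> carrier_vec (N c0)" by (simp add: v_def)
    have gv: "g v \<in> Rel" "g v c0 = v" using g[OF v] DRel by auto
    have "(\<Sum>c\<in>J. (R c \<one>\<^bsub>G\<^esub> *\<^sub>v g v c) $ snd c) = (\<Sum>c\<in>J. if c = c0 then 1 else 0)"
    proof (rule sum.cong)
      fix c assume c: "c \<in> J"
      have "R c \<one>\<^bsub>G\<^esub> *\<^sub>v g v c = g v c"
        using RelD(1)[OF gv(1) c] by (simp add: matrix_rep_one[OF RJ[OF c] G])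
      moreover have "g v c $ snd c = (if c = c0 then 1 else 0)"
      proof (cases "c \<in> C")
        case True
        then obtain a where a: "fst c = fst c0" "A c = a \<cdot>\<^sub>m 1\<^sub>m (N c0)" using scalar by blast
        have "N c = N c0" using a(1) by (simp add: N_def)
        then have l: "snd c < N c0" using J(2)[OF c] by simp
        have gvc: "g v c = a \<cdot>\<^sub>v v" unfolding gA[OF c v] a(2) using v by (intro eq_vecI) auto
        show ?thesis
        proof (cases "c = c0")
          case True
          then show ?thesis using gv(2) J(2)[OF c0J] by (simp add: v_def)
        next
          case False
          then have "snd c \<noteq> snd c0" using a(1) by (simp add: prod_eq_iff)
          then show ?thesis using l False J(2)[OF c0J] gvc by (simp add: v_def)
        qed
      next
        case False
        then show ?thesis using c0 g[OF v] Dout[of "g v" c] c J(2)[OF c] by auto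
      qed
      ultimately show "(R c \<one>\<^bsub>G\<^esub> *\<^sub>v g v c) $ snd c = (if c = c0 then 1 else 0)" by simp
    qed simp
    also have "\<dots> = 1" using finJ c0J by simp
    finally show False using RelD(2)[OF gv(1) c0J G.one_closed] by simp
  qed
  define X where "X = (\<lambda>(i,j). col (M i) j)"
  have "X \<in> Rel"
  proof -
    have "(\<Sum>c\<in>J. (R c x *\<^sub>v X c) $ snd c) = 0" if x: "x \<in> carrier G" for x
    proof -
      have "(\<Sum>c\<in>J. (R c x *\<^sub>v X c) $ snd c) = (\<Sum>i\<in>I. \<Sum>j<n i. (\<rho> i x *\<^sub>v col (M i) j) $ j)"
        unfolding J_def using fin by (subst sum.Sigma) (auto simp: R_def X_def intro!: sum.cong)
      also have "\<dots> = (\<Sum>i\<in>I. mat_trace (\<rho> i x * M i))"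
      proof (rule sum.cong)
        fix i assume i: "i \<in> I"
        show "(\<Sum>j<n i. (\<rho> i x *\<^sub>v col (M i) j) $ j) = mat_trace (\<rho> i x * M i)"
          using M[OF i] matrix_rep_carrier[OF irreducible_repD(1)[OF irr[OF i]] x] by (simp add: mat_trace_def)
      qed simp
      finally show ?thesis using rel[OF x] by simp
    qed
    moreover have "X c \<in> carrier_vec (N c)" if "c \<in> J" for c
      using that M by (fastforce simp: X_def N_def J_def)
    ultimately show ?thesis by (simp add: Rel_def)
  qed
  from empty[OF this] have "X c = 0\<^sub>v (N c)" if "c \<in> J" for c
    using that unfolding supp_def by blast
  then have col: "col (M i) j = 0\<^sub>v (n i)" if "j < n i" for j
    using that i by (force simp: X_def N_def J_def)
  show ?thesis
  proof (rule eq_matI)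
    fix k j assume "k < dim_row (0\<^sub>m (n i) (n i) :: 'F mat)" "j < dim_col (0\<^sub>m (n i) (n i) :: 'F mat)"
    then show "M i $$ (k, j) = 0\<^sub>m (n i) (n i) $$ (k, j)"
      using arg_cong[OF col[of j], of "\<lambda>u. u $ k"] M[OF i] by simp
  qed (use M[OF i] in auto)
qed

section \<open>Composition series\<close>

text \<open>Take an invertible matrix \<open>Q\<close> with the largest possible number \<open>r\<close> of initial columns in \<open>W\<close>. If some
  vector \<open>Q v\<close> in \<open>W\<close> had a nonzero coordinate \<open>v $ i\<close> with \<open>r \<le> i\<close>, then by Cramer's rule it could
  replace column \<open>i\<close>; moved to position \<open>r\<close>, it would extend the initial segment.\<close>

lemma adapted_basis:
  fixes W :: "'F::field vec set"
  assumes W: "W \<subseteq> carrier_vec n" "0\<^sub>v n \<in> W"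
    and Wadd: "\<forall>v\<in>W. \<forall>w\<in>W. v + w \<in> W"
    and Wsmult: "\<forall>c. \<forall>v\<in>W. c \<cdot>\<^sub>v v \<in> W"
    and ne: "W \<noteq> {0\<^sub>v n}" "W \<noteq> carrier_vec n"
  obtains r Q where "0 < r" "r < n" "Q \<in> carrier_mat n n" "det Q \<noteq> 0"
    "\<And>v. v \<in> carrier_vec n \<Longrightarrow> Q *\<^sub>v v \<in> W \<longleftrightarrow> (\<forall>i. r \<le> i \<longrightarrow> i < n \<longrightarrow> v $ i = 0)"
proof -
  define S where "S r \<longleftrightarrow> r \<le> n \<and> (\<exists>Q\<in>carrier_mat n n. det Q \<noteq> 0 \<and> (\<forall>j<r. col Q j \<in> W))" for r
  have "S 0" unfolding S_def by (auto intro!: bexI[of _ "1\<^sub>m n"])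
  define r where "r = (GREATEST r. S r)"
  have bound: "\<forall>y. S y \<longrightarrow> y \<le> n" by (simp add: S_def)
  have "S r" unfolding r_def using \<open>S 0\<close> bound by (intro GreatestI_nat[of S 0 n]) auto
  have max: "r' \<le> r" if "S r'" for r'
    unfolding r_def using that bound by (intro Greatest_le_nat[of S r' n]) auto
  from \<open>S r\<close> obtain Q where rn: "r \<le> n" and Q: "Q \<in> carrier_mat n n" "det Q \<noteq> 0"
    and colW: "\<And>j. j < r \<Longrightarrow> col Q j \<in> W" by (auto simp: S_def)
  have upper: "v $ i = 0" if v: "v \<in> carrier_vec n" and vW: "Q *\<^sub>v v \<in> W" and i: "r \<le> i" "i < n" for v i
  proof (rule ccontr)
    assume nz: "v $ i \<noteq> 0"
    define Q1 where "Q1 = replace_col Q (Q *\<^sub>v v) i"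
    have Q1: "Q1 \<in> carrier_mat n n" using Q by (auto simp: Q1_def replace_col_def)
    have d1: "det Q1 \<noteq> 0" unfolding Q1_def using cramer_lemma_mat[OF Q(1) v i(2)] nz Q(2) by simp
    have c1: "col Q1 j = (if j = i then Q *\<^sub>v v else col Q j)" if "j < n" for j
      using that Q(1) v by (intro eq_vecI) (auto simp: Q1_def replace_col_def)
    define Q2 where "Q2 = (if i = r then Q1 else swapcols r i Q1)"
    have Q2: "Q2 \<in> carrier_mat n n" using Q1 by (simp add: Q2_def)
    have d2: "det Q2 \<noteq> 0" using d1 det_swapcols[of r n i Q1] Q1 i by (auto simp: Q2_def)
    have "col Q2 j = (if j = r then Q *\<^sub>v v else col Q j)" if "j < Suc r" for j
    proof -
      have "col Q2 j = col Q1 (if j = r then i else j)"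
        using that Q1 i by (intro eq_vecI) (auto simp: Q2_def)
      then show ?thesis using c1[of "if j = r then i else j"] that i by auto
    qed
    then have "\<forall>j<Suc r. col Q2 j \<in> W" using colW vW by (auto simp: less_Suc_eq)
    then have "S (Suc r)" unfolding S_def using i Q2 d2 by auto
    then show False using max by fastforce
  qed
  have lower: "Q *\<^sub>v v \<in> W"
    if "k \<le> r" "v \<in> carrier_vec n" "\<And>i. k \<le> i \<Longrightarrow> i < n \<Longrightarrow> v $ i = 0" for k v
    using that
  proof (induction k arbitrary: v)
    case 0
    then have "v = 0\<^sub>v n" by (intro eq_vecI) auto
    then have "Q *\<^sub>v v = 0\<^sub>v n" using Q by auto
    then show ?case using W by simp
  next
    case (Suc k)
    define v' where "v' = vec n (\<lambda>i. if i = k then 0 else v $ i)"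
    have v': "v' \<in> carrier_vec n" by (simp add: v'_def)
    have kn: "k < n" "k < r" using Suc.prems rn by auto
    have dec: "v = v' + v $ k \<cdot>\<^sub>v unit_vec n k"
      using Suc.prems kn by (intro eq_vecI) (auto simp: v'_def)
    have "Q *\<^sub>v v' \<in> W" using Suc.prems by (intro Suc.IH) (auto simp: v'_def)
    moreover have "Q *\<^sub>v unit_vec n k = col Q k" using Q kn by (intro eq_vecI) auto
    moreover have "Q *\<^sub>v (v' + v $ k \<cdot>\<^sub>v unit_vec n k) = Q *\<^sub>v v' + v $ k \<cdot>\<^sub>v (Q *\<^sub>v unit_vec n k)"
      using v' by (simp add: mult_add_distrib_mat_vec[OF Q(1)] mult_mat_vec[OF Q(1)])
    ultimately show ?case using dec Wadd Wsmult colW[OF kn(2)] by metis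
  qed
  obtain Qi where Qi: "Qi \<in> carrier_mat n n" "Q * Qi = 1\<^sub>m n"
    using det_non_zero_imp_unit[OF Q, of "()"] by (auto simp: Units_def ring_mat_def)
  have surj: "\<exists>v\<in>carrier_vec n. w = Q *\<^sub>v v" if "w \<in> carrier_vec n" for w
    using that Qi assoc_mult_mat_vec[OF Q(1) Qi(1) that] by (intro bexI[of _ "Qi *\<^sub>v w"]) auto
  have "r \<noteq> 0"
  proof
    assume r0: "r = 0"
    have "w = 0\<^sub>v n" if w: "w \<in> W" for w
    proof -
      obtain v where v: "v \<in> carrier_vec n" "w = Q *\<^sub>v v" using surj w W by blast
      then have "v = 0\<^sub>v n" using upper[OF v(1)] w r0 by (intro eq_vecI) auto
      then show ?thesis using v Q by auto
    qed
    then show False using ne W by blast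
  qed
  moreover have "r \<noteq> n"
  proof
    assume "r = n"
    then have "W = carrier_vec n" using lower[of n] surj W(1) by fastforce
    with ne show False by simp
  qed
  ultimately show ?thesis using rn upper lower[of r] Q by (intro that[of r Q]) auto
qed

lemma char_poly_four_block_lower_left_zero:
  fixes A :: "'a::idom mat"
  assumes A: "A \<in> carrier_mat m m" and B: "B \<in> carrier_mat m k" and D: "D \<in> carrier_mat k k"
  shows "char_poly (four_block_mat A B (0\<^sub>m k m) D) = char_poly A * char_poly D"
proof -
  have "char_poly_matrix (four_block_mat A B (0\<^sub>m k m) D) =
    four_block_mat (char_poly_matrix A) (map_mat (\<lambda>a. [:- a:]) B) (0\<^sub>m k m) (char_poly_matrix D)"
    using assms by (intro eq_matI) (auto simp: char_poly_matrix_def)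
  then show ?thesis unfolding char_poly_def
    using assms by (simp add: det_four_block_mat_lower_left_zero[of _ m _ k])
qed

lemma block_triangular_constituents:
  fixes \<sigma> :: "'g \<Rightarrow> 'F::field mat"
  assumes G: "group G" and \<sigma>: "matrix_rep G n \<sigma>" and r: "r \<le> n"
    and lower_left: "\<forall>x\<in>carrier G. \<forall>i j. r \<le> i \<longrightarrow> i < n \<longrightarrow> j < r \<longrightarrow> \<sigma> x $$ (i, j) = 0"
  obtains \<rho>1 \<rho>2 where "matrix_rep G r \<rho>1" "matrix_rep G (n - r) \<rho>2"
    "\<And>x. x \<in> carrier G \<Longrightarrow> char_poly (\<sigma> x) = char_poly (\<rho>1 x) * char_poly (\<rho>2 x)"
    "\<And>x. x \<in> carrier G \<Longrightarrow> mat_trace (\<sigma> x) = mat_trace (\<rho>1 x) + mat_trace (\<rho>2 x)"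
proof
  interpret G: group G by fact
  note zero = lower_left[rule_format]
  note s = matrix_rep_carrier[OF \<sigma>]
  define \<rho>1 where "\<rho>1 x = mat r r (\<lambda>(i, j). \<sigma> x $$ (i, j))" for x
  define \<rho>2 where "\<rho>2 x = mat (n - r) (n - r) (\<lambda>(i, j). \<sigma> x $$ (i + r, j + r))" for x
  define B where "B x = mat r (n - r) (\<lambda>(i, j). \<sigma> x $$ (i, j + r))" for x
  have block: "\<sigma> x = four_block_mat (\<rho>1 x) (B x) (0\<^sub>m (n - r) r) (\<rho>2 x)" if "x \<in> carrier G" for x
    using r s[OF that] zero[OF that] by (intro eq_matI) (auto simp: \<rho>1_def \<rho>2_def B_def)
  have prod: "\<sigma> (x \<otimes>\<^bsub>G\<^esub> y) $$ (i, j) = (\<Sum>k<r. \<sigma> x $$ (i, k) * \<sigma> y $$ (k, j)) +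
      (\<Sum>k=r..<n. \<sigma> x $$ (i, k) * \<sigma> y $$ (k, j))"
    if "x \<in> carrier G" "y \<in> carrier G" "i < n" "j < n" for x y i j
  proof -
    have "\<sigma> (x \<otimes>\<^bsub>G\<^esub> y) $$ (i, j) = (\<Sum>k=0..<n. \<sigma> x $$ (i, k) * \<sigma> y $$ (k, j))"
      using that s[of x] s[of y] by (simp add: matrix_rep_mult[OF \<sigma>] scalar_prod_def)
    also have "\<dots> = (\<Sum>k=0..<r. \<sigma> x $$ (i, k) * \<sigma> y $$ (k, j)) +
      (\<Sum>k=r..<n. \<sigma> x $$ (i, k) * \<sigma> y $$ (k, j))"
      using r by (simp add: sum.atLeastLessThan_concat)
    finally show ?thesis by (simp add: atLeast0LessThan)
  qed
  show "matrix_rep G r \<rho>1"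
  proof (rule matrix_repI[OF G])
    fix x y assume xy: "x \<in> carrier G" "y \<in> carrier G"
    show "\<rho>1 (x \<otimes>\<^bsub>G\<^esub> y) = \<rho>1 x * \<rho>1 y"
    proof (rule eq_matI)
      fix i j assume "i < dim_row (\<rho>1 x * \<rho>1 y)" "j < dim_col (\<rho>1 x * \<rho>1 y)"
      then have ij: "i < r" "j < r" by (auto simp: \<rho>1_def)
      then have "\<rho>1 (x \<otimes>\<^bsub>G\<^esub> y) $$ (i, j) = (\<Sum>k<r. \<sigma> x $$ (i, k) * \<sigma> y $$ (k, j))"
        using prod[OF xy, of i j] zero[OF xy(2)] r by (simp add: \<rho>1_def)
      then show "\<rho>1 (x \<otimes>\<^bsub>G\<^esub> y) $$ (i, j) = (\<rho>1 x * \<rho>1 y) $$ (i, j)"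
        using ij by (simp add: \<rho>1_def scalar_prod_def atLeast0LessThan)
    qed (auto simp: \<rho>1_def)
  next
    show "\<rho>1 \<one>\<^bsub>G\<^esub> = 1\<^sub>m r" using r by (intro eq_matI) (auto simp: \<rho>1_def matrix_rep_one[OF \<sigma> G])
  qed (simp add: \<rho>1_def)
  show "matrix_rep G (n - r) \<rho>2"
  proof (rule matrix_repI[OF G])
    fix x y assume xy: "x \<in> carrier G" "y \<in> carrier G"
    show "\<rho>2 (x \<otimes>\<^bsub>G\<^esub> y) = \<rho>2 x * \<rho>2 y"
    proof (rule eq_matI)
      fix i j assume "i < dim_row (\<rho>2 x * \<rho>2 y)" "j < dim_col (\<rho>2 x * \<rho>2 y)"
      then have ij: "i < n - r" "j < n - r" by (auto simp: \<rho>2_def)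
      then have "\<rho>2 (x \<otimes>\<^bsub>G\<^esub> y) $$ (i, j) = (\<Sum>k=r..<n. \<sigma> x $$ (i + r, k) * \<sigma> y $$ (k, j + r))"
        using prod[OF xy, of "i + r" "j + r"] zero[OF xy(1)] r by (simp add: \<rho>2_def)
      also have "\<dots> = (\<Sum>k=0..<n-r. \<sigma> x $$ (i + r, k + r) * \<sigma> y $$ (k + r, j + r))"
        using sum.shift_bounds_nat_ivl[of "\<lambda>k. \<sigma> x $$ (i + r, k) * \<sigma> y $$ (k, j + r)" 0 r "n - r"] r by simp
      finally show "\<rho>2 (x \<otimes>\<^bsub>G\<^esub> y) $$ (i, j) = (\<rho>2 x * \<rho>2 y) $$ (i, j)"
        using ij by (simp add: \<rho>2_def scalar_prod_def)
    qed (auto simp: \<rho>2_def)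
  next
    show "\<rho>2 \<one>\<^bsub>G\<^esub> = 1\<^sub>m (n - r)"
      using r by (intro eq_matI) (auto simp: \<rho>2_def matrix_rep_one[OF \<sigma> G])
  qed (simp add: \<rho>2_def)
  show "char_poly (\<sigma> x) = char_poly (\<rho>1 x) * char_poly (\<rho>2 x)" if "x \<in> carrier G" for x
    unfolding block[OF that]
    by (rule char_poly_four_block_lower_left_zero) (auto simp: \<rho>1_def \<rho>2_def B_def)
  show "mat_trace (\<sigma> x) = mat_trace (\<rho>1 x) + mat_trace (\<rho>2 x)" if "x \<in> carrier G" for x
  proof -
    have "mat_trace (\<sigma> x) = (\<Sum>i=0..<r. \<sigma> x $$ (i, i)) + (\<Sum>i=r..<n. \<sigma> x $$ (i, i))"
      using r s[OF that] by (simp add: mat_trace_def sum.atLeastLessThan_concat lessThan_atLeast0)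
    also have "(\<Sum>i=r..<n. \<sigma> x $$ (i, i)) = (\<Sum>i=0..<n-r. \<sigma> x $$ (i + r, i + r))"
      using sum.shift_bounds_nat_ivl[of "\<lambda>k. \<sigma> x $$ (k, k)" 0 r "n - r"] r by simp
    finally show ?thesis by (simp add: mat_trace_def \<rho>1_def \<rho>2_def lessThan_atLeast0)
  qed
qed

lemma conjugate_rep:
  fixes \<rho> :: "'g \<Rightarrow> 'F::field mat"
  assumes G: "group G" and \<rho>: "matrix_rep G n \<rho>" and PQ: "P \<in> carrier_mat n n" "Q \<in> carrier_mat n n"
    "P * Q = 1\<^sub>m n" "Q * P = 1\<^sub>m n"
  shows "matrix_rep G n (\<lambda>x. P * \<rho> x * Q)"
    "x \<in> carrier G \<Longrightarrow> char_poly (P * \<rho> x * Q) = char_poly (\<rho> x)"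
    "x \<in> carrier G \<Longrightarrow> mat_trace (P * \<rho> x * Q) = mat_trace (\<rho> x)"
proof -
  note r = matrix_rep_carrier[OF \<rho>]
  show "matrix_rep G n (\<lambda>x. P * \<rho> x * Q)"
  proof (rule matrix_repI[OF G])
    fix x y assume xy: "x \<in> carrier G" "y \<in> carrier G"
    note c = r[OF xy(1)] r[OF xy(2)] PQ(1,2)
    have "P * \<rho> x * Q * (P * \<rho> y * Q) = P * \<rho> x * (Q * (P * (\<rho> y * Q)))"
      using c by (simp add: assoc_mult_mat[of _ n n _ n _ n])
    also have "Q * (P * (\<rho> y * Q)) = (Q * P) * (\<rho> y * Q)"
      using c by (simp add: assoc_mult_mat[of _ n n _ n _ n])
    also have "\<dots> = \<rho> y * Q" using c PQ by simp
    finally show "P * \<rho> (x \<otimes>\<^bsub>G\<^esub> y) * Q = P * \<rho> x * Q * (P * \<rho> y * Q)"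
      using c by (simp add: matrix_rep_mult[OF \<rho> xy] assoc_mult_mat[of _ n n _ n _ n])
  next
    show "P * \<rho> \<one>\<^bsub>G\<^esub> * Q = 1\<^sub>m n" using PQ by (simp add: matrix_rep_one[OF \<rho> G])
  qed (use r PQ in auto)
  show "x \<in> carrier G \<Longrightarrow> char_poly (P * \<rho> x * Q) = char_poly (\<rho> x)"
    using r PQ by (intro char_poly_similar similar_matI[of _ _ P Q n]) auto
  show "x \<in> carrier G \<Longrightarrow> mat_trace (P * \<rho> x * Q) = mat_trace (\<rho> x)"
    using r PQ by (intro mat_trace_conj) auto
qed

text \<open>Induction along a composition series. A basis adapted to an invariant subspace makes the
  representation block triangular, so that characteristic polynomials multiply and traces add. Nothing
  else about an extension matters for Brauer characters, so the rule speaks of these two invariants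
  only.\<close>

lemma composition_series_induct [consumes 2, case_names zero irreducible extension]:
  fixes \<rho> :: "'g \<Rightarrow> 'F::field mat"
  assumes G: "group G" and \<rho>: "matrix_rep G n \<rho>"
    and zero: "\<And>\<rho>. matrix_rep G 0 \<rho> \<Longrightarrow> P 0 \<rho>"
    and irreducible: "\<And>n \<rho>. irreducible_rep G n \<rho> \<Longrightarrow> P n \<rho>"
    and extension: "\<And>m k \<rho>1 \<rho>2 \<rho>. \<lbrakk>matrix_rep G m \<rho>1; matrix_rep G k \<rho>2; matrix_rep G (m + k) \<rho>; P m \<rho>1; P k \<rho>2;
      \<And>x. x \<in> carrier G \<Longrightarrow> char_poly (\<rho> x) = char_poly (\<rho>1 x) * char_poly (\<rho>2 x);
      \<And>x. x \<in> carrier G \<Longrightarrow> mat_trace (\<rho> x) = mat_trace (\<rho>1 x) + mat_trace (\<rho>2 x)\<rbrakk> \<Longrightarrow> P (m + k) \<rho>"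
  shows "P n \<rho>"
  using \<rho>
proof (induction n arbitrary: \<rho> rule: less_induct)
  case (less n)
  show ?case
  proof (cases "n = 0 \<or> irreducible_rep G n \<rho>")
    case True
    then show ?thesis using zero irreducible less.prems by auto
  next
    case False
    then have n: "0 < n" and "\<not> irreducible_rep G n \<rho>" by auto
    then have "\<exists>W. (W \<subseteq> carrier_vec n \<and> 0\<^sub>v n \<in> W \<and> (\<forall>v\<in>W. \<forall>w\<in>W. v + w \<in> W) \<and> (\<forall>c. \<forall>v\<in>W. c \<cdot>\<^sub>v v \<in> W) \<and>
      (\<forall>x\<in>carrier G. \<forall>v\<in>W. \<rho> x *\<^sub>v v \<in> W)) \<and> W \<noteq> {0\<^sub>v n} \<and> W \<noteq> carrier_vec n"
      using less.prems unfolding irreducible_rep_iff by simp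
    then obtain W where W0: "W \<subseteq> carrier_vec n \<and> 0\<^sub>v n \<in> W \<and> (\<forall>v\<in>W. \<forall>w\<in>W. v + w \<in> W) \<and>
      (\<forall>c. \<forall>v\<in>W. c \<cdot>\<^sub>v v \<in> W) \<and> (\<forall>x\<in>carrier G. \<forall>v\<in>W. \<rho> x *\<^sub>v v \<in> W)"
      and ne: "W \<noteq> {0\<^sub>v n}" "W \<noteq> carrier_vec n" by blast
    have W: "W \<subseteq> carrier_vec n" "0\<^sub>v n \<in> W" "\<forall>v\<in>W. \<forall>w\<in>W. v + w \<in> W"
      "\<forall>c. \<forall>v\<in>W. c \<cdot>\<^sub>v v \<in> W" "\<forall>x\<in>carrier G. \<forall>v\<in>W. \<rho> x *\<^sub>v v \<in> W"
      using W0 by simp_all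
    obtain r Q where r: "0 < r" "r < n" and Q: "Q \<in> carrier_mat n n" "det Q \<noteq> 0"
      and QW: "\<And>v. v \<in> carrier_vec n \<Longrightarrow> Q *\<^sub>v v \<in> W \<longleftrightarrow> (\<forall>i. r \<le> i \<longrightarrow> i < n \<longrightarrow> v $ i = 0)"
      by (rule adapted_basis[OF W(1-4) ne]) (rule that)
    obtain R where R: "R \<in> carrier_mat n n" "Q * R = 1\<^sub>m n" "R * Q = 1\<^sub>m n"
      using det_non_zero_imp_unit[OF Q, of "()"] by (auto simp: Units_def ring_mat_def)
    define \<sigma> where "\<sigma> x = R * \<rho> x * Q" for x
    note conj = conjugate_rep[OF G less.prems R(1) Q(1) R(3,2), folded \<sigma>_def]
    note c = matrix_rep_carrier[OF less.prems]
    have zero': "\<sigma> x $$ (i, j) = 0" if x: "x \<in> carrier G" and ij: "r \<le> i" "i < n" "j < r" for x i j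
    proof -
      define v where "v = col (\<sigma> x) j"
      have s: "\<sigma> x \<in> carrier_mat n n" using c[OF x] R Q by (simp add: \<sigma>_def)
      then have v: "v \<in> carrier_vec n" by (auto simp: v_def)
      have "v = \<sigma> x *\<^sub>v unit_vec n j" using s ij r by (intro eq_vecI) (auto simp: v_def)
      then have "Q *\<^sub>v v = (Q * \<sigma> x) *\<^sub>v unit_vec n j" using assoc_mult_mat_vec[OF Q(1) s, of "unit_vec n j"] by simp
      also have "Q * \<sigma> x = (Q * R) * (\<rho> x * Q)"
        unfolding \<sigma>_def using c[OF x] R(1) Q(1) by (simp add: assoc_mult_mat[of _ n n _ n _ n])
      also have "\<dots> = \<rho> x * Q" using c[OF x] R(2) Q(1) by simp
      also have "\<rho> x * Q *\<^sub>v unit_vec n j = \<rho> x *\<^sub>v (Q *\<^sub>v unit_vec n j)"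
        using assoc_mult_mat_vec[OF c[OF x] Q(1), of "unit_vec n j"] by simp
      finally have "Q *\<^sub>v v = \<rho> x *\<^sub>v (Q *\<^sub>v unit_vec n j)" .
      moreover have "Q *\<^sub>v unit_vec n j \<in> W" using QW[of "unit_vec n j"] ij r by auto
      ultimately have "Q *\<^sub>v v \<in> W" using W(5) x by simp
      then have "v $ i = 0" using QW[OF v] ij by blast
      then show ?thesis using s ij r by (simp add: v_def)
    qed
    have low: "\<forall>x\<in>carrier G. \<forall>i j. r \<le> i \<longrightarrow> i < n \<longrightarrow> j < r \<longrightarrow> \<sigma> x $$ (i, j) = 0"
      using zero' by simp
    obtain \<rho>1 \<rho>2 where \<rho>1: "matrix_rep G r \<rho>1" and \<rho>2: "matrix_rep G (n - r) \<rho>2"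
      and cp: "\<And>x. x \<in> carrier G \<Longrightarrow> char_poly (\<sigma> x) = char_poly (\<rho>1 x) * char_poly (\<rho>2 x)"
      and tr: "\<And>x. x \<in> carrier G \<Longrightarrow> mat_trace (\<sigma> x) = mat_trace (\<rho>1 x) + mat_trace (\<rho>2 x)"
      by (rule block_triangular_constituents[OF G conj(1) less_imp_le[OF r(2)] low]) (rule that)
    have "P (r + (n - r)) \<rho>"
    proof (rule extension[OF \<rho>1 \<rho>2])
      show "matrix_rep G (r + (n - r)) \<rho>" using less.prems r by simp
      show "P r \<rho>1" using less.IH[OF r(2) \<rho>1] .
      show "P (n - r) \<rho>2" using r by (intro less.IH \<rho>2) simp
      show "char_poly (\<rho> x) = char_poly (\<rho>1 x) * char_poly (\<rho>2 x)" if "x \<in> carrier G" for x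
        using cp[OF that] conj(2)[OF that] by simp
      show "mat_trace (\<rho> x) = mat_trace (\<rho>1 x) + mat_trace (\<rho>2 x)" if "x \<in> carrier G" for x
        using tr[OF that] conj(3)[OF that] by simp
    qed
    then show ?thesis using r by simp
  qed
qed

lemma char_poly_scalar:
  fixes a :: "'a::field"
  shows "char_poly (a \<cdot>\<^sub>m 1\<^sub>m n) = [:- a, 1:] ^ n"
proof -
  have "char_poly (a \<cdot>\<^sub>m 1\<^sub>m n) = (\<Prod>b\<leftarrow>diag_mat (a \<cdot>\<^sub>m 1\<^sub>m n). [:- b, 1:])"
    by (rule char_poly_upper_triangular[of _ n]) (auto simp: upper_triangular_def)
  also have "diag_mat (a \<cdot>\<^sub>m 1\<^sub>m n :: 'a mat) = replicate n a"
    by (auto simp: diag_mat_def intro: nth_equalityI)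
  finally show ?thesis by simp
qed

lemma scalar_mat_pow: "(a \<cdot>\<^sub>m 1\<^sub>m n :: 'a::field mat) ^\<^sub>m j = a ^ j \<cdot>\<^sub>m 1\<^sub>m n"
  by (induction j) (auto intro!: eq_matI)

text \<open>A generator of a cyclic group commutes with the whole group, so over a splitting field it acts on
  each composition factor as a scalar. These scalars form the multiset \<open>M\<close>.\<close>

lemma cyclic_eigenvalues:
  fixes \<rho> :: "'g \<Rightarrow> 'F::field mat"
  assumes G: "group G" and fin: "finite (carrier G)" and x: "x \<in> carrier G"
    and split: "splitting_field TYPE('F) (G\<lparr>carrier := generate G {x}\<rparr>)"
    and \<rho>: "matrix_rep (G\<lparr>carrier := generate G {x}\<rparr>) n \<rho>"
  shows "\<exists>M. char_poly (\<rho> x) = (\<Prod>a\<in>#M. [:- a, 1:]) \<and>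
    (\<forall>j::nat. mat_trace (\<rho> (x [^]\<^bsub>G\<^esub> j)) = (\<Sum>a\<in>#M. a ^ j)) \<and> (\<forall>a\<in>#M. a ^ group.ord G x = 1)"
proof -
  interpret G: group G by fact
  define H where "H = G\<lparr>carrier := generate G {x}\<rparr>"
  have sub: "subgroup (generate G {x}) G" using x by (intro G.generate_is_subgroup) auto
  have H: "group H" unfolding H_def by (rule subgroup.subgroup_is_group[OF sub G])
  have xH: "x \<in> carrier H" by (simp add: H_def generate.incl)
  have pow: "y [^]\<^bsub>H\<^esub> j = y [^]\<^bsub>G\<^esub> j" for j :: nat and y
    unfolding H_def using G.nat_pow_consistent by metis
  have ord: "G.ord x \<noteq> 0" using G.ord_ge_1[OF fin x] by simp
  have gen: "\<exists>j::nat. h = x [^]\<^bsub>G\<^esub> j" if "h \<in> carrier H" for h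
    using that G.generate_pow_nat[OF x ord] by (auto simp: H_def)
  show ?thesis using H \<rho>[folded H_def]
  proof (induction rule: composition_series_induct)
    case (zero \<rho>)
    have "char_poly (\<rho> x) = 1"
      using degree_monic_char_poly[OF matrix_rep_carrier[OF zero xH]] by (auto elim: degree_eq_zeroE)
    moreover have "mat_trace (\<rho> (x [^]\<^bsub>G\<^esub> j)) = 0" for j :: nat
    proof -
      have "x [^]\<^bsub>G\<^esub> j \<in> carrier H"
        using monoid.nat_pow_closed[OF group.is_monoid[OF H] xH, of j] by (simp only: pow)
      from carrier_matD(1)[OF matrix_rep_carrier[OF zero this]] show ?thesis by (simp add: mat_trace_def)
    qed
    ultimately show ?case by (intro exI[of _ "{#}"]) simp
  next
    case (irreducible n \<rho>)
    note rep = irreducible_repD(1)[OF irreducible]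
    note rx = matrix_rep_carrier[OF rep xH]
    have rpow: "\<rho> (x [^]\<^bsub>G\<^esub> j) = \<rho> x ^\<^sub>m j" for j :: nat
      using matrix_rep_pow[OF rep H xH] by (simp only: pow)
    have "\<rho> x * \<rho> h = \<rho> h * \<rho> x" if h: "h \<in> carrier H" for h
    proof -
      obtain j :: nat where "h = x [^]\<^bsub>G\<^esub> j" using gen[OF h] by blast
      then have "\<rho> h = \<rho> x ^\<^sub>m j" by (simp add: rpow)
      moreover have "\<rho> x * \<rho> x ^\<^sub>m j = \<rho> x ^\<^sub>m j * \<rho> x"
        by (induction j) (use rx in \<open>auto simp: assoc_mult_mat[symmetric, of _ n n _ n _ n]\<close>)
      ultimately show ?thesis by simp
    qed
    then obtain a where a: "\<rho> x = a \<cdot>\<^sub>m 1\<^sub>m n"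
      using split irreducible rx unfolding splitting_field_def H_def[symmetric] by blast
    have "a ^ G.ord x = 1"
    proof -
      have "a ^ G.ord x \<cdot>\<^sub>m 1\<^sub>m n = \<rho> (x [^]\<^bsub>G\<^esub> G.ord x)" by (simp add: rpow a scalar_mat_pow)
      also have "\<dots> = 1\<^sub>m n" using matrix_rep_one[OF rep H] x by (simp add: H_def)
      finally have "(a ^ G.ord x \<cdot>\<^sub>m 1\<^sub>m n) $$ (0, 0) = (1\<^sub>m n :: 'F mat) $$ (0, 0)" by simp
      then show ?thesis using irreducible_repD(2)[OF irreducible] by simp
    qed
    then show ?case
      by (intro exI[of _ "replicate_mset n a"])
        (auto simp: rpow a scalar_mat_pow char_poly_scalar mat_trace_smult[of _ n] mat_trace_one)
  next
    case (extension m k \<rho>1 \<rho>2 \<rho>)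
    then obtain M1 M2 where
      M: "char_poly (\<rho>1 x) = (\<Prod>a\<in>#M1. [:- a, 1:])" "\<And>j::nat. mat_trace (\<rho>1 (x [^]\<^bsub>G\<^esub> j)) = (\<Sum>a\<in>#M1. a ^ j)"
        "\<And>a. a \<in># M1 \<Longrightarrow> a ^ G.ord x = 1"
        "char_poly (\<rho>2 x) = (\<Prod>a\<in>#M2. [:- a, 1:])" "\<And>j::nat. mat_trace (\<rho>2 (x [^]\<^bsub>G\<^esub> j)) = (\<Sum>a\<in>#M2. a ^ j)"
        "\<And>a. a \<in># M2 \<Longrightarrow> a ^ G.ord x = 1" by blast
    have "x [^]\<^bsub>G\<^esub> j \<in> carrier H" for j :: nat
      using monoid.nat_pow_closed[OF group.is_monoid[OF H] xH, of j] by (simp only: pow)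
    then show ?case using M extension.hyps(4,5) xH by (intro exI[of _ "M1 + M2"]) auto
  qed
qed

section \<open>The valuation ring and its residue map\<close>

context p_modular_system
begin

lemma zero_O: "0 \<in> \<O>" and one_O: "1 \<in> \<O>"
  and add_O: "x \<in> \<O> \<Longrightarrow> y \<in> \<O> \<Longrightarrow> x + y \<in> \<O>"
  and mult_O: "x \<in> \<O> \<Longrightarrow> y \<in> \<O> \<Longrightarrow> x * y \<in> \<O>"
  using subringE[OF subring_\<O>] by auto

lemma uminus_O: "x \<in> \<O> \<Longrightarrow> - x \<in> \<O>"
  using subringE(5)[OF subring_\<O>, of x] by (simp add: class_ring_simps)

lemma diff_O: "x \<in> \<O> \<Longrightarrow> y \<in> \<O> \<Longrightarrow> x - y \<in> \<O>"
  using add_O[of x "- y"] uminus_O[of y] by simp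

lemma sum_O: "(\<And>i. i \<in> I \<Longrightarrow> f i \<in> \<O>) \<Longrightarrow> sum f I \<in> \<O>"
  by (induction I rule: infinite_finite_induct) (auto intro: zero_O add_O)

lemma power_O: "x \<in> \<O> \<Longrightarrow> x ^ n \<in> \<O>"
  by (induction n) (auto intro: one_O mult_O)

lemma of_nat_O: "of_nat n \<in> \<O>"
  by (induction n) (auto intro: zero_O one_O add_O)

lemma res_add: "x \<in> \<O> \<Longrightarrow> y \<in> \<O> \<Longrightarrow> res (x + y) = res x + res y"
  and res_mult: "x \<in> \<O> \<Longrightarrow> y \<in> \<O> \<Longrightarrow> res (x * y) = res x * res y"
  and res_one: "res 1 = 1"
  using res_hom by (auto simp: ring_hom_def)

lemma res_zero: "res 0 = 0"
proof -
  have "res 0 + res 0 = res 0 + 0" using res_add[of 0 0] zero_O by simp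
  then show ?thesis unfolding add_left_cancel .
qed

lemma res_uminus: "x \<in> \<O> \<Longrightarrow> res (- x) = - res x"
  using res_add[of x "- x"] uminus_O[of x] by (simp add: res_zero minus_unique)

lemma res_diff: "x \<in> \<O> \<Longrightarrow> y \<in> \<O> \<Longrightarrow> res (x - y) = res x - res y"
  using res_add[of x "- y"] uminus_O[of y] by (simp add: res_uminus)

lemma res_sum: "(\<And>i. i \<in> I \<Longrightarrow> f i \<in> \<O>) \<Longrightarrow> res (sum f I) = (\<Sum>i\<in>I. res (f i))"
  by (induction I rule: infinite_finite_induct) (auto simp: res_zero res_add sum_O)

lemma res_power: "x \<in> \<O> \<Longrightarrow> res (x ^ n) = res x ^ n"
  by (induction n) (auto simp: res_one res_mult power_O)

lemma res_of_nat: "res (of_nat n) = of_nat n"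
  by (induction n) (auto simp: res_zero res_one res_add of_nat_O one_O)

lemma of_nat_res_eq_0_iff: "(of_nat n :: 'k) = 0 \<longleftrightarrow> p dvd n"
  by (simp add: of_nat_eq_0_iff_char_dvd char_k)

lemma principal_domain_\<O>: "principal_domain (ring_on \<O>)"
  and unique_maximalideal: "\<exists>!M. maximalideal M (ring_on \<O>)"
  using complete_dvr_\<O> by (auto simp: complete_dvr_def discrete_valuation_ring_def)

lemma a_inv_ring_on: "x \<in> \<O> \<Longrightarrow> \<ominus>\<^bsub>ring_on \<O>\<^esub> x = - x"
proof -
  assume x: "x \<in> \<O>"
  interpret R: principal_domain "ring_on \<O>" by (rule principal_domain_\<O>)
  have "- x \<oplus>\<^bsub>ring_on \<O>\<^esub> x = \<zero>\<^bsub>ring_on \<O>\<^esub>" by simp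
  then show ?thesis using x uminus_O[OF x] R.minus_equality[of "- x" x] by simp
qed

text \<open>An ideal that contains the kernel and an element with nonzero residue contains \<open>1\<close>, since that
  residue has an inverse and the inverse is itself a residue.\<close>

lemma res_kernel_maximal: "maximalideal {x \<in> \<O>. res x = 0} (ring_on \<O>)"
proof -
  interpret R: principal_domain "ring_on \<O>" by (rule principal_domain_\<O>)
  show ?thesis
  proof (rule maximalidealI)
    show "ideal {x \<in> \<O>. res x = 0} (ring_on \<O>)"
    proof (rule idealI)
      show "subgroup {x \<in> \<O>. res x = 0} (add_monoid (ring_on \<O>))"
      proof (rule R.add.subgroupI)
        fix a assume "a \<in> {x \<in> \<O>. res x = 0}"
        then show "\<ominus>\<^bsub>ring_on \<O>\<^esub> a \<in> {x \<in> \<O>. res x = 0}"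
          using a_inv_ring_on[of a] by (simp add: uminus_O res_uminus)
      qed (use zero_O in \<open>auto simp: res_zero res_add add_O\<close>)
    next
      show "ring (ring_on \<O>)" by (rule R.ring_axioms)
    qed (auto simp: mult_O res_mult)
    show "carrier (ring_on \<O>) \<noteq> {x \<in> \<O>. res x = 0}"
    proof
      assume eq: "carrier (ring_on \<O>) = {x \<in> \<O>. res x = 0}"
      have "1 \<in> carrier (ring_on \<O>)" using one_O by simp
      then show False unfolding eq by (simp add: res_one)
    qed
    fix J assume J: "ideal J (ring_on \<O>)" "{x \<in> \<O>. res x = 0} \<subseteq> J" "J \<subseteq> carrier (ring_on \<O>)"
    show "J = {x \<in> \<O>. res x = 0} \<or> J = carrier (ring_on \<O>)"
    proof (rule disjCI)
      assume "J \<noteq> carrier (ring_on \<O>)"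
      have "res j = 0" if j: "j \<in> J" for j
      proof (rule ccontr)
        assume nz: "res j \<noteq> 0"
        have jO: "j \<in> \<O>" using j J(3) by auto
        obtain i where i: "i \<in> \<O>" "res i = inverse (res j)" using res_surj by (metis UNIV_I imageE)
        interpret J: ideal J "ring_on \<O>" by (rule J(1))
        have ij: "i * j \<in> J" using J.I_l_closed[OF j, of i] i by simp
        have "1 - i * j \<in> J" using J(2) i jO nz
          by (auto simp: res_diff res_mult res_one one_O mult_O diff_O)
        then have "(1 - i * j) \<oplus>\<^bsub>ring_on \<O>\<^esub> (i * j) \<in> J" using ij by (rule J.a_closed)
        then have "\<one>\<^bsub>ring_on \<O>\<^esub> \<in> J" by simp
        then have "J = carrier (ring_on \<O>)" by (rule J.one_imp_carrier)
        with \<open>J \<noteq> carrier (ring_on \<O>)\<close> show False by simp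
      qed
      then show "J = {x \<in> \<O>. res x = 0}" using J by auto
    qed
  qed
qed

text \<open>A nonunit has an irreducible divisor. It generates a maximal ideal, and the only maximal ideal is the
  kernel of \<open>res\<close>.\<close>

lemma res_nonzero_unit:
  assumes u: "u \<in> \<O>" and nz: "res u \<noteq> 0"
  shows "1 / u \<in> \<O>"
proof -
  interpret R: principal_domain "ring_on \<O>" by (rule principal_domain_\<O>)
  have u0: "u \<noteq> 0" using nz res_zero by auto
  have "u \<in> Units (ring_on \<O>)"
  proof (rule ccontr)
    assume "u \<notin> Units (ring_on \<O>)"
    then obtain b where b: "b \<in> carrier (ring_on \<O>)" "ring_irreducible\<^bsub>ring_on \<O>\<^esub> b" "b divides\<^bsub>ring_on \<O>\<^esub> u"
      using R.exists_irreducible_divisor[of u] u u0 by auto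
    then have "PIdl\<^bsub>ring_on \<O>\<^esub> b = {x \<in> \<O>. res x = 0}"
      using R.irreducible_imp_maximalideal unique_maximalideal res_kernel_maximal by blast
    moreover have "u \<in> PIdl\<^bsub>ring_on \<O>\<^esub> b"
      using b(3) unfolding cgenideal_def factor_def by (auto simp: mult.commute)
    ultimately show False using nz by auto
  qed
  then obtain w where "w \<in> \<O>" "w * u = 1" by (auto simp: Units_def)
  then show ?thesis using u0 by (metis nonzero_eq_divide_eq)
qed

text \<open>Write \<open>x\<close> as a fraction and divide numerator and denominator by a generator of the ideal that they
  span. Afterwards they span the unit ideal, so that one of them is a unit.\<close>

lemma valuation_cases:
  obtains "x \<in> \<O>" | "x \<noteq> 0" "1 / x \<in> \<O>" "res (1 / x) = 0"
proof -
  interpret R: principal_domain "ring_on \<O>" by (rule principal_domain_\<O>)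
  obtain a b where ab: "a \<in> \<O>" "b \<in> \<O>" "b \<noteq> 0" "x = a / b" using quotient_field by blast
  define J where "J = {r * a + s * b | r s. r \<in> \<O> \<and> s \<in> \<O>}"
  have "ideal J (ring_on \<O>)"
  proof (rule idealI)
    show "subgroup J (add_monoid (ring_on \<O>))"
    proof (rule R.add.subgroupI)
      show "J \<subseteq> carrier (ring_on \<O>)" using ab by (auto simp: J_def add_O mult_O)
      show "J \<noteq> {}" using zero_O by (auto simp: J_def)
      fix y assume y: "y \<in> J"
      then obtain r s where rs: "r \<in> \<O>" "s \<in> \<O>" "y = r * a + s * b" by (auto simp: J_def)
      have "\<ominus>\<^bsub>ring_on \<O>\<^esub> y = (- r) * a + (- s) * b"
        using a_inv_ring_on[of y] rs ab by (simp add: add_O mult_O)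
      then show "\<ominus>\<^bsub>ring_on \<O>\<^esub> y \<in> J" unfolding J_def using rs uminus_O by blast
      fix z assume "z \<in> J"
      then obtain r' s' where rs': "r' \<in> \<O>" "s' \<in> \<O>" "z = r' * a + s' * b" by (auto simp: J_def)
      have "y \<oplus>\<^bsub>ring_on \<O>\<^esub> z = (r + r') * a + (s + s') * b"
        using rs rs' by (simp add: algebra_simps)
      then show "y \<oplus>\<^bsub>ring_on \<O>\<^esub> z \<in> J" unfolding J_def using rs rs' add_O by blast
    qed
    have *: "c * y \<in> J" if "y \<in> J" "c \<in> \<O>" for c y
    proof -
      from that obtain r s where rs: "r \<in> \<O>" "s \<in> \<O>" "y = r * a + s * b" by (auto simp: J_def)
      then have "c * y = (c * r) * a + (c * s) * b" by (simp add: algebra_simps)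
      then show ?thesis unfolding J_def using rs that(2) mult_O by blast
    qed
    show "c \<otimes>\<^bsub>ring_on \<O>\<^esub> y \<in> J" "y \<otimes>\<^bsub>ring_on \<O>\<^esub> c \<in> J" if "y \<in> J" "c \<in> carrier (ring_on \<O>)" for c y
      using *[OF that(1), of c] that by (simp_all add: mult.commute)
  qed (rule R.ring_axioms)
  then obtain g where g: "g \<in> \<O>" "J = PIdl\<^bsub>ring_on \<O>\<^esub> g" using R.exists_gen by auto
  then have J: "J = {r * g | r. r \<in> \<O>}" by (simp add: cgenideal_def)
  have "1 * a + 0 * b \<in> J" "0 * a + 1 * b \<in> J" unfolding J_def using zero_O one_O by blast+
  then obtain a' b' where a': "a' \<in> \<O>" "a = a' * g" and b': "b' \<in> \<O>" "b = b' * g"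
    by (auto simp: J)
  have "1 * g \<in> J" unfolding J using one_O by blast
  then obtain r s where rs: "r \<in> \<O>" "s \<in> \<O>" "g = r * a + s * b" by (auto simp: J_def)
  have g0: "g \<noteq> 0" using b' ab(3) by auto
  have "(r * a' + s * b') * g = 1 * g" using rs(3) a'(2) b'(2) by (simp add: algebra_simps)
  then have 1: "r * a' + s * b' = 1" using g0 by simp
  have "res r * res a' + res s * res b' = 1"
    using arg_cong[OF 1, of res] rs a' b' by (simp add: res_add res_mult mult_O res_one)
  then consider "res b' \<noteq> 0" | "res b' = 0" "res a' \<noteq> 0" by force
  then show ?thesis
  proof cases
    case 1
    have "x = a' * (1 / b')" using ab(4) a' b' g0 by simp
    then have "x \<in> \<O>" using mult_O[OF a'(1) res_nonzero_unit[OF b'(1) 1]] by simp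
    then show ?thesis by (rule that)
  next
    case 2
    have a'0: "a' \<noteq> 0" using 2 res_zero by auto
    have b'0: "b' \<noteq> 0" using b' ab(3) by auto
    have "1 / x = b' * (1 / a')" using ab(4) a' b' g0 by simp
    moreover have u: "1 / a' \<in> \<O>" by (rule res_nonzero_unit[OF a'(1) 2(2)])
    ultimately have "1 / x \<in> \<O>" "res (1 / x) = 0" using mult_O[OF b'(1) u] res_mult[OF b'(1) u] 2(1) by auto
    moreover have "x \<noteq> 0" using ab(4) a' b' g0 a'0 b'0 by simp
    ultimately show ?thesis by (intro that(2))
  qed
qed

text \<open>Divisibility in a valuation ring is total, so a finite set has an element of least valuation.\<close>

lemma minimal_valuation_exists:
  assumes "finite S" "S \<noteq> {}" "0 \<notin> S"
  shows "\<exists>d\<in>S. \<forall>s\<in>S. s / d \<in> \<O>"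
  using assms
proof (induction S rule: finite_ne_induct)
  case (singleton x)
  then show ?case using one_O by auto
next
  case (insert x F)
  then obtain d where d: "d \<in> F" "\<And>s. s \<in> F \<Longrightarrow> s / d \<in> \<O>" by auto
  have nz: "d \<noteq> 0" "x \<noteq> 0" using insert d by auto
  show ?case
  proof (rule valuation_cases[of "x / d"])
    assume "x / d \<in> \<O>"
    then show ?thesis using d by (intro bexI[of _ d]) auto
  next
    assume "1 / (x / d) \<in> \<O>"
    then have dx: "d / x \<in> \<O>" by simp
    have "s / x \<in> \<O>" if "s \<in> F" for s
      using mult_O[OF d(2)[OF that] dx] nz by simp
    then show ?thesis using one_O nz by (intro bexI[of _ x]) auto
  qed
qed

lemma root_of_unity_O:
  assumes "z ^ m = 1" "0 < m"
  shows "z \<in> \<O>"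
proof (rule valuation_cases[of z])
  assume z: "z \<noteq> 0" "1 / z \<in> \<O>" "res (1 / z) = 0"
  have "(1 / z) ^ m = 1" using assms by (simp add: power_one_over)
  then have "res (1 / z) ^ m = 1" using res_power[OF z(2), of m] res_one by metis
  then show ?thesis using z(3) assms(2) by (simp add: power_0_left)
qed

text \<open>If the quotient \<open>u\<close> is a root of unity of order prime to \<open>p\<close>, has residue \<open>1\<close>, but is not \<open>1\<close>, then the
  geometric sum of its first \<open>N\<close> powers vanishes for a suitable \<open>N\<close> prime to \<open>p\<close>. The residue of that sum is
  \<open>N\<close>, which is not zero in the residue field.\<close>

lemma root_of_unity_res_inj:
  assumes z: "z ^ m = 1" "0 < m" "\<not> p dvd m" and w: "w ^ l = 1" "0 < l" "\<not> p dvd l"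
    and eq: "res z = res w"
  shows "z = w"
proof (rule ccontr)
  assume "z \<noteq> w"
  define u where "u = z / w"
  define N where "N = m * l"
  have zO: "z \<in> \<O>" and wO: "w \<in> \<O>" using z w root_of_unity_O by blast+
  have w0: "w \<noteq> 0" using w by (auto simp: power_0_left)
  have zN: "z ^ N = 1" by (simp add: N_def power_mult z(1))
  have wN: "w ^ N = 1" by (simp add: N_def mult.commute[of m l] power_mult w(1))
  have N: "0 < N" "\<not> p dvd N" using z w prime_p by (auto simp: N_def prime_dvd_mult_iff)
  have uN: "u ^ N = 1" using zN wN by (simp add: u_def power_divide)
  have uO: "u \<in> \<O>" using uN N root_of_unity_O by blast
  have "res z = res u * res w" using res_mult[OF uO wO] w0 by (simp add: u_def)
  moreover have "res w \<noteq> 0" using res_power[OF wO, of N] wN N res_one by (auto simp: power_0_left)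
  ultimately have ru: "res u = 1" using eq by simp
  have "u \<noteq> 1" using \<open>z \<noteq> w\<close> w0 by (auto simp: u_def)
  then have "(\<Sum>i<N. u ^ i) = 0" using uN geometric_sum[of u N] by simp
  then have "(\<Sum>i<N. res (u ^ i)) = 0" using res_sum[of "{..<N}" "\<lambda>i. u ^ i"] power_O[OF uO] res_zero by simp
  then have "(of_nat N :: 'k) = 0" by (simp add: res_power[OF uO] ru)
  with N(2) show False by (simp add: of_nat_res_eq_0_iff)
qed

lemma root_lift_res:
  assumes "z ^ m = 1" "0 < m" "\<not> p dvd m"
  shows "root_lift p \<O> res (res z) = z"
  unfolding root_lift_def
proof (rule the_equality)
  show "z \<in> \<O> \<and> (\<exists>m>0. \<not> p dvd m \<and> z ^ m = 1) \<and> res z = res z"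
    using assms root_of_unity_O by blast
  show "y = z" if "y \<in> \<O> \<and> (\<exists>m>0. \<not> p dvd m \<and> y ^ m = 1) \<and> res y = res z" for y
    using that assms root_of_unity_res_inj by blast
qed

section \<open>Reduction of polynomials and matrices\<close>

definition integral_poly :: "'K poly \<Rightarrow> bool" where
  "integral_poly f \<longleftrightarrow> (\<forall>i. Polynomial.coeff f i \<in> \<O>)"

lemma coeff_map_res: "Polynomial.coeff (map_poly res f) i = res (Polynomial.coeff f i)"
  by (simp add: coeff_map_poly res_zero)

lemma integral_poly_pCons: "a \<in> \<O> \<Longrightarrow> integral_poly f \<Longrightarrow> integral_poly (pCons a f)"
  by (auto simp: integral_poly_def coeff_pCons split: nat.split)

lemma integral_poly_const: "integral_poly 0" "integral_poly 1" "a \<in> \<O> \<Longrightarrow> integral_poly [:a:]"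
  by (auto simp: integral_poly_def coeff_pCons coeff_1 zero_O one_O split: nat.split)

lemma integral_poly_add: "integral_poly f \<Longrightarrow> integral_poly g \<Longrightarrow> integral_poly (f + g)"
  and map_res_add: "integral_poly f \<Longrightarrow> integral_poly g \<Longrightarrow> map_poly res (f + g) = map_poly res f + map_poly res g"
  by (auto simp: integral_poly_def add_O coeff_map_res res_add intro: poly_eqI)

lemma integral_poly_mult: "integral_poly f \<Longrightarrow> integral_poly g \<Longrightarrow> integral_poly (f * g)"
  and map_res_mult: "integral_poly f \<Longrightarrow> integral_poly g \<Longrightarrow> map_poly res (f * g) = map_poly res f * map_poly res g"
  by (auto simp: integral_poly_def coeff_mult mult_O sum_O coeff_map_res res_sum res_mult intro!: poly_eqI)

lemma integral_poly_sum: "(\<And>i. i \<in> I \<Longrightarrow> integral_poly (f i)) \<Longrightarrow> integral_poly (sum f I)"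
  by (induction I rule: infinite_finite_induct) (auto intro: integral_poly_const integral_poly_add)

lemma map_res_sum: "(\<And>i. i \<in> I \<Longrightarrow> integral_poly (f i)) \<Longrightarrow> map_poly res (sum f I) = (\<Sum>i\<in>I. map_poly res (f i))"
  by (induction I rule: infinite_finite_induct) (auto simp: map_res_add integral_poly_sum)

lemma map_res_1: "map_poly res 1 = 1"
  by (intro poly_eqI) (simp add: coeff_map_res coeff_1 res_one res_zero)

lemma integral_poly_prod: "(\<And>i. i \<in> I \<Longrightarrow> integral_poly (f i)) \<Longrightarrow> integral_poly (prod f I)"
  by (induction I rule: infinite_finite_induct) (auto intro: integral_poly_const integral_poly_mult)

lemma map_res_prod: "(\<And>i. i \<in> I \<Longrightarrow> integral_poly (f i)) \<Longrightarrow> map_poly res (prod f I) = (\<Prod>i\<in>I. map_poly res (f i))"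
  by (induction I rule: infinite_finite_induct) (auto simp: map_res_mult integral_poly_prod map_res_1)

lemma map_res_linear: "map_poly res [:a, b:] = [:res a, res b:]"
  by (intro poly_eqI) (auto simp: coeff_map_res coeff_pCons res_zero split: nat.split)

lemma map_res_prod_mset:
  assumes "\<And>a. a \<in># M \<Longrightarrow> a \<in> \<O>"
  shows "map_poly res (\<Prod>a\<in>#M. [:- a, 1:]) = (\<Prod>a\<in>#image_mset res M. [:- a, 1:]) \<and>
    integral_poly (\<Prod>a\<in>#M. [:- a, 1:])"
  using assms
proof (induction M)
  case empty
  then show ?case by (simp add: map_res_1 integral_poly_const)
next
  case (add a M)
  have "integral_poly [:- a, 1:]" using add.prems
    by (intro integral_poly_pCons integral_poly_const uminus_O) (auto intro: one_O)
  then show ?case using add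
    by (simp add: map_res_mult integral_poly_mult map_res_linear res_uminus res_one del: mult_pCons_left)
qed

definition integral_mat :: "'K mat \<Rightarrow> bool" where
  "integral_mat A \<longleftrightarrow> (\<forall>i<dim_row A. \<forall>j<dim_col A. A $$ (i, j) \<in> \<O>)"

text \<open>The map \<open>res\<close> is a homomorphism on \<open>\<O>\<close> only and not on the whole type, so the identity is read off
  from the Leibniz formula for the determinant.\<close>

lemma map_res_char_poly:
  assumes A: "A \<in> carrier_mat n n" and int: "integral_mat A"
  shows "map_poly res (char_poly A) = char_poly (map_mat res A)"
proof -
  have e: "integral_poly (char_poly_matrix A $$ (i, j))"
    "map_poly res (char_poly_matrix A $$ (i, j)) = char_poly_matrix (map_mat res A) $$ (i, j)"
    if "i < n" "j < n" for i j
  proof -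
    have a: "A $$ (i, j) \<in> \<O>" using that A int by (auto simp: integral_mat_def)
    show "integral_poly (char_poly_matrix A $$ (i, j))" using a A that
      by (auto simp: char_poly_matrix_def uminus_O one_O zero_O intro!: integral_poly_pCons integral_poly_const)
    show "map_poly res (char_poly_matrix A $$ (i, j)) = char_poly_matrix (map_mat res A) $$ (i, j)"
      using a A that by (auto simp: char_poly_matrix_def map_res_linear res_uminus res_one res_zero)
        (auto intro!: poly_eqI simp: coeff_map_res coeff_pCons res_zero res_uminus split: nat.split)
  qed
  have s: "integral_poly (signof q)" "map_poly res (signof q) = signof q" for q :: "nat \<Rightarrow> nat"
  proof -
    have "(-1 :: 'K poly) = [:-1:]" "(-1 :: 'k poly) = [:-1:]" by (simp_all add: one_pCons)
    then show "integral_poly (signof q)" "map_poly res (signof q) = signof q"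
      by (auto simp: sign_def integral_poly_const uminus_O one_O map_res_1 res_uminus res_one res_zero
          intro!: poly_eqI simp: coeff_map_res coeff_pCons split: nat.split)
  qed
  have p: "q i < n" if "q permutes {0..<n}" "i < n" for q i
    using permutes_in_image[OF that(1), of i] that(2) by simp
  have ip: "integral_poly (\<Prod>i=0..<n. char_poly_matrix A $$ (i, q i))" if "q permutes {0..<n}" for q
    using p[OF that] by (intro integral_poly_prod e) auto
  have "map_poly res (char_poly A) =
      map_poly res (\<Sum>q\<in>{q. q permutes {0..<n}}. signof q * (\<Prod>i=0..<n. char_poly_matrix A $$ (i, q i)))"
    unfolding char_poly_def using A by (subst det_def'[of _ n]) auto
  also have "\<dots> = (\<Sum>q\<in>{q. q permutes {0..<n}}.
      map_poly res (signof q * (\<Prod>i=0..<n. char_poly_matrix A $$ (i, q i))))"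
    by (rule map_res_sum) (auto intro!: integral_poly_mult s ip)
  also have "\<dots> = (\<Sum>q\<in>{q. q permutes {0..<n}}.
      signof q * (\<Prod>i=0..<n. char_poly_matrix (map_mat res A) $$ (i, q i)))"
  proof (rule sum.cong)
    fix q assume "q \<in> {q. q permutes {0..<n}}"
    then have q: "q permutes {0..<n}" by simp
    have "map_poly res (\<Prod>i=0..<n. char_poly_matrix A $$ (i, q i)) =
        (\<Prod>i=0..<n. map_poly res (char_poly_matrix A $$ (i, q i)))"
      using p[OF q] by (intro map_res_prod e) auto
    also have "\<dots> = (\<Prod>i=0..<n. char_poly_matrix (map_mat res A) $$ (i, q i))"
      using p[OF q] by (intro prod.cong e) auto
    finally show "map_poly res (signof q * (\<Prod>i=0..<n. char_poly_matrix A $$ (i, q i))) =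
      signof q * (\<Prod>i=0..<n. char_poly_matrix (map_mat res A) $$ (i, q i))"
      by (simp add: map_res_mult s ip[OF q])
  qed simp
  also have "\<dots> = char_poly (map_mat res A)"
    unfolding char_poly_def using A by (subst det_def'[of _ n]) auto
  finally show ?thesis .
qed

lemma integral_mat_mult:
  assumes "A \<in> carrier_mat m n" "B \<in> carrier_mat n k" "integral_mat A" "integral_mat B"
  shows "integral_mat (A * B)" "map_mat res (A * B) = map_mat res A * map_mat res B"
proof -
  have i: "A $$ (i, l) \<in> \<O>" "B $$ (l, j) \<in> \<O>" if "i < m" "l < n" "j < k" for i l j
    using that assms by (auto simp: integral_mat_def)
  show "integral_mat (A * B)" using assms(1,2) i unfolding integral_mat_def
    by (auto simp: scalar_prod_def intro!: sum_O mult_O)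
  show "map_mat res (A * B) = map_mat res A * map_mat res B"
  proof (rule eq_matI)
    fix a b assume "a < dim_row (map_mat res A * map_mat res B)" "b < dim_col (map_mat res A * map_mat res B)"
    then have ab: "a < m" "b < k" using assms(1,2) by auto
    have "map_mat res (A * B) $$ (a, b) = res (\<Sum>l=0..<n. A $$ (a, l) * B $$ (l, b))"
      using ab assms(1,2) by (simp add: scalar_prod_def)
    also have "\<dots> = (\<Sum>l=0..<n. res (A $$ (a, l) * B $$ (l, b)))"
      using i ab by (intro res_sum mult_O) auto
    also have "\<dots> = (\<Sum>l=0..<n. res (A $$ (a, l)) * res (B $$ (l, b)))"
      using i[OF ab(1) _ ab(2)] by (intro sum.cong res_mult) auto
    finally show "map_mat res (A * B) $$ (a, b) = (map_mat res A * map_mat res B) $$ (a, b)"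
      using ab assms(1,2) by (simp add: scalar_prod_def)
  qed (use assms(1,2) in auto)
qed

lemma reduction_rep:
  assumes G: "group G" and \<rho>: "matrix_rep G n \<rho>" and int: "\<And>x. x \<in> carrier G \<Longrightarrow> integral_mat (\<rho> x)"
  shows "matrix_rep G n (\<lambda>x. map_mat res (\<rho> x))"
proof (rule matrix_repI[OF G])
  note r = matrix_rep_carrier[OF \<rho>]
  show "map_mat res (\<rho> (x \<otimes>\<^bsub>G\<^esub> y)) = map_mat res (\<rho> x) * map_mat res (\<rho> y)"
    if "x \<in> carrier G" "y \<in> carrier G" for x y
    using that integral_mat_mult(2)[OF r r int int] by (simp add: matrix_rep_mult[OF \<rho>])
  show "map_mat res (\<rho> \<one>\<^bsub>G\<^esub>) = 1\<^sub>m n"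
    by (intro eq_matI) (auto simp: matrix_rep_one[OF \<rho> G] res_one res_zero)
qed (use matrix_rep_carrier[OF \<rho>] in auto)

section \<open>Invariant lattices\<close>

text \<open>The group permutes the vectors \<open>\<rho> x e\<^sub>i\<close>, and they span the whole space. Choose \<open>n\<close> of them whose
  determinant is nonzero of least valuation. By Cramer's rule the coordinates of the other vectors with
  respect to these are quotients of two such determinants, hence integral; so the chosen vectors are a
  basis of a \<open>G\<close>-stable \<open>\<O>\<close>-lattice.\<close>

lemma integral_form:
  assumes G: "group G" and fin: "finite (carrier G)" and \<rho>: "matrix_rep G n \<rho>"
  obtains P Q where "P \<in> carrier_mat n n" "Q \<in> carrier_mat n n" "P * Q = 1\<^sub>m n" "Q * P = 1\<^sub>m n"
    "\<And>x. x \<in> carrier G \<Longrightarrow> integral_mat (P * \<rho> x * Q)"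
proof -
  interpret G: group G by fact
  note r = matrix_rep_carrier[OF \<rho>]
  define T where "T f = mat n n (\<lambda>(i, j). \<rho> (fst (f j)) $$ (i, snd (f j)))" for f :: "nat \<Rightarrow> _ \<times> nat"
  define F where "F = {..<n} \<rightarrow>\<^sub>E carrier G \<times> {..<n}"
  define S where "S = (\<lambda>f. det (T f)) ` F - {0}"
  have finF: "finite F" unfolding F_def using fin by (intro finite_PiE) auto
  define f0 where "f0 = (\<lambda>j\<in>{..<n}. (\<one>\<^bsub>G\<^esub>, j))"
  have "T f0 = 1\<^sub>m n" by (intro eq_matI) (auto simp: T_def f0_def matrix_rep_one[OF \<rho> G])
  moreover have "f0 \<in> F" by (auto simp: f0_def F_def)
  ultimately have "1 \<in> S" unfolding S_def by force
  then obtain d where "d \<in> S" and d: "\<And>s. s \<in> S \<Longrightarrow> s / d \<in> \<O>"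
    using minimal_valuation_exists[of S] finF unfolding S_def by blast
  then obtain f where f: "f \<in> F" "det (T f) = d" "d \<noteq> 0" by (auto simp: S_def)
  have fj: "fst (f j) \<in> carrier G" "snd (f j) < n" if "j < n" for j
    using f(1) that by (auto simp: F_def PiE_iff mem_Times_iff)
  define Q where "Q = T f"
  have Q: "Q \<in> carrier_mat n n" by (simp add: Q_def T_def)
  obtain P where P: "P \<in> carrier_mat n n" "Q * P = 1\<^sub>m n" "P * Q = 1\<^sub>m n"
    using det_non_zero_imp_unit[OF Q, of "()"] f by (auto simp: Q_def Units_def ring_mat_def)
  have "integral_mat (P * \<rho> x * Q)" if x: "x \<in> carrier G" for x
    unfolding integral_mat_def
  proof (intro allI impI)
    fix i j assume "i < dim_row (P * \<rho> x * Q)" "j < dim_col (P * \<rho> x * Q)"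
    then have ij: "i < n" "j < n" using P Q by auto
    define s where "s = col (\<rho> (x \<otimes>\<^bsub>G\<^esub> fst (f j))) (snd (f j))"
    define v where "v = P *\<^sub>v s"
    have xf: "x \<otimes>\<^bsub>G\<^esub> fst (f j) \<in> carrier G" using x fj(1)[OF ij(2)] by simp
    have s: "s \<in> carrier_vec n" using r[OF xf] by (auto simp: s_def)
    have v: "v \<in> carrier_vec n" using P s by (simp add: v_def)
    have Qv: "Q *\<^sub>v v = s" using assoc_mult_mat_vec[OF Q P(1) s] P s by (simp add: v_def)
    \<comment> \<open>Column \<open>j\<close> of \<open>\<rho> x * Q\<close> is again one of the spanning vectors; put into column \<open>i\<close> of \<open>Q\<close>, it gives the matrix of \<open>f'\<close>.\<close>
    define f' where "f' = f(i := (x \<otimes>\<^bsub>G\<^esub> fst (f j), snd (f j)))"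
    have f': "f' \<in> F" using f(1) ij xf fj(2)[OF ij(2)] by (auto simp: F_def f'_def PiE_iff extensional_def)
    have rc: "replace_col Q s i = T f'"
      using Q s r[OF xf] fj(2)[OF ij(2)] by (intro eq_matI) (auto simp: replace_col_def T_def f'_def Q_def s_def)
    have "det (T f') = v $ i * d"
      using cramer_lemma_mat[OF Q v ij(1)] f(2) unfolding Qv rc by (simp add: Q_def)
    then have "v $ i = det (T f') / d" using f(3) by simp
    also have "\<dots> \<in> \<O>"
      using d[of "det (T f')"] f' zero_O by (cases "det (T f') = 0") (auto simp: S_def)
    finally have vi: "v $ i \<in> \<O>" .
    have "col (\<rho> x * Q) j = s"
    proof (rule eq_vecI)
      fix k assume "k < dim_vec s"
      then have k: "k < n" using s by simp
      have "col (\<rho> x * Q) j $ k = (\<Sum>l=0..<n. \<rho> x $$ (k, l) * \<rho> (fst (f j)) $$ (l, snd (f j)))"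
        using k ij r[OF x] by (simp add: Q_def T_def scalar_prod_def)
      also have "\<dots> = s $ k"
        using k fj[OF ij(2)] r[OF x] r[OF fj(1)[OF ij(2)]] r[OF xf]
        by (simp add: s_def matrix_rep_mult[OF \<rho>] x scalar_prod_def)
      finally show "col (\<rho> x * Q) j $ k = s $ k" .
    qed (use s r[OF x] Q in auto)
    moreover have "(P * (\<rho> x * Q)) $$ (i, j) = (P *\<^sub>v col (\<rho> x * Q) j) $ i"
      using P Q ij r[OF x] by simp
    ultimately have "(P * (\<rho> x * Q)) $$ (i, j) = v $ i" by (simp add: v_def)
    moreover have "P * \<rho> x * Q = P * (\<rho> x * Q)" using P Q r[OF x] by (simp add: assoc_mult_mat[of _ n n _ n _ n])
    ultimately show "(P * \<rho> x * Q) $$ (i, j) \<in> \<O>" using vi by simp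
  qed
  then show ?thesis using P Q by (intro that[of P Q]) auto
qed

end

section \<open>Brauer characters\<close>

lemma poly_prod_linear_eq_0_iff:
  fixes x :: "'a::field"
  shows "poly (\<Prod>a\<in>#M. [:- a, 1:]) x = 0 \<longleftrightarrow> x \<in># M"
  by (induction M) (auto simp: algebra_simps simp del: mult_pCons_left)

lemma proots_prod_linear:
  fixes M :: "'a::field multiset"
  shows "proots (\<Prod>a\<in>#M. [:- a, 1:]) = M \<and> (\<Prod>a\<in>#M. [:- a, 1:]) \<noteq> 0"
proof (induction M)
  case (add a M)
  then have "proots ([:- a, 1:] * (\<Prod>a\<in>#M. [:- a, 1:])) = {#a#} + M"
    by (subst proots_mult) auto
  then show ?case using add by (simp del: mult_pCons_left)
qed simp

locale p_modular_group = p_modular_system p \<O> res + group G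
  for p and \<O> :: "'K::field_char_0 set" and res :: "'K \<Rightarrow> 'k::field"
    and G :: "('g, 'm) monoid_scheme" (structure) +
  assumes finite_carrier: "finite (carrier G)"
    and splitting_K: "\<And>H. subgroup H G \<Longrightarrow> splitting_field TYPE('K) (G\<lparr>carrier := H\<rparr>)"
    and splitting_k: "\<And>H. subgroup H G \<Longrightarrow> splitting_field TYPE('k) (G\<lparr>carrier := H\<rparr>)"
begin

lemma cyclic_subgroup: "x \<in> carrier G \<Longrightarrow> subgroup (generate G {x}) G"
  by (intro generate_is_subgroup) auto

lemma ord_gt_0: "x \<in> carrier G \<Longrightarrow> 0 < ord x"
  using ord_ge_1[OF finite_carrier] by fastforce

lemma eigenvalues_K:
  fixes \<rho> :: "'g \<Rightarrow> 'K mat"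
  assumes "x \<in> carrier G" "matrix_rep G n \<rho>"
  obtains M where "char_poly (\<rho> x) = (\<Prod>a\<in>#M. [:- a, 1:])"
    "\<And>j::nat. mat_trace (\<rho> (x [^] j)) = (\<Sum>a\<in>#M. a ^ j)" "\<And>a. a \<in># M \<Longrightarrow> a ^ ord x = 1"
  using cyclic_eigenvalues[OF group_axioms finite_carrier assms(1) splitting_K[OF cyclic_subgroup[OF assms(1)]]
      matrix_rep_subgroup[OF assms(2) group_axioms cyclic_subgroup[OF assms(1)]]] by blast

lemma eigenvalues_k:
  fixes \<rho> :: "'g \<Rightarrow> 'k mat"
  assumes "x \<in> carrier G" "matrix_rep G n \<rho>"
  obtains M where "char_poly (\<rho> x) = (\<Prod>a\<in>#M. [:- a, 1:])"
    "\<And>j::nat. mat_trace (\<rho> (x [^] j)) = (\<Sum>a\<in>#M. a ^ j)" "\<And>a. a \<in># M \<Longrightarrow> a ^ ord x = 1"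
  using cyclic_eigenvalues[OF group_axioms finite_carrier assms(1) splitting_k[OF cyclic_subgroup[OF assms(1)]]
      matrix_rep_subgroup[OF assms(2) group_axioms cyclic_subgroup[OF assms(1)]]] by blast

text \<open>The matrix of the cyclic permutation that \<open>x\<close> induces on the group generated by it has integral
  entries. Over the residue field, \<open>a\<close> is an eigenvalue of it, with eigenvector \<open>(1, a, a\<^sup>2, \<dots>)\<close>. Over \<open>'K\<close> its
  eigenvalues are roots of unity of order dividing \<open>ord x\<close>, and their residues are the eigenvalues over the
  residue field.\<close>

lemma root_of_unity_lifts:
  fixes a :: 'k
  assumes x: "x \<in> carrier G" and a: "a ^ ord x = 1"
  shows "\<exists>z. z ^ ord x = 1 \<and> res z = a"
proof -
  define m where "m = ord x"
  have m: "0 < m" using ord_gt_0[OF x] by (simp add: m_def)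
  define S where "S t = (mat m m (\<lambda>(i, j). if j = (i + t) mod m then 1 else 0) :: 'K mat)" for t
  have S_mod: "S s = S t" if "s mod m = t mod m" for s t
  proof -
    have "(i + s) mod m = (i + t) mod m" for i using that by (metis mod_add_right_eq)
    then show ?thesis by (simp add: S_def)
  qed
  have S_mult: "S s * S t = S (s + t)" for s t
  proof (rule eq_matI)
    fix i j assume "i < dim_row (S (s + t))" "j < dim_col (S (s + t))"
    then have ij: "i < m" "j < m" by (auto simp: S_def)
    have "(S s * S t) $$ (i, j) = (\<Sum>l=0..<m. (if l = (i + s) mod m then 1 else 0) * (if j = (l + t) mod m then 1 else 0))"
      using ij by (simp add: S_def scalar_prod_def)
    also have "\<dots> = (\<Sum>l=0..<m. if l = (i + s) mod m then (if j = (l + t) mod m then 1 else 0) else 0)"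
      by (intro sum.cong) auto
    also have "\<dots> = (if j = ((i + s) mod m + t) mod m then 1 else 0)"
      using m by (subst sum.delta) auto
    also have "((i + s) mod m + t) mod m = (i + (s + t)) mod m" by (simp add: mod_add_left_eq add.assoc)
    finally show "(S s * S t) $$ (i, j) = S (s + t) $$ (i, j)" using ij by (simp add: S_def)
  qed (auto simp: S_def)
  have S_0: "S 0 = 1\<^sub>m m" by (intro eq_matI) (auto simp: S_def)
  define \<tau> where "\<tau> h = S (SOME t. h = x [^] t)" for h
  have \<tau>: "\<tau> (x [^] t) = S t" for t :: nat
  proof -
    define s where "s = (SOME s. x [^] t = x [^] (s::nat))"
    have "x [^] t = x [^] s" unfolding s_def by (rule someI_ex) auto
    then have "x [^] int t = x [^] int s" by (simp add: int_pow_int)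
    then have "int m dvd int s - int t" using int_pow_eq[OF x] by (simp add: m_def)
    then have "int s mod int m = int t mod int m" by (simp add: mod_eq_dvd_iff)
    then have "s mod m = t mod m" by (metis of_nat_eq_iff of_nat_mod)
    then show ?thesis unfolding \<tau>_def s_def[symmetric] by (rule S_mod)
  qed
  define H where "H = G\<lparr>carrier := generate G {x}\<rparr>"
  have H: "group H" unfolding H_def by (rule subgroup.subgroup_is_group[OF cyclic_subgroup[OF x] group_axioms])
  have gen: "\<exists>t::nat. h = x [^] t" if "h \<in> carrier H" for h
    using that generate_pow_nat[OF x] m by (auto simp: H_def m_def)
  have "matrix_rep H m \<tau>"
  proof (rule matrix_repI[OF H])
    fix g assume "g \<in> carrier H"
    then obtain s :: nat where s: "g = x [^] s" using gen by blast
    then show "\<tau> g \<in> carrier_mat m m" by (simp add: \<tau> S_def)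
    fix h assume "h \<in> carrier H"
    then obtain t :: nat where t: "h = x [^] t" using gen by blast
    have "g \<otimes>\<^bsub>H\<^esub> h = x [^] (s + t)" using s t x by (simp add: H_def nat_pow_mult)
    then show "\<tau> (g \<otimes>\<^bsub>H\<^esub> h) = \<tau> g * \<tau> h" by (simp add: s t \<tau> S_mult)
  next
    have "\<one>\<^bsub>H\<^esub> = x [^] (0::nat)" by (simp add: H_def)
    then show "\<tau> \<one>\<^bsub>H\<^esub> = 1\<^sub>m m" by (simp only: \<tau> S_0)
  qed
  from cyclic_eigenvalues[OF group_axioms finite_carrier x splitting_K[OF cyclic_subgroup[OF x]] this[unfolded H_def]]
  obtain M where M: "char_poly (\<tau> x) = (\<Prod>a\<in>#M. [:- a, 1:])" "\<And>b. b \<in># M \<Longrightarrow> b ^ m = 1"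
    by (auto simp: m_def)
  have "\<tau> x = S 1" using \<tau>[of 1] x by simp
  then have cp: "char_poly (S 1) = (\<Prod>a\<in>#M. [:- a, 1:])" using M by simp
  have MO: "b \<in> \<O>" if "b \<in># M" for b using root_of_unity_O[OF M(2)[OF that] m] .
  define C where "C = map_mat res (S 1)"
  have C: "C \<in> carrier_mat m m" by (simp add: C_def S_def)
  have "map_poly res (char_poly (S 1)) = char_poly C"
    unfolding C_def by (rule map_res_char_poly[of _ m]) (auto simp: S_def integral_mat_def zero_O one_O)
  then have cpC: "char_poly C = (\<Prod>a\<in>#image_mset res M. [:- a, 1:])"
    using map_res_prod_mset[of M] MO cp by simp
  define v where "v = vec m (\<lambda>i. a ^ i)"
  have "C *\<^sub>v v = a \<cdot>\<^sub>v v"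
  proof (rule eq_vecI)
    fix i assume "i < dim_vec (a \<cdot>\<^sub>v v)"
    then have i: "i < m" by (simp add: v_def)
    have "(C *\<^sub>v v) $ i = (\<Sum>l=0..<m. (if l = (i + 1) mod m then 1 else 0) * a ^ l)"
      using i by (auto simp: C_def S_def v_def scalar_prod_def res_one res_zero intro!: sum.cong)
    also have "\<dots> = (\<Sum>l=0..<m. if l = (i + 1) mod m then a ^ l else 0)"
      by (intro sum.cong) auto
    also have "\<dots> = a ^ ((i + 1) mod m)" using m by (subst sum.delta) auto
    also have "\<dots> = a ^ (i + 1)"
    proof -
      have "a ^ (i + 1) = a ^ (m * ((i + 1) div m) + (i + 1) mod m)" by simp
      also have "\<dots> = (a ^ m) ^ ((i + 1) div m) * a ^ ((i + 1) mod m)" by (simp only: power_add power_mult)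
      finally show ?thesis using a by (simp add: m_def)
    qed
    finally show "(C *\<^sub>v v) $ i = (a \<cdot>\<^sub>v v) $ i" using i by (simp add: v_def)
  qed (simp add: v_def C_def S_def)
  moreover have "v \<noteq> 0\<^sub>v m"
  proof
    assume "v = 0\<^sub>v m"
    then have "v $ 0 = 0" using m by simp
    then show False using m by (simp add: v_def)
  qed
  ultimately have "eigenvalue C a"
    unfolding eigenvalue_def eigenvector_def using C by (intro exI[of _ v]) (auto simp: v_def)
  then have "a \<in># image_mset res M"
    using eigenvalue_root_char_poly[OF C] poly_prod_linear_eq_0_iff cpC by metis
  then show ?thesis using M(2) by (auto simp: m_def)
qed

lemma p_regularD: "x \<in> p_regular p G \<Longrightarrow> x \<in> carrier G" "x \<in> p_regular p G \<Longrightarrow> \<not> p dvd ord x"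
  by (auto simp: p_regular_def)

lemma res_brauer_character:
  assumes x: "x \<in> p_regular p G" and \<tau>: "matrix_rep G n \<tau>"
  shows "brauer_character p \<O> res G \<tau> x \<in> \<O>"
    "res (brauer_character p \<O> res G \<tau> x) = mat_trace (\<tau> x)"
proof -
  note xG = p_regularD(1)[OF x]
  obtain M where M: "char_poly (\<tau> x) = (\<Prod>a\<in>#M. [:- a, 1:])"
    "\<And>j::nat. mat_trace (\<tau> (x [^] j)) = (\<Sum>a\<in>#M. a ^ j)" "\<And>a. a \<in># M \<Longrightarrow> a ^ ord x = 1"
    by (rule eigenvalues_k[OF xG \<tau>]) (rule that)
  have lift: "root_lift p \<O> res a \<in> \<O> \<and> res (root_lift p \<O> res a) = a" if a: "a \<in># M" for a
  proof -
    obtain z where z: "z ^ ord x = 1" "res z = a" using root_of_unity_lifts[OF xG M(3)[OF a]] by blast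
    then have "root_lift p \<O> res a = z"
      using root_lift_res[OF z(1) ord_gt_0[OF xG] p_regularD(2)[OF x]] by simp
    then show ?thesis using z root_of_unity_O[OF z(1) ord_gt_0[OF xG]] by simp
  qed
  have b: "brauer_character p \<O> res G \<tau> x = (\<Sum>a\<in>#M. root_lift p \<O> res a)"
    using x M(1) proots_prod_linear[of M] by (simp add: brauer_character_def)
  have "(\<Sum>a\<in>#N. root_lift p \<O> res a) \<in> \<O> \<and> res (\<Sum>a\<in>#N. root_lift p \<O> res a) = (\<Sum>a\<in>#N. a)"
    if "N \<subseteq># M" for N
    using that
  proof (induction N)
    case (add a N)
    then have "a \<in># M" "N \<subseteq># M" using mset_subset_eq_insertD[OF add.prems]
      by (auto intro: subset_mset.less_imp_le)
    then show ?case using add.IH lift[of a] by (simp add: add_O res_add)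
  qed (simp add: zero_O res_zero)
  from this[of M] M(2)[of 1] xG show "brauer_character p \<O> res G \<tau> x \<in> \<O>"
    "res (brauer_character p \<O> res G \<tau> x) = mat_trace (\<tau> x)" by (simp_all add: b)
qed

text \<open>The eigenvalues of \<open>\<rho> x\<close> are roots of unity of order prime to \<open>p\<close>, hence they are themselves the lifts
  of the eigenvalues of the reduction.\<close>

lemma brauer_character_reduction:
  assumes x: "x \<in> p_regular p G" and \<rho>: "matrix_rep G n \<rho>"
    and int: "\<And>y. y \<in> carrier G \<Longrightarrow> integral_mat (\<rho> y)"
  shows "brauer_character p \<O> res G (\<lambda>y. map_mat res (\<rho> y)) x = mat_trace (\<rho> x)"
proof -
  note xG = p_regularD(1)[OF x]
  obtain M where M: "char_poly (\<rho> x) = (\<Prod>a\<in>#M. [:- a, 1:])"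
    "\<And>j::nat. mat_trace (\<rho> (x [^] j)) = (\<Sum>a\<in>#M. a ^ j)" "\<And>a. a \<in># M \<Longrightarrow> a ^ ord x = 1"
    by (rule eigenvalues_K[OF xG \<rho>]) (rule that)
  have "char_poly (map_mat res (\<rho> x)) = (\<Prod>a\<in>#image_mset res M. [:- a, 1:])"
    using map_res_char_poly[OF matrix_rep_carrier[OF \<rho> xG] int[OF xG]] map_res_prod_mset[of M] M
      root_of_unity_O[OF M(3) ord_gt_0[OF xG]] by simp
  then have "brauer_character p \<O> res G (\<lambda>y. map_mat res (\<rho> y)) x = (\<Sum>a\<in>#image_mset res M. root_lift p \<O> res a)"
    using x proots_prod_linear[of "image_mset res M"] by (simp add: brauer_character_def)
  also have "\<dots> = (\<Sum>a\<in>#M. a)"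
    using root_lift_res[OF M(3) ord_gt_0[OF xG] p_regularD(2)[OF x]]
    by (simp add: image_mset.compositionality comp_def cong: image_mset_cong)
  finally show ?thesis using M(2)[of 1] xG by simp
qed

text \<open>Let \<open>ord x = p\<^sup>e m\<close> with \<open>m\<close> prime to \<open>p\<close>, and choose an exponent \<open>q\<close> divisible by \<open>p\<^sup>e\<close> and congruent to
  \<open>1\<close> modulo \<open>m\<close>. Then \<open>x\<close> to the power \<open>q\<close> is \<open>p\<close>-regular. The eigenvalues of \<open>\<tau> x\<close> are \<open>m\<close>-th roots of
  unity, because a field of characteristic \<open>p\<close> has no other roots of unity of order dividing \<open>ord x\<close>;
  so they do not change when raised to the power \<open>q\<close>.\<close>

lemma trace_p_regular_part:
  assumes x: "x \<in> carrier G"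
  obtains q :: nat where "x [^] q \<in> p_regular p G"
    "\<And>n (\<tau> :: 'g \<Rightarrow> 'k mat). matrix_rep G n \<tau> \<Longrightarrow> mat_trace (\<tau> (x [^] q)) = mat_trace (\<tau> x)"
proof -
  have nu: "\<not> is_unit p" using prime_p by auto
  obtain m where m: "ord x = p ^ multiplicity p (ord x) * m" "\<not> p dvd m"
    using multiplicity_decompose'[of "ord x" p] ord_gt_0[OF x] nu by auto
  define e where "e = multiplicity p (ord x)"
  have om: "ord x = p ^ e * m" using m by (simp add: e_def)
  have m0: "0 < m" using om ord_gt_0[OF x] by (cases m) auto
  \<comment> \<open>Euler's theorem makes \<open>q\<close> congruent to \<open>1\<close> modulo \<open>m\<close>.\<close>
  define q where "q = p ^ (e * totient m)"
  have cop: "coprime (p ^ e) m" using m(2) prime_p by (simp add: prime_imp_coprime)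
  have "[(p ^ e) ^ totient m = 1] (mod m)" by (rule euler_theorem[OF cop])
  then have "[q = 1] (mod m)" by (simp add: q_def power_mult)
  moreover have q1: "1 \<le> q" using prime_gt_0_nat[OF prime_p] by (simp add: q_def)
  ultimately have "m dvd q - 1" by (simp add: cong_altdef_nat)
  then obtain t where t: "q = 1 + m * t" using q1 by (metis dvdE le_add_diff_inverse)
  have "0 < totient m" using m0 by simp
  then have "e * 1 \<le> e * totient m" by (intro mult_le_mono2) linarith
  then have "p ^ e dvd q" unfolding q_def by (intro le_imp_power_dvd) simp
  then obtain u where u: "q = p ^ e * u" by (elim dvdE)
  have "(x [^] q) [^] m = \<one>"
  proof -
    have "(x [^] q) [^] m = x [^] (ord x * u)" using x by (simp add: nat_pow_pow u om mult.commute mult.left_commute)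
    then show ?thesis using x by (simp add: pow_eq_id)
  qed
  then have "ord (x [^] q) dvd m" using x by (simp add: pow_eq_id)
  then have reg: "x [^] q \<in> p_regular p G" using m(2) x unfolding p_regular_def by (auto dest: dvd_trans)
  have "mat_trace (\<tau> (x [^] q)) = mat_trace (\<tau> x)" if \<tau>: "matrix_rep G n \<tau>" for n and \<tau> :: "'g \<Rightarrow> 'k mat"
  proof -
    obtain M where M: "char_poly (\<tau> x) = (\<Prod>a\<in>#M. [:- a, 1:])"
      "\<And>j::nat. mat_trace (\<tau> (x [^] j)) = (\<Sum>a\<in>#M. a ^ j)" "\<And>a. a \<in># M \<Longrightarrow> a ^ ord x = 1"
      by (rule eigenvalues_k[OF x \<tau>]) (rule that)
    have "a ^ q = a" if "a \<in># M" for a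
    proof -
      have 1: "(a ^ m) ^ p ^ e = 1" using M(3)[OF that] by (simp add: om mult.commute flip: power_mult)
      have "(a ^ m - 1 + 1) ^ p ^ e = (a ^ m - 1) ^ p ^ e + 1 ^ p ^ e"
        using prime_p by (intro freshmans_dream') (auto simp: char_k)
      then have "a ^ m = 1" using 1 by simp
      then show ?thesis by (simp add: t power_mult)
    qed
    then have "(\<Sum>a\<in>#M. a ^ q) = (\<Sum>a\<in>#M. a ^ 1)" by (simp cong: image_mset_cong)
    then show ?thesis using M(2)[of q] M(2)[of 1] x by simp
  qed
  with reg show ?thesis by (rule that)
qed

lemma ibr_representatives:
  obtains D :: "('g \<Rightarrow> 'K) \<Rightarrow> nat" and R :: "('g \<Rightarrow> 'K) \<Rightarrow> 'g \<Rightarrow> 'k mat"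
  where "\<And>\<phi>. \<phi> \<in> IBr p \<O> res G \<Longrightarrow> irreducible_rep G (D \<phi>) (R \<phi>)"
    "\<And>\<phi>. \<phi> \<in> IBr p \<O> res G \<Longrightarrow> brauer_character p \<O> res G (R \<phi>) = \<phi>"
proof -
  have "\<forall>\<phi>\<in>IBr p \<O> res G. \<exists>r :: nat \<times> ('g \<Rightarrow> 'k mat).
      irreducible_rep G (fst r) (snd r) \<and> brauer_character p \<O> res G (snd r) = \<phi>"
    by (auto simp: IBr_def)
  then obtain f :: "('g \<Rightarrow> 'K) \<Rightarrow> nat \<times> ('g \<Rightarrow> 'k mat)" where
    "\<forall>\<phi>\<in>IBr p \<O> res G. irreducible_rep G (fst (f \<phi>)) (snd (f \<phi>)) \<and> brauer_character p \<O> res G (snd (f \<phi>)) = \<phi>"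
    using bchoice by meson
  then show ?thesis by (intro that[of "\<lambda>\<phi>. fst (f \<phi>)" "\<lambda>\<phi>. snd (f \<phi>)"]) auto
qed

section \<open>Independence of irreducible Brauer characters\<close>

lemma splitting_field_G:
  "splitting_field TYPE('K) G" "splitting_field TYPE('k) G"
  using splitting_K[OF subgroup_self] splitting_k[OF subgroup_self] by simp_all

lemma equivalent_reps_brauer_character:
  assumes \<rho>: "matrix_rep G n \<rho>" and eq: "equivalent_reps G n \<rho> \<sigma>"
  shows "brauer_character p \<O> res G \<sigma> = brauer_character p \<O> res G \<rho>"
proof -
  obtain A B where AB: "A \<in> carrier_mat n n" "B \<in> carrier_mat n n" "A * B = 1\<^sub>m n" "B * A = 1\<^sub>m n"
    "\<And>x. x \<in> carrier G \<Longrightarrow> \<sigma> x = A * \<rho> x * B" using eq unfolding equivalent_reps_def by blast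
  have "char_poly (\<sigma> x) = char_poly (\<rho> x)" if "x \<in> p_regular p G" for x
    using conjugate_rep(2)[OF group_axioms \<rho> AB(1-4) p_regularD(1)[OF that]] AB(5) p_regularD(1)[OF that] by simp
  then show ?thesis unfolding brauer_character_def by (intro ext) (simp add: restrict_def)
qed

text \<open>Representations with different Brauer characters are inequivalent, so this is the theorem of Frobenius
  and Schur for scalar matrices.\<close>

lemma brauer_traces_independent:
  fixes R :: "('g \<Rightarrow> 'K) \<Rightarrow> 'g \<Rightarrow> 'k mat"
  assumes fin: "finite F" and irr: "\<And>\<phi>. \<phi> \<in> F \<Longrightarrow> irreducible_rep G (D \<phi>) (R \<phi>)"
    and br: "\<And>\<phi>. \<phi> \<in> F \<Longrightarrow> brauer_character p \<O> res G (R \<phi>) = \<phi>"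
    and rel: "\<And>x. x \<in> carrier G \<Longrightarrow> (\<Sum>\<phi>\<in>F. c \<phi> * mat_trace (R \<phi> x)) = 0"
    and \<phi>: "\<phi> \<in> F"
  shows "c \<phi> = 0"
proof -
  have "c \<phi> \<cdot>\<^sub>m 1\<^sub>m (D \<phi>) = 0\<^sub>m (D \<phi>) (D \<phi>)"
  proof (rule frobenius_schur[OF group_axioms fin irr, where M = "\<lambda>\<phi>. c \<phi> \<cdot>\<^sub>m 1\<^sub>m (D \<phi>)"])
    show "\<exists>c. A = c \<cdot>\<^sub>m 1\<^sub>m (D i)" if "i \<in> F" "A \<in> carrier_mat (D i) (D i)"
      "\<And>x. x \<in> carrier G \<Longrightarrow> A * R i x = R i x * A" for i A
      using splitting_field_G(2) irr[OF that(1)] that(2,3) unfolding splitting_field_def by blast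
    show "i = j" if "i \<in> F" "j \<in> F" "D i = D j" "equivalent_reps G (D i) (R i) (R j)" for i j
      using equivalent_reps_brauer_character[OF irreducible_repD(1)[OF irr[OF that(1)]] that(4)]
        br[OF that(1)] br[OF that(2)] by simp
    show "(\<Sum>i\<in>F. mat_trace (R i x * (c i \<cdot>\<^sub>m 1\<^sub>m (D i)))) = 0" if x: "x \<in> carrier G" for x
    proof -
      have "mat_trace (R i x * (c i \<cdot>\<^sub>m 1\<^sub>m (D i))) = c i * mat_trace (R i x)" if "i \<in> F" for i
      proof -
        note r = matrix_rep_carrier[OF irreducible_repD(1)[OF irr[OF that]] x]
        have "R i x * (c i \<cdot>\<^sub>m 1\<^sub>m (D i)) = c i \<cdot>\<^sub>m R i x"
          using r by (simp add: mult_smult_distrib[OF r one_carrier_mat])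
        then show ?thesis using r by (simp add: mat_trace_smult)
      qed
      then show ?thesis using rel[OF x] by simp
    qed
  qed (use \<phi> in auto)
  then have "(c \<phi> \<cdot>\<^sub>m 1\<^sub>m (D \<phi>)) $$ (0, 0) = 0\<^sub>m (D \<phi>) (D \<phi>) $$ (0, 0)" by simp
  then show ?thesis using irreducible_repD(2)[OF irr[OF \<phi>]] by simp
qed

text \<open>With more irreducible Brauer characters than group elements, a linear relation between the traces
  would exist, since it solves a system with more unknowns than equations.\<close>

lemma finite_IBr: "finite (IBr p \<O> res G)"
proof (rule ccontr)
  assume "infinite (IBr p \<O> res G)"
  then obtain F where F: "F \<subseteq> IBr p \<O> res G" "finite F" "card F = Suc (card (carrier G))"
    using infinite_arbitrarily_large by blast
  obtain D R where irr: "\<And>\<phi>. \<phi> \<in> IBr p \<O> res G \<Longrightarrow> irreducible_rep G (D \<phi>) (R \<phi> :: 'g \<Rightarrow> 'k mat)"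
    and br: "\<And>\<phi>. \<phi> \<in> IBr p \<O> res G \<Longrightarrow> brauer_character p \<O> res G (R \<phi>) = \<phi>"
    by (rule ibr_representatives) (rule that)
  define N where "N = card (carrier G)"
  obtain g where g: "bij_betw g {..<N} (carrier G)"
    using ex_bij_betw_nat_finite[OF finite_carrier] by (auto simp: N_def lessThan_atLeast0)
  obtain f where f: "bij_betw f {..<Suc N} F"
    using ex_bij_betw_nat_finite[OF F(2)] F(3) by (auto simp: N_def lessThan_atLeast0)
  define A where "A = mat N (Suc N) (\<lambda>(i, j). mat_trace (R (f j) (g i)))"
  obtain v where v: "v \<in> carrier_vec (Suc N)" "v \<noteq> 0\<^sub>v (Suc N)" "A *\<^sub>v v = 0\<^sub>v N"
    using wide_matrix_kernel[of A N "Suc N"] by (auto simp: A_def)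
  define c where "c \<phi> = v $ (the_inv_into {..<Suc N} f \<phi>)" for \<phi>
  have cf: "c (f j) = v $ j" if "j < Suc N" for j
    using that f by (simp add: c_def the_inv_into_f_f bij_betw_def)
  have rel: "(\<Sum>\<phi>\<in>F. c \<phi> * mat_trace (R \<phi> x)) = 0" if x: "x \<in> carrier G" for x
  proof -
    obtain i where i: "i < N" "x = g i" using g x by (auto simp: bij_betw_def)
    have "(\<Sum>\<phi>\<in>F. c \<phi> * mat_trace (R \<phi> x)) = (\<Sum>j<Suc N. c (f j) * mat_trace (R (f j) x))"
      by (rule sum.reindex_bij_betw[OF f, symmetric])
    also have "\<dots> = (\<Sum>j<Suc N. v $ j * mat_trace (R (f j) x))" by (intro sum.cong) (auto simp: cf)
    also have "\<dots> = (A *\<^sub>v v) $ i"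
      using i v(1) by (auto simp: A_def scalar_prod_def lessThan_atLeast0 mult.commute intro!: sum.cong)
    finally show ?thesis using v(3) i by simp
  qed
  have "v $ j = 0" if j: "j < Suc N" for j
  proof -
    have "f j \<in> F" using f j by (auto simp: bij_betw_def)
    then have "c (f j) = 0"
      using F(1) irr br rel by (intro brauer_traces_independent[OF F(2), of D R c]) auto
    then show ?thesis using cf[OF j] by simp
  qed
  then have "v = 0\<^sub>v (Suc N)" using v(1) by (intro eq_vecI) auto
  with v(2) show False by simp
qed

text \<open>Modulo the maximal ideal, a relation between Brauer characters becomes a relation between traces, at
  first on \<open>p\<close>-regular elements only. Traces do not distinguish an element from its \<open>p\<close>-regular part, so
  the relation holds on all of \<open>G\<close>, where the traces are independent.\<close>

lemma brauer_relation_mod_p: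
  assumes c: "\<And>\<phi>. \<phi> \<in> IBr p \<O> res G \<Longrightarrow> c \<phi> \<in> \<O>"
    and rel: "\<And>x. x \<in> p_regular p G \<Longrightarrow> res (\<Sum>\<phi>\<in>IBr p \<O> res G. c \<phi> * \<phi> x) = 0"
    and \<phi>: "\<phi> \<in> IBr p \<O> res G"
  shows "res (c \<phi>) = 0"
proof -
  obtain D R where irr: "\<And>\<phi>. \<phi> \<in> IBr p \<O> res G \<Longrightarrow> irreducible_rep G (D \<phi>) (R \<phi> :: 'g \<Rightarrow> 'k mat)"
    and br: "\<And>\<phi>. \<phi> \<in> IBr p \<O> res G \<Longrightarrow> brauer_character p \<O> res G (R \<phi>) = \<phi>"
    by (rule ibr_representatives) (rule that)
  note rep = irreducible_repD(1)[OF irr]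
  show ?thesis
  proof (rule brauer_traces_independent[OF finite_IBr irr br, where c = "\<lambda>\<phi>. res (c \<phi>)"])
    fix x assume x: "x \<in> carrier G"
    obtain q :: nat where q: "x [^] q \<in> p_regular p G"
      "\<And>n (\<tau> :: 'g \<Rightarrow> 'k mat). matrix_rep G n \<tau> \<Longrightarrow> mat_trace (\<tau> (x [^] q)) = mat_trace (\<tau> x)"
      by (rule trace_p_regular_part[OF x]) (rule that)
    define y where "y = x [^] q"
    have val: "\<psi> y \<in> \<O>" "res (\<psi> y) = mat_trace (R \<psi> x)" if "\<psi> \<in> IBr p \<O> res G" for \<psi>
      using res_brauer_character[OF q(1) rep[OF that]] br[OF that] q(2)[OF rep[OF that]] by (simp_all add: y_def)
    have "(\<Sum>\<psi>\<in>IBr p \<O> res G. res (c \<psi>) * mat_trace (R \<psi> x)) = (\<Sum>\<psi>\<in>IBr p \<O> res G. res (c \<psi> * \<psi> y))"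
      using val c by (intro sum.cong) (auto simp: res_mult)
    also have "\<dots> = res (\<Sum>\<psi>\<in>IBr p \<O> res G. c \<psi> * \<psi> y)"
      using val c by (intro res_sum[symmetric] mult_O)
    also have "\<dots> = 0" unfolding y_def by (rule rel[OF q(1)])
    finally show "(\<Sum>\<psi>\<in>IBr p \<O> res G. res (c \<psi>) * mat_trace (R \<psi> x)) = 0" .
  qed (use \<phi> in simp_all)
qed

lemma of_int_O: "of_int i \<in> \<O>"
  and res_of_int: "res (of_int i) = of_int i"
  by (cases i rule: int_cases2; simp add: of_nat_O uminus_O res_uminus res_of_nat)+

text \<open>By the reduction modulo \<open>p\<close>, all coefficients of an integral relation are divisible by \<open>p\<close>. Dividing them
  by \<open>p\<close> gives another integral relation, so they are divisible by every power of \<open>p\<close>.\<close>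

lemma brauer_characters_independent:
  fixes m :: "('g \<Rightarrow> 'K) \<Rightarrow> int"
  assumes rel: "\<And>x. x \<in> p_regular p G \<Longrightarrow> (\<Sum>\<phi>\<in>IBr p \<O> res G. of_int (m \<phi>) * \<phi> x) = 0"
    and \<phi>: "\<phi> \<in> IBr p \<O> res G"
  shows "m \<phi> = 0"
proof -
  have div: "int p ^ N dvd m \<phi>"
    if "\<And>x. x \<in> p_regular p G \<Longrightarrow> (\<Sum>\<phi>\<in>IBr p \<O> res G. of_int (m \<phi>) * \<phi> x) = 0" "\<phi> \<in> IBr p \<O> res G"
    for N m \<phi>
    using that
  proof (induction N arbitrary: m \<phi>)
    case (Suc N)
    have "int p dvd m \<psi>" if "\<psi> \<in> IBr p \<O> res G" for \<psi>
    proof -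
      have "res (of_int (m \<psi>)) = 0"
        by (rule brauer_relation_mod_p[OF _ _ that]) (simp_all add: of_int_O Suc.prems(1) res_zero)
      then show ?thesis by (simp add: res_of_int of_int_eq_0_iff_char_dvd char_k)
    qed
    then have m: "m \<psi> = int p * (m \<psi> div int p)" if "\<psi> \<in> IBr p \<O> res G" for \<psi> using that by simp
    have "(\<Sum>\<psi>\<in>IBr p \<O> res G. of_int (m \<psi> div int p) * \<psi> x) = 0" if x: "x \<in> p_regular p G" for x
    proof -
      have "of_nat p * (\<Sum>\<psi>\<in>IBr p \<O> res G. of_int (m \<psi> div int p) * \<psi> x) =
          (\<Sum>\<psi>\<in>IBr p \<O> res G. of_int (int p * (m \<psi> div int p)) * \<psi> x)"
        by (simp add: sum_distrib_left mult.assoc)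
      also have "\<dots> = (\<Sum>\<psi>\<in>IBr p \<O> res G. of_int (m \<psi>) * \<psi> x)"
        using m by (intro sum.cong) auto
      finally show ?thesis using Suc.prems(1)[OF x] prime_gt_0_nat[OF prime_p] by simp
    qed
    then have "int p ^ N dvd m \<phi> div int p" using Suc.prems(2) by (rule Suc.IH)
    then have "int p * int p ^ N dvd int p * (m \<phi> div int p)" by (rule mult_dvd_mono[OF dvd_refl])
    then show ?case using m[OF Suc.prems(2)] by simp
  qed simp
  show ?thesis
  proof (rule ccontr)
    assume nz: "m \<phi> \<noteq> 0"
    define N where "N = nat \<bar>m \<phi>\<bar>"
    have "int p ^ N dvd m \<phi>" using div rel \<phi> by blast
    then have "\<bar>int p ^ N\<bar> \<le> \<bar>m \<phi>\<bar>" using nz dvd_imp_le_int by blast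
    then have "p ^ N \<le> N" by (simp add: N_def flip: of_nat_power)
    moreover have "N < p ^ N" using power_gt_expt[of p N] prime_gt_1_nat[OF prime_p] by simp
    ultimately show False by simp
  qed
qed

section \<open>Decomposition numbers\<close>

lemma brauer_character_decomposition:
  assumes "matrix_rep G n \<tau>"
  shows "\<exists>d :: ('g \<Rightarrow> 'K) \<Rightarrow> nat. (\<forall>\<phi>. \<phi> \<notin> IBr p \<O> res G \<longrightarrow> d \<phi> = 0) \<and>
    (\<forall>x\<in>p_regular p G. brauer_character p \<O> res G \<tau> x = (\<Sum>\<phi>\<in>IBr p \<O> res G. of_nat (d \<phi>) * \<phi> x))"
  using group_axioms assms
proof (induction rule: composition_series_induct)
  case (zero \<tau>)
  have "char_poly (\<tau> x) = 1" if "x \<in> carrier G" for x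
    using degree_monic_char_poly[OF matrix_rep_carrier[OF zero that]] by (auto elim: degree_eq_zeroE)
  then have "brauer_character p \<O> res G \<tau> x = 0" if "x \<in> p_regular p G" for x
    using that p_regularD(1)[OF that] by (simp add: brauer_character_def)
  then show ?case by (intro exI[of _ "\<lambda>_. 0"]) simp
next
  case (irreducible n \<tau>)
  define \<psi> where "\<psi> = brauer_character p \<O> res G \<tau>"
  have \<psi>: "\<psi> \<in> IBr p \<O> res G" using irreducible by (auto simp: IBr_def \<psi>_def)
  have "(\<Sum>\<phi>\<in>IBr p \<O> res G. of_nat (if \<phi> = \<psi> then 1 else 0) * \<phi> x) = \<psi> x" for x
  proof -
    have "(\<Sum>\<phi>\<in>IBr p \<O> res G. of_nat (if \<phi> = \<psi> then 1 else 0) * \<phi> x) =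
        (\<Sum>\<phi>\<in>IBr p \<O> res G. if \<phi> = \<psi> then \<phi> x else 0)" by (intro sum.cong) auto
    then show ?thesis using \<psi> finite_IBr by simp
  qed
  then show ?case using \<psi> by (intro exI[of _ "\<lambda>\<phi>. if \<phi> = \<psi> then 1 else 0"]) (auto simp: \<psi>_def)
next
  case (extension m k \<tau>1 \<tau>2 \<tau>)
  obtain d1 :: "('g \<Rightarrow> 'K) \<Rightarrow> nat" where d1: "\<forall>\<phi>. \<phi> \<notin> IBr p \<O> res G \<longrightarrow> d1 \<phi> = 0"
    "\<forall>x\<in>p_regular p G. brauer_character p \<O> res G \<tau>1 x = (\<Sum>\<phi>\<in>IBr p \<O> res G. of_nat (d1 \<phi>) * \<phi> x)"
    using extension.IH(1) by blast
  obtain d2 :: "('g \<Rightarrow> 'K) \<Rightarrow> nat" where d2: "\<forall>\<phi>. \<phi> \<notin> IBr p \<O> res G \<longrightarrow> d2 \<phi> = 0"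
    "\<forall>x\<in>p_regular p G. brauer_character p \<O> res G \<tau>2 x = (\<Sum>\<phi>\<in>IBr p \<O> res G. of_nat (d2 \<phi>) * \<phi> x)"
    using extension.IH(2) by blast
  have "brauer_character p \<O> res G \<tau> x = brauer_character p \<O> res G \<tau>1 x + brauer_character p \<O> res G \<tau>2 x"
    if x: "x \<in> p_regular p G" for x
  proof -
    note xG = p_regularD(1)[OF x]
    have nz: "char_poly (\<tau>1 x) \<noteq> 0" "char_poly (\<tau>2 x) \<noteq> 0"
      using degree_monic_char_poly[OF matrix_rep_carrier[OF extension.hyps(1) xG]]
        degree_monic_char_poly[OF matrix_rep_carrier[OF extension.hyps(2) xG]] by auto
    show ?thesis using x extension.hyps(4)[OF xG] by (simp add: brauer_character_def proots_mult[OF nz])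
  qed
  then show ?case using d1 d2
    by (intro exI[of _ "\<lambda>\<phi>. d1 \<phi> + d2 \<phi>"]) (simp add: sum.distrib distrib_right)
qed

text \<open>Decomposition numbers are given by a definite description. Existence comes from a composition series
  of \<open>\<tau>\<close>, uniqueness from the independence of the irreducible Brauer characters.\<close>

lemma decomposition_number_spec:
  assumes \<tau>: "matrix_rep G n \<tau>" and \<chi>: "\<And>x. x \<in> p_regular p G \<Longrightarrow> \<chi> x = brauer_character p \<O> res G \<tau> x"
    and x: "x \<in> p_regular p G"
  shows "\<chi> x = (\<Sum>\<phi>\<in>IBr p \<O> res G. of_nat (decomposition_number p \<O> res G \<chi> \<phi>) * \<phi> x)"
proof -
  let ?P = "\<lambda>d. (\<forall>\<phi>. \<phi> \<notin> IBr p \<O> res G \<longrightarrow> d \<phi> = 0) \<and>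
    (\<forall>x\<in>p_regular p G. \<chi> x = (\<Sum>\<phi>\<in>IBr p \<O> res G. of_nat (d \<phi>) * \<phi> x))"
  obtain d :: "('g \<Rightarrow> 'K) \<Rightarrow> nat" where d: "?P d" using brauer_character_decomposition[OF \<tau>] \<chi> by auto
  have unique: "d' = d" if d': "?P d'" for d'
  proof
    fix \<phi>
    show "d' \<phi> = d \<phi>"
    proof (cases "\<phi> \<in> IBr p \<O> res G")
      case True
      have "int (d' \<phi>) - int (d \<phi>) = 0"
      proof (rule brauer_characters_independent[OF _ True])
        fix x assume "x \<in> p_regular p G"
        then have "\<chi> x = (\<Sum>\<phi>\<in>IBr p \<O> res G. of_nat (d \<phi>) * \<phi> x)" "\<chi> x = (\<Sum>\<phi>\<in>IBr p \<O> res G. of_nat (d' \<phi>) * \<phi> x)"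
          using d d' by blast+
        then show "(\<Sum>\<phi>\<in>IBr p \<O> res G. of_int (int (d' \<phi>) - int (d \<phi>)) * \<phi> x) = 0"
          by (simp add: left_diff_distrib sum_subtractf)
      qed
      then show ?thesis by simp
    next
      case False
      then show ?thesis using d d' by simp
    qed
  qed
  have "?P (THE d. ?P d)" using d unique by (rule theI[where P = ?P])
  then have "?P (decomposition_number p \<O> res G \<chi>)" unfolding decomposition_number_def .
  then show ?thesis using x by blast
qed

lemma decomposition_numbers_divisible:
  assumes \<tau>: "matrix_rep G n \<tau>" and \<chi>: "\<And>x. x \<in> p_regular p G \<Longrightarrow> \<chi> x = brauer_character p \<O> res G \<tau> x"
    and res: "\<And>x. x \<in> p_regular p G \<Longrightarrow> res (\<chi> x) = 0"
    and \<phi>: "\<phi> \<in> IBr p \<O> res G"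
  shows "p dvd decomposition_number p \<O> res G \<chi> \<phi>"
proof -
  have "res (of_nat (decomposition_number p \<O> res G \<chi> \<phi>)) = 0"
    by (rule brauer_relation_mod_p[OF _ _ \<phi>])
      (simp_all add: of_nat_O res decomposition_number_spec[OF \<tau> \<chi>, symmetric])
  then show ?thesis by (simp add: res_of_nat of_nat_res_eq_0_iff)
qed

end

section \<open>Irreducibility\<close>

lemma conjugate_irreducible:
  fixes \<rho> :: "'g \<Rightarrow> 'F::field mat"
  assumes G: "group G" and \<rho>: "irreducible_rep G n \<rho>" and PQ: "P \<in> carrier_mat n n" "Q \<in> carrier_mat n n"
    "P * Q = 1\<^sub>m n" "Q * P = 1\<^sub>m n"
  shows "irreducible_rep G n (\<lambda>x. P * \<rho> x * Q)"
proof (rule irreducible_repI[OF conjugate_rep(1)[OF G irreducible_repD(1)[OF \<rho>] PQ] irreducible_repD(2)[OF \<rho>]])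
  note r = matrix_rep_carrier[OF irreducible_repD(1)[OF \<rho>]]
  fix W :: "'F vec set"
  assume W: "W \<subseteq> carrier_vec n" "0\<^sub>v n \<in> W" "\<And>v w. v \<in> W \<Longrightarrow> w \<in> W \<Longrightarrow> v + w \<in> W"
    "\<And>c v. v \<in> W \<Longrightarrow> c \<cdot>\<^sub>v v \<in> W" "\<And>x v. x \<in> carrier G \<Longrightarrow> v \<in> W \<Longrightarrow> P * \<rho> x * Q *\<^sub>v v \<in> W"
  have PQv: "P *\<^sub>v (Q *\<^sub>v v) = v" if "v \<in> carrier_vec n" for v
    using assoc_mult_mat_vec[OF PQ(1,2) that] PQ(3) that by simp
  have QPv: "Q *\<^sub>v (P *\<^sub>v v) = v" if "v \<in> carrier_vec n" for v
    using assoc_mult_mat_vec[OF PQ(2,1) that] PQ(4) that by simp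
  have P0: "P *\<^sub>v 0\<^sub>v n = 0\<^sub>v n" using PQ by (intro eq_vecI) auto
  let ?W = "{v \<in> carrier_vec n. P *\<^sub>v v \<in> W}"
  have "?W = {0\<^sub>v n} \<or> ?W = carrier_vec n"
  proof (rule irreducible_repD(3)[OF \<rho>])
    show "\<rho> x *\<^sub>v v \<in> ?W" if x: "x \<in> carrier G" and v: "v \<in> ?W" for x v
    proof -
      have vc: "v \<in> carrier_vec n" and Pv: "P *\<^sub>v v \<in> W" using v by auto
      then have Pvc: "P *\<^sub>v v \<in> carrier_vec n" using W(1) by auto
      have "P * \<rho> x * Q *\<^sub>v (P *\<^sub>v v) = (P * \<rho> x) *\<^sub>v (Q *\<^sub>v (P *\<^sub>v v))"
        using PQ r[OF x] Pvc by (intro assoc_mult_mat_vec) auto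
      also have "\<dots> = P *\<^sub>v (\<rho> x *\<^sub>v v)"
        using assoc_mult_mat_vec[OF PQ(1) r[OF x] vc] by (simp add: QPv[OF vc])
      finally show ?thesis using W(5)[OF x Pv] r[OF x] vc by auto
    qed
  qed (use W P0 in \<open>auto simp: mult_add_distrib_mat_vec[OF PQ(1)] mult_mat_vec[OF PQ(1)]\<close>)
  then show "W = {0\<^sub>v n} \<or> W = carrier_vec n"
  proof
    assume "?W = carrier_vec n"
    have "w \<in> W" if w: "w \<in> carrier_vec n" for w
    proof -
      have "Q *\<^sub>v w \<in> ?W" unfolding \<open>?W = carrier_vec n\<close> using PQ w by auto
      then show ?thesis by (simp add: PQv[OF w])
    qed
    then show ?thesis using W(1) by blast
  next
    assume "?W = {0\<^sub>v n}"
    have "w = 0\<^sub>v n" if w: "w \<in> W" for w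
    proof -
      have wc: "w \<in> carrier_vec n" using w W(1) by auto
      then have "Q *\<^sub>v w \<in> ?W" using w PQ by (simp add: PQv[OF wc])
      then have "Q *\<^sub>v w = 0\<^sub>v n" unfolding \<open>?W = {0\<^sub>v n}\<close> by simp
      then show ?thesis using PQv[OF wc] P0 by simp
    qed
    then show ?thesis using W(2) by blast
  qed
qed

lemma subspace_linear_combination:
  fixes W :: "'F::field vec set"
  assumes "finite S" and "W \<subseteq> carrier_vec n" "0\<^sub>v n \<in> W" "\<And>v w. v \<in> W \<Longrightarrow> w \<in> W \<Longrightarrow> v + w \<in> W"
    "\<And>c v. v \<in> W \<Longrightarrow> c \<cdot>\<^sub>v v \<in> W" and v: "\<And>y. y \<in> S \<Longrightarrow> v y \<in> W"
  shows "vec n (\<lambda>k. \<Sum>y\<in>S. a y * v y $ k) \<in> W"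
  using assms(1) v
proof (induction S rule: finite_induct)
  case empty
  have "vec n (\<lambda>k. \<Sum>y\<in>{}. a y * v y $ k) = 0\<^sub>v n" by (intro eq_vecI) auto
  then show ?case using assms(3) by simp
next
  case (insert x S)
  have "v x \<in> carrier_vec n" using insert.prems assms(2) by auto
  then have "vec n (\<lambda>k. \<Sum>y\<in>insert x S. a y * v y $ k) = a x \<cdot>\<^sub>v v x + vec n (\<lambda>k. \<Sum>y\<in>S. a y * v y $ k)"
    using insert.hyps by (intro eq_vecI) auto
  then show ?case using insert assms(4,5) by simp
qed

text \<open>Matrix units send a nonzero vector of an invariant subspace to multiples of all the unit vectors.\<close>

lemma irreducible_of_matrix_units:
  fixes \<tau> :: "'g \<Rightarrow> 'F::field mat"
  assumes \<tau>: "matrix_rep G n \<tau>" and n: "0 < n" and fin: "finite (carrier G)"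
    and units: "\<And>i j. i < n \<Longrightarrow> j < n \<Longrightarrow> \<exists>a. \<forall>k<n. \<forall>l<n.
      (\<Sum>y\<in>carrier G. a y * \<tau> y $$ (k, l)) = (if k = j \<and> l = i then 1 else 0)"
  shows "irreducible_rep G n \<tau>"
proof (rule irreducible_repI[OF \<tau> n])
  note t = matrix_rep_carrier[OF \<tau>]
  fix W :: "'F vec set"
  assume W: "W \<subseteq> carrier_vec n" "0\<^sub>v n \<in> W" "\<And>v w. v \<in> W \<Longrightarrow> w \<in> W \<Longrightarrow> v + w \<in> W"
    "\<And>c v. v \<in> W \<Longrightarrow> c \<cdot>\<^sub>v v \<in> W" "\<And>x v. x \<in> carrier G \<Longrightarrow> v \<in> W \<Longrightarrow> \<tau> x *\<^sub>v v \<in> W"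
  show "W = {0\<^sub>v n} \<or> W = carrier_vec n"
  proof (rule disjCI)
    assume "W \<noteq> carrier_vec n"
    have "w = 0\<^sub>v n" if w: "w \<in> W" for w
    proof (rule ccontr)
      assume "w \<noteq> 0\<^sub>v n"
      have wc: "w \<in> carrier_vec n" using w W(1) by auto
      then obtain i where i: "i < n" "w $ i \<noteq> 0" using \<open>w \<noteq> 0\<^sub>v n\<close> by (metis carrier_vecD eq_vecI index_zero_vec)
      have unit: "unit_vec n j \<in> W" if j: "j < n" for j
      proof -
        obtain a where a: "\<And>k l. k < n \<Longrightarrow> l < n \<Longrightarrow>
            (\<Sum>y\<in>carrier G. a y * \<tau> y $$ (k, l)) = (if k = j \<and> l = i then 1 else 0)"
          using units[OF i(1) j] by blast
        have "vec n (\<lambda>k. \<Sum>y\<in>carrier G. a y * (\<tau> y *\<^sub>v w) $ k) \<in> W"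
          by (rule subspace_linear_combination[OF fin W(1,2)]) (use W w in auto)
        also have "vec n (\<lambda>k. \<Sum>y\<in>carrier G. a y * (\<tau> y *\<^sub>v w) $ k) = w $ i \<cdot>\<^sub>v unit_vec n j"
        proof (rule eq_vecI)
          fix k assume "k < dim_vec (w $ i \<cdot>\<^sub>v unit_vec n j)"
          then have k: "k < n" by simp
          have "(\<Sum>y\<in>carrier G. a y * (\<tau> y *\<^sub>v w) $ k) = (\<Sum>y\<in>carrier G. \<Sum>l=0..<n. a y * \<tau> y $$ (k, l) * w $ l)"
          proof (rule sum.cong)
            fix y assume "y \<in> carrier G"
            from t[OF this] show "a y * (\<tau> y *\<^sub>v w) $ k = (\<Sum>l=0..<n. a y * \<tau> y $$ (k, l) * w $ l)"
              using k wc by (simp add: scalar_prod_def sum_distrib_left mult.assoc)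
          qed simp
          also have "\<dots> = (\<Sum>l=0..<n. (\<Sum>y\<in>carrier G. a y * \<tau> y $$ (k, l)) * w $ l)"
            by (subst sum.swap) (simp add: sum_distrib_right)
          also have "\<dots> = (\<Sum>l=0..<n. if l = i then (if k = j then w $ l else 0) else 0)"
            using k by (intro sum.cong) (auto simp: a)
          also have "\<dots> = (if k = j then w $ i else 0)" using i by simp
          finally show "vec n (\<lambda>k. \<Sum>y\<in>carrier G. a y * (\<tau> y *\<^sub>v w) $ k) $ k = (w $ i \<cdot>\<^sub>v unit_vec n j) $ k"
            using k j by simp
        qed simp
        finally have "inverse (w $ i) \<cdot>\<^sub>v (w $ i \<cdot>\<^sub>v unit_vec n j) \<in> W" by (rule W(4))
        moreover have "inverse (w $ i) \<cdot>\<^sub>v (w $ i \<cdot>\<^sub>v unit_vec n j) = unit_vec n j"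
          using i by (intro eq_vecI) (auto simp: mult.assoc[symmetric])
        ultimately show ?thesis by simp
      qed
      have "v \<in> W" if v: "v \<in> carrier_vec n" for v
      proof -
        have "vec n (\<lambda>k. \<Sum>j<n. v $ j * unit_vec n j $ k) \<in> W"
          by (rule subspace_linear_combination[OF _ W(1,2)]) (use W unit in auto)
        also have "vec n (\<lambda>k. \<Sum>j<n. v $ j * unit_vec n j $ k) = v"
          using v by (intro eq_vecI) (auto simp: if_distrib[of "\<lambda>u. _ * u"] cong: if_cong)
        finally show ?thesis .
      qed
      then show False using W(1) \<open>W \<noteq> carrier_vec n\<close> by blast
    qed
    then show "W = {0\<^sub>v n}" using W(2) by blast
  qed
qed

section \<open>Characters with integral representations\<close>

lemma (in group) inv_mult_cancel:
  assumes "x \<in> carrier G" "y \<in> carrier G"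
  shows "y \<otimes> (inv y \<otimes> x) = x" "inv y \<otimes> (y \<otimes> x) = x"
  using assms by (simp_all add: m_assoc[symmetric])

lemma (in group) sum_left_translate:
  assumes "x \<in> carrier G"
  shows "(\<Sum>y\<in>carrier G. f y) = (\<Sum>y\<in>carrier G. f (x \<otimes> y))"
  by (rule sum.reindex_bij_witness[of _ "\<lambda>y. x \<otimes> y" "\<lambda>y. inv x \<otimes> y"])
    (use assms in \<open>auto simp: m_assoc[symmetric]\<close>)

lemma (in group) sum_inverse: "(\<Sum>y\<in>carrier G. f y) = (\<Sum>y\<in>carrier G. f (inv y))"
  by (rule sum.reindex_bij_witness[of _ "\<lambda>y. inv y" "\<lambda>y. inv y"]) auto

context p_modular_group
begin

context
  fixes n and \<rho> :: "'g \<Rightarrow> 'K mat" and \<chi> :: "'g \<Rightarrow> 'K"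
  assumes \<rho>: "irreducible_rep G n \<rho>" and int: "\<And>x. x \<in> carrier G \<Longrightarrow> integral_mat (\<rho> x)"
    and \<chi>: "\<And>x. x \<in> carrier G \<Longrightarrow> \<chi> x = mat_trace (\<rho> x)"
begin

lemma rep_entries: "x \<in> carrier G \<Longrightarrow> \<rho> x \<in> carrier_mat n n"
  using matrix_rep_carrier[OF irreducible_repD(1)[OF \<rho>]] .

lemma rep_entry_mult:
  assumes "x \<in> carrier G" "y \<in> carrier G" "i < n" "j < n"
  shows "\<rho> (x \<otimes> y) $$ (i, j) = (\<Sum>l<n. \<rho> x $$ (i, l) * \<rho> y $$ (l, j))"
  using assms rep_entries[of x] rep_entries[of y]
  by (simp add: matrix_rep_mult[OF irreducible_repD(1)[OF \<rho>]] scalar_prod_def lessThan_atLeast0)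

lemma rep_entry_O: "x \<in> carrier G \<Longrightarrow> i < n \<Longrightarrow> j < n \<Longrightarrow> \<rho> x $$ (i, j) \<in> \<O>"
  using int[of x] rep_entries[of x] by (auto simp: integral_mat_def)

lemma chi_sum: "x \<in> carrier G \<Longrightarrow> \<chi> x = (\<Sum>i<n. \<rho> x $$ (i, i))"
  using rep_entries[of x] by (simp add: \<chi> mat_trace_def)

lemma chi_O: "x \<in> carrier G \<Longrightarrow> \<chi> x \<in> \<O>"
  unfolding chi_sum by (intro sum_O rep_entry_O) auto

lemma chi_one: "\<chi> \<one> = of_nat n"
  by (simp add: \<chi> matrix_rep_one[OF irreducible_repD(1)[OF \<rho>] group_axioms] mat_trace_one)

lemma chi_commute: "x \<in> carrier G \<Longrightarrow> y \<in> carrier G \<Longrightarrow> \<chi> (x \<otimes> y) = \<chi> (y \<otimes> x)"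
  by (simp add: \<chi> matrix_rep_mult[OF irreducible_repD(1)[OF \<rho>]]
      mat_trace_mult_comm[of "\<rho> x" n n "\<rho> y"] rep_entries)

text \<open>The matrix \<open>\<Sum>\<^sub>x w x \<rho> (inv x)\<close> commutes with the representation, because \<open>w\<close> is a class function, and is
  therefore a scalar.\<close>

lemma class_function_convolution:
  fixes w :: "'g \<Rightarrow> 'K"
  assumes w: "\<forall>x\<in>carrier G. \<forall>y\<in>carrier G. w (x \<otimes> y) = w (y \<otimes> x)"
  obtains z where "\<And>y i j. y \<in> carrier G \<Longrightarrow> i < n \<Longrightarrow> j < n \<Longrightarrow>
      (\<Sum>x\<in>carrier G. w x * \<rho> (y \<otimes> inv x) $$ (i, j)) = z * \<rho> y $$ (i, j)"
    "\<And>y. y \<in> carrier G \<Longrightarrow> (\<Sum>x\<in>carrier G. w x * \<chi> (y \<otimes> inv x)) = z * \<chi> y"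
proof -
  define Z where "Z = mat n n (\<lambda>(i, j). \<Sum>x\<in>carrier G. w x * \<rho> (inv x) $$ (i, j))"
  have left: "(\<rho> y * Z) $$ (i, j) = (\<Sum>x\<in>carrier G. w x * \<rho> (y \<otimes> inv x) $$ (i, j))"
    if y: "y \<in> carrier G" and ij: "i < n" "j < n" for y i j
  proof -
    have "(\<rho> y * Z) $$ (i, j) = (\<Sum>l<n. \<rho> y $$ (i, l) * (\<Sum>x\<in>carrier G. w x * \<rho> (inv x) $$ (l, j)))"
      using rep_entries[OF y] ij by (simp add: Z_def scalar_prod_def lessThan_atLeast0)
    also have "\<dots> = (\<Sum>x\<in>carrier G. w x * (\<Sum>l<n. \<rho> y $$ (i, l) * \<rho> (inv x) $$ (l, j)))"
      unfolding sum_distrib_left by (subst sum.swap) (simp add: mult.left_commute)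
    also have "\<dots> = (\<Sum>x\<in>carrier G. w x * \<rho> (y \<otimes> inv x) $$ (i, j))"
      using y ij by (intro sum.cong) (auto simp: rep_entry_mult)
    finally show ?thesis .
  qed
  have right: "(Z * \<rho> y) $$ (i, j) = (\<Sum>x\<in>carrier G. w x * \<rho> (inv x \<otimes> y) $$ (i, j))"
    if y: "y \<in> carrier G" and ij: "i < n" "j < n" for y i j
  proof -
    have "(Z * \<rho> y) $$ (i, j) = (\<Sum>l<n. (\<Sum>x\<in>carrier G. w x * \<rho> (inv x) $$ (i, l)) * \<rho> y $$ (l, j))"
      using rep_entries[OF y] ij by (simp add: Z_def scalar_prod_def lessThan_atLeast0)
    also have "\<dots> = (\<Sum>x\<in>carrier G. w x * (\<Sum>l<n. \<rho> (inv x) $$ (i, l) * \<rho> y $$ (l, j)))"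
      unfolding sum_distrib_left sum_distrib_right by (subst sum.swap) (simp add: mult.assoc)
    also have "\<dots> = (\<Sum>x\<in>carrier G. w x * \<rho> (inv x \<otimes> y) $$ (i, j))"
      using y ij by (intro sum.cong) (auto simp: rep_entry_mult)
    finally show ?thesis .
  qed
  have comm: "Z * \<rho> y = \<rho> y * Z" if y: "y \<in> carrier G" for y
  proof (rule eq_matI)
    fix i j assume "i < dim_row (\<rho> y * Z)" "j < dim_col (\<rho> y * Z)"
    then have ij: "i < n" "j < n" using rep_entries[OF y] by (auto simp: Z_def)
    have "(\<Sum>x\<in>carrier G. w x * \<rho> (inv x \<otimes> y) $$ (i, j)) = (\<Sum>x\<in>carrier G. w x * \<rho> (y \<otimes> inv x) $$ (i, j))"
    proof (rule sum.reindex_bij_witness[of _ "\<lambda>x. y \<otimes> x \<otimes> inv y" "\<lambda>x. inv y \<otimes> x \<otimes> y"])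
      fix x assume x: "x \<in> carrier G"
      show "y \<otimes> (inv y \<otimes> x \<otimes> y) \<otimes> inv y = x" "inv y \<otimes> (y \<otimes> x \<otimes> inv y) \<otimes> y = x"
        using x y by (simp_all add: m_assoc inv_mult_cancel)
      have "y \<otimes> inv (inv y \<otimes> x \<otimes> y) = inv x \<otimes> y"
        using x y by (simp add: inv_mult_group m_assoc[symmetric])
      moreover have "w (inv y \<otimes> x \<otimes> y) = w (y \<otimes> (inv y \<otimes> x))" using w x y by simp
      then have "w (inv y \<otimes> x \<otimes> y) = w x" using x y by (simp add: inv_mult_cancel)
      ultimately show "w (inv y \<otimes> x \<otimes> y) * \<rho> (y \<otimes> inv (inv y \<otimes> x \<otimes> y)) $$ (i, j) =
        w x * \<rho> (inv x \<otimes> y) $$ (i, j)" by simp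
    qed (use y in auto)
    then show "(Z * \<rho> y) $$ (i, j) = (\<rho> y * Z) $$ (i, j)" using left[OF y ij] right[OF y ij] by simp
  qed (use rep_entries[OF y] in \<open>auto simp: Z_def\<close>)
  have "Z \<in> carrier_mat n n" by (simp add: Z_def)
  then obtain z where z: "Z = z \<cdot>\<^sub>m 1\<^sub>m n"
    using splitting_field_G(1) \<rho> comm unfolding splitting_field_def by blast
  have 1: "(\<Sum>x\<in>carrier G. w x * \<rho> (y \<otimes> inv x) $$ (i, j)) = z * \<rho> y $$ (i, j)"
    if y: "y \<in> carrier G" and ij: "i < n" "j < n" for y i j
  proof -
    have "\<rho> y * Z = z \<cdot>\<^sub>m \<rho> y"
      using rep_entries[OF y] by (simp add: z mult_smult_distrib[OF rep_entries[OF y] one_carrier_mat])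
    then show ?thesis using left[OF y ij] rep_entries[OF y] ij by simp
  qed
  have 2: "(\<Sum>x\<in>carrier G. w x * \<chi> (y \<otimes> inv x)) = z * \<chi> y" if y: "y \<in> carrier G" for y
  proof -
    have "(\<Sum>x\<in>carrier G. w x * \<chi> (y \<otimes> inv x)) = (\<Sum>x\<in>carrier G. \<Sum>i<n. w x * \<rho> (y \<otimes> inv x) $$ (i, i))"
      using y by (intro sum.cong) (auto simp: chi_sum sum_distrib_left)
    also have "\<dots> = (\<Sum>i<n. z * \<rho> y $$ (i, i))"
      by (subst sum.swap) (use y in \<open>simp add: 1\<close>)
    finally show ?thesis using y by (simp add: chi_sum sum_distrib_left)
  qed
  show ?thesis using that[of z] 1 2 by blast
qed

section \<open>The order cut out by a character\<close>

context
  assumes sym: "symmetric_algebra (ring_on \<O>) (order_algebra \<O> G \<chi>)"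
begin

text \<open>With this constant, \<open>e(\<chi>) = \<kappa> \<Sum>\<^sub>x \<chi> (inv x) x\<close>.\<close>

definition "\<kappa> = (of_nat n / of_nat (card (carrier G)) :: 'K)"

text \<open>The element \<open>x e(\<chi>)\<close> of the group algebra.\<close>

definition "elt_image x = (\<lambda>z. if z \<in> carrier G then \<kappa> * \<chi> (inv z \<otimes> x) else 0)"

text \<open>The image \<open>a e(\<chi>)\<close> of the element of the group algebra with coefficients \<open>a\<close>.\<close>

definition "alg_image a = (\<lambda>z. \<Sum>y\<in>carrier G. a y * elt_image y z)"

abbreviation "A \<equiv> order_algebra \<O> G \<chi>"

lemma kappa_nonzero: "\<kappa> \<noteq> 0" and kappa_card: "of_nat (card (carrier G)) * \<kappa> = of_nat n"
proof -
  have "card (carrier G) \<noteq> 0" using finite_carrier by auto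
  then show "\<kappa> \<noteq> 0" "of_nat (card (carrier G)) * \<kappa> = of_nat n"
    using irreducible_repD(2)[OF \<rho>] by (simp_all add: \<kappa>_def)
qed

lemma idempotent_eq: "char_idempotent G \<chi> = elt_image \<one>"
  by (auto simp: char_idempotent_def elt_image_def \<kappa>_def chi_one)

lemma mult_A: "f \<otimes>\<^bsub>A\<^esub> g = (\<lambda>x. if x \<in> carrier G then \<Sum>y\<in>carrier G. f y * g (inv y \<otimes> x) else 0)"
  and add_A: "f \<oplus>\<^bsub>A\<^esub> g = (\<lambda>x. f x + g x)"
  and zero_A: "\<zero>\<^bsub>A\<^esub> = (\<lambda>x. 0)"
  and smult_A: "c \<odot>\<^bsub>A\<^esub> f = (\<lambda>x. c * f x)"
  and one_A: "\<one>\<^bsub>A\<^esub> = elt_image \<one>"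
  by (simp_all add: order_algebra_def group_algebra_def idempotent_eq)

lemma carrier_A: "carrier A = {alg_image a | a. \<forall>x\<in>carrier G. a x \<in> \<O>}"
proof -
  have alg_image: "a \<otimes>\<^bsub>group_algebra G\<^esub> char_idempotent G \<chi> = alg_image a" for a
  proof
    fix z
    have "a y * elt_image \<one> (inv y \<otimes> z) = a y * elt_image y z" if "y \<in> carrier G" "z \<in> carrier G" for y
      using that by (simp add: elt_image_def inv_mult_group)
    moreover have "alg_image a z = 0" if "z \<notin> carrier G" using that by (simp add: alg_image_def elt_image_def)
    moreover have "(\<Sum>y\<in>carrier G. a y * elt_image \<one> (inv y \<otimes> z)) = alg_image a z" if "z \<in> carrier G"
      unfolding alg_image_def using that calculation(1) by (intro sum.cong) auto
    ultimately show "(a \<otimes>\<^bsub>group_algebra G\<^esub> char_idempotent G \<chi>) z = alg_image a z"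
      by (simp add: group_algebra_def idempotent_eq)
  qed
  have "\<exists>b. alg_image a = alg_image b \<and> b \<in> carrier (group_algebra G) \<and> (\<forall>x\<in>carrier G. b x \<in> \<O>)" if "\<forall>x\<in>carrier G. a x \<in> \<O>" for a
    using that by (intro exI[of _ "\<lambda>x. if x \<in> carrier G then a x else 0"]) (auto simp: alg_image_def group_algebra_def)
  then show ?thesis by (auto simp: order_algebra_def alg_image)
qed

lemma elt_image_in_A: "x \<in> carrier G \<Longrightarrow> elt_image x \<in> carrier A"
proof -
  assume x: "x \<in> carrier G"
  have "alg_image (\<lambda>y. if y = x then 1 else 0) = elt_image x"
  proof
    fix z
    have "alg_image (\<lambda>y. if y = x then 1 else 0) z = (\<Sum>y\<in>carrier G. if y = x then elt_image y z else 0)"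
      unfolding alg_image_def by (intro sum.cong) auto
    then show "alg_image (\<lambda>y. if y = x then 1 else 0) z = elt_image x z" using x finite_carrier by simp
  qed
  then show ?thesis unfolding carrier_A using zero_O one_O
    by (intro CollectI exI[of _ "\<lambda>y. if y = x then 1 else 0"]) auto
qed

lemma module_A: "module (ring_on \<O>) A" and ring_A: "ring A"
  using sym by (auto simp: symmetric_algebra_def assoc_algebra_def)

text \<open>This compares coefficients in \<open>e(\<chi>) e(\<chi>) = e(\<chi>)\<close>; that equation is part of \<open>e(\<chi>)\<close> being the unit
  of the order.\<close>

lemma orthogonality: "v \<in> carrier G \<Longrightarrow> \<kappa> * (\<Sum>u\<in>carrier G. \<chi> (inv u) * \<chi> (v \<otimes> u)) = \<chi> v"
proof -
  assume v: "v \<in> carrier G"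
  interpret A: ring A by (rule ring_A)
  have "(elt_image \<one> \<otimes>\<^bsub>A\<^esub> elt_image \<one>) (inv v) = elt_image \<one> (inv v)" using A.l_one[OF A.one_closed] by (simp add: one_A)
  moreover have "(elt_image \<one> \<otimes>\<^bsub>A\<^esub> elt_image \<one>) (inv v) = (\<Sum>u\<in>carrier G. \<kappa> * \<chi> (inv u) * (\<kappa> * \<chi> (v \<otimes> u)))"
    unfolding mult_A using v by (auto simp: elt_image_def inv_mult_group intro!: sum.cong)
  ultimately have "\<kappa> * (\<kappa> * (\<Sum>u\<in>carrier G. \<chi> (inv u) * \<chi> (v \<otimes> u))) = \<kappa> * \<chi> v"
    using v by (simp add: elt_image_def sum_distrib_left mult.assoc mult.left_commute)
  then show ?thesis using kappa_nonzero by simp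
qed

lemma convolution_chi:
  assumes "x \<in> carrier G" "y \<in> carrier G"
  shows "\<kappa> * (\<Sum>w\<in>carrier G. \<chi> (inv w \<otimes> x) * \<chi> (y \<otimes> w)) = \<chi> (y \<otimes> x)"
proof -
  have "(\<Sum>w\<in>carrier G. \<chi> (inv w \<otimes> x) * \<chi> (y \<otimes> w)) =
      (\<Sum>u\<in>carrier G. \<chi> (inv (x \<otimes> u) \<otimes> x) * \<chi> (y \<otimes> (x \<otimes> u)))"
    by (rule sum_left_translate[OF assms(1)])
  also have "\<dots> = (\<Sum>u\<in>carrier G. \<chi> (inv u) * \<chi> (y \<otimes> x \<otimes> u))"
    using assms by (intro sum.cong) (auto simp: inv_mult_group m_assoc)
  finally show ?thesis using orthogonality[of "y \<otimes> x"] assms by simp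
qed

lemma elt_image_mult:
  assumes x: "x \<in> carrier G" and y: "y \<in> carrier G"
  shows "elt_image x \<otimes>\<^bsub>A\<^esub> elt_image y = elt_image (x \<otimes> y)"
proof
  fix z
  show "(elt_image x \<otimes>\<^bsub>A\<^esub> elt_image y) z = elt_image (x \<otimes> y) z"
  proof (cases "z \<in> carrier G")
    case z: True
    have "(elt_image x \<otimes>\<^bsub>A\<^esub> elt_image y) z = (\<Sum>w\<in>carrier G. \<kappa> * (\<kappa> * (\<chi> (inv w \<otimes> x) * \<chi> (y \<otimes> inv z \<otimes> w))))"
      unfolding mult_A using z
    proof (simp, intro sum.cong)
      fix w assume w: "w \<in> carrier G"
      have "\<chi> (inv (inv w \<otimes> z) \<otimes> y) = \<chi> (y \<otimes> inv z \<otimes> w)"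
        using chi_commute[of "inv z \<otimes> w" y] w y z by (simp add: inv_mult_group m_assoc)
      then show "elt_image x w * elt_image y (inv w \<otimes> z) = \<kappa> * (\<kappa> * (\<chi> (inv w \<otimes> x) * \<chi> (y \<otimes> inv z \<otimes> w)))"
        using w z by (simp add: elt_image_def)
    qed simp
    also have "\<dots> = \<kappa> * \<chi> (y \<otimes> inv z \<otimes> x)"
      using convolution_chi[OF x, of "y \<otimes> inv z"] y z by (simp flip: sum_distrib_left)
    also have "\<chi> (y \<otimes> inv z \<otimes> x) = \<chi> (inv z \<otimes> (x \<otimes> y))"
      using chi_commute[of y "inv z \<otimes> x"] x y z by (simp add: m_assoc)
    finally show ?thesis using z by (simp add: elt_image_def)
  qed (simp add: mult_A elt_image_def)
qed

text \<open>The elements \<open>y e(\<chi>)\<close> span the order.\<close>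

lemma linear_form_alg_image:
  assumes h: "h \<in> module_hom (ring_on \<O>) A (regular_module (ring_on \<O>))"
    and a: "\<And>x. x \<in> carrier G \<Longrightarrow> a x \<in> \<O>"
  shows "h (alg_image a) = (\<Sum>y\<in>carrier G. a y * h (elt_image y))"
proof -
  interpret M: module "ring_on \<O>" A by (rule module_A)
  have hadd: "h (f \<oplus>\<^bsub>A\<^esub> g) = h f + h g" if "f \<in> carrier A" "g \<in> carrier A" for f g
    using h that by (simp add: module_hom_def regular_module_def)
  have hsmult: "h (c \<odot>\<^bsub>A\<^esub> f) = c * h f" if "c \<in> \<O>" "f \<in> carrier A" for c f
    using h that by (simp add: module_hom_def regular_module_def)
  have h0: "h \<zero>\<^bsub>A\<^esub> = 0" using hsmult[OF zero_O M.zero_closed] by (simp add: zero_A smult_A)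
  have "(\<lambda>z. \<Sum>y\<in>S. a y * elt_image y z) \<in> carrier A \<and> h (\<lambda>z. \<Sum>y\<in>S. a y * elt_image y z) = (\<Sum>y\<in>S. a y * h (elt_image y))"
    if "finite S" "S \<subseteq> carrier G" for S
    using that
  proof (induction S rule: finite_induct)
    case empty
    then show ?case using h0 M.zero_closed by (simp add: zero_A)
  next
    case (insert x S)
    have x: "a x \<in> \<O>" "elt_image x \<in> carrier A" using insert.prems a elt_image_in_A by auto
    have ax: "a x \<odot>\<^bsub>A\<^esub> elt_image x \<in> carrier A" using M.smult_closed[of "a x" "elt_image x"] x by simp
    have "(\<lambda>z. \<Sum>y\<in>insert x S. a y * elt_image y z) = (a x \<odot>\<^bsub>A\<^esub> elt_image x) \<oplus>\<^bsub>A\<^esub> (\<lambda>z. \<Sum>y\<in>S. a y * elt_image y z)"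
      using insert.hyps by (simp add: add_A smult_A)
    then show ?case using insert ax hadd[OF ax] hsmult[OF x] M.a_closed[OF ax] by simp
  qed
  from this[OF finite_carrier] show ?thesis by (simp add: alg_image_def)
qed

lemma dual_A: "f \<in> carrier (dual_module (ring_on \<O>) A) \<longleftrightarrow>
    f \<in> module_hom (ring_on \<O>) A (regular_module (ring_on \<O>)) \<and> f \<in> extensional (carrier A)"
  by (simp add: dual_module_def)

section \<open>Symmetrizing forms\<close>

text \<open>The symmetrizing form is the image of the unit under a bimodule isomorphism from the order to its
  dual. Multiplying the unit from the left and from the right gives the same element, which makes the
  form symmetric; surjectivity of the isomorphism makes it generate the dual.\<close>

lemma symmetrizing_form:
  obtains s where "s \<in> module_hom (ring_on \<O>) A (regular_module (ring_on \<O>))"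
    "\<And>f g. f \<in> carrier A \<Longrightarrow> g \<in> carrier A \<Longrightarrow> s (f \<otimes>\<^bsub>A\<^esub> g) = s (g \<otimes>\<^bsub>A\<^esub> f)"
    "\<And>h. h \<in> module_hom (ring_on \<O>) A (regular_module (ring_on \<O>)) \<Longrightarrow> h \<in> extensional (carrier A) \<Longrightarrow>
      \<exists>g\<in>carrier A. \<forall>f\<in>carrier A. h f = s (f \<otimes>\<^bsub>A\<^esub> g)"
proof -
  interpret A: ring A by (rule ring_A)
  obtain \<Phi> where \<Phi>: "\<Phi> \<in> module_hom (ring_on \<O>) A (dual_module (ring_on \<O>) A)"
    "bij_betw \<Phi> (carrier A) (carrier (dual_module (ring_on \<O>) A))"
    and bi: "\<And>a x b. a \<in> carrier A \<Longrightarrow> x \<in> carrier A \<Longrightarrow> b \<in> carrier A \<Longrightarrow>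
      \<Phi> (a \<otimes>\<^bsub>A\<^esub> x \<otimes>\<^bsub>A\<^esub> b) = (\<lambda>y\<in>carrier A. \<Phi> x (b \<otimes>\<^bsub>A\<^esub> y \<otimes>\<^bsub>A\<^esub> a))"
    using sym unfolding symmetric_algebra_def by blast
  define s where "s = \<Phi> \<one>\<^bsub>A\<^esub>"
  have 1: "\<Phi> g f = s (f \<otimes>\<^bsub>A\<^esub> g)" if "f \<in> carrier A" "g \<in> carrier A" for f g
    using bi[of g "\<one>\<^bsub>A\<^esub>" "\<one>\<^bsub>A\<^esub>"] that by (simp add: s_def)
  have 2: "\<Phi> g f = s (g \<otimes>\<^bsub>A\<^esub> f)" if "f \<in> carrier A" "g \<in> carrier A" for f g
    using bi[of "\<one>\<^bsub>A\<^esub>" "\<one>\<^bsub>A\<^esub>" g] that by (simp add: s_def)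
  show ?thesis
  proof (rule that[of s])
    have "s \<in> carrier (dual_module (ring_on \<O>) A)"
      unfolding s_def using \<Phi>(2) A.one_closed by (rule bij_betwE[rule_format])
    then show "s \<in> module_hom (ring_on \<O>) A (regular_module (ring_on \<O>))" unfolding dual_A by blast
    show "s (f \<otimes>\<^bsub>A\<^esub> g) = s (g \<otimes>\<^bsub>A\<^esub> f)" if "f \<in> carrier A" "g \<in> carrier A" for f g
      using 1[OF that] 2[OF that] by simp
    fix h assume "h \<in> module_hom (ring_on \<O>) A (regular_module (ring_on \<O>))" "h \<in> extensional (carrier A)"
    then have "h \<in> carrier (dual_module (ring_on \<O>) A)" unfolding dual_A by blast
    then have "h \<in> \<Phi> ` carrier A" using \<Phi>(2) unfolding bij_betw_def by blast
    then obtain g where "g \<in> carrier A" "h = \<Phi> g" by blast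
    then show "\<exists>g\<in>carrier A. \<forall>f\<in>carrier A. h f = s (f \<otimes>\<^bsub>A\<^esub> g)" using 1 by blast
  qed
qed

text \<open>As \<open>\<rho>\<close> maps \<open>e(\<chi>)\<close> to the identity matrix, this is the linear form \<open>a e(\<chi>) \<mapsto> \<rho> a $$ (i, j)\<close>.\<close>

definition "entry_form i j = (\<lambda>f. \<Sum>x\<in>carrier G. f x * \<rho> x $$ (i, j))"

text \<open>The point is that \<open>\<rho>\<close> maps \<open>e(\<chi>)\<close> to the identity matrix. The image of \<open>e(\<chi>)\<close> is a scalar \<open>\<kappa> z\<close>, and the
  orthogonality relation at the identity of \<open>G\<close> shows that its trace is \<open>n\<close>.\<close>

lemma entry_form_elt_image:
  assumes y: "y \<in> carrier G" and ij: "i < n" "j < n"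
  shows "entry_form i j (elt_image y) = \<rho> y $$ (i, j)"
proof -
  obtain z where z: "\<And>y i j. y \<in> carrier G \<Longrightarrow> i < n \<Longrightarrow> j < n \<Longrightarrow>
      (\<Sum>x\<in>carrier G. \<chi> x * \<rho> (y \<otimes> inv x) $$ (i, j)) = z * \<rho> y $$ (i, j)"
    "\<And>y. y \<in> carrier G \<Longrightarrow> (\<Sum>x\<in>carrier G. \<chi> x * \<chi> (y \<otimes> inv x)) = z * \<chi> y"
    by (rule class_function_convolution[of \<chi>]) (use chi_commute that in blast)+
  have "z * of_nat n = (\<Sum>x\<in>carrier G. \<chi> x * \<chi> (inv x))" using z(2)[of \<one>] by (simp add: chi_one)
  also have "\<dots> = (\<Sum>u\<in>carrier G. \<chi> (inv u) * \<chi> (\<one> \<otimes> u))" by (simp add: mult.commute)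
  finally have "\<kappa> * z * of_nat n = of_nat n" using orthogonality[of \<one>] by (simp add: chi_one mult.assoc)
  then have kz: "\<kappa> * z = 1" using irreducible_repD(2)[OF \<rho>] by simp
  have "entry_form i j (elt_image y) = (\<Sum>x\<in>carrier G. \<kappa> * \<chi> (inv x \<otimes> y) * \<rho> x $$ (i, j))"
    unfolding entry_form_def by (intro sum.cong) (auto simp: elt_image_def)
  also have "\<dots> = (\<Sum>u\<in>carrier G. \<kappa> * \<chi> (inv (y \<otimes> u) \<otimes> y) * \<rho> (y \<otimes> u) $$ (i, j))"
    by (rule sum_left_translate[OF y])
  also have "\<dots> = (\<Sum>u\<in>carrier G. \<kappa> * \<chi> (inv u) * \<rho> (y \<otimes> u) $$ (i, j))"
    using y by (intro sum.cong) (auto simp: inv_mult_group m_assoc)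
  also have "\<dots> = (\<Sum>u\<in>carrier G. \<kappa> * \<chi> (inv (inv u)) * \<rho> (y \<otimes> inv u) $$ (i, j))"
    by (rule sum_inverse)
  also have "\<dots> = \<kappa> * (\<Sum>x\<in>carrier G. \<chi> x * \<rho> (y \<otimes> inv x) $$ (i, j))"
    by (simp add: sum_distrib_left mult.assoc)
  also have "\<dots> = \<rho> y $$ (i, j)" using z(1)[OF y ij] kz by (simp flip: mult.assoc)
  finally show ?thesis .
qed

lemma entry_form_alg_image:
  assumes ij: "i < n" "j < n"
  shows "entry_form i j (alg_image a) = (\<Sum>y\<in>carrier G. a y * \<rho> y $$ (i, j))"
proof -
  have "entry_form i j (alg_image a) = (\<Sum>x\<in>carrier G. \<Sum>y\<in>carrier G. a y * (elt_image y x * \<rho> x $$ (i, j)))"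
    by (simp add: entry_form_def alg_image_def sum_distrib_right mult.assoc)
  also have "\<dots> = (\<Sum>y\<in>carrier G. a y * entry_form i j (elt_image y))"
    by (subst sum.swap) (simp add: entry_form_def sum_distrib_left)
  finally show ?thesis by (simp add: entry_form_elt_image ij)
qed

lemma entry_form_linear:
  assumes ij: "i < n" "j < n"
  shows "restrict (entry_form i j) (carrier A) \<in> module_hom (ring_on \<O>) A (regular_module (ring_on \<O>))"
proof -
  interpret M: module "ring_on \<O>" A by (rule module_A)
  have "entry_form i j f \<in> \<O>" if "f \<in> carrier A" for f
    using that unfolding carrier_A by (auto simp: entry_form_alg_image[OF ij] intro!: sum_O mult_O rep_entry_O ij)
  moreover have "entry_form i j (f \<oplus>\<^bsub>A\<^esub> g) = entry_form i j f + entry_form i j g" for f g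
    by (simp add: entry_form_def add_A distrib_right sum.distrib)
  moreover have "entry_form i j (c \<odot>\<^bsub>A\<^esub> f) = c * entry_form i j f" for c f
    by (simp add: entry_form_def smult_A sum_distrib_left mult.assoc)
  moreover have "c \<odot>\<^bsub>A\<^esub> f \<in> carrier A" if "c \<in> \<O>" "f \<in> carrier A" for c f
    using M.smult_closed[of c f] that by simp
  ultimately show ?thesis using M.a_closed by (simp add: module_hom_def regular_module_def)
qed

text \<open>A symmetric form is a multiple of the character. Indeed, the values \<open>t x\<close> of the form \<open>s\<close> at the elements
  \<open>x e(\<chi>)\<close> make up a class function. By Schur's lemma its convolution with \<open>\<chi>\<close> is a multiple of \<open>\<chi>\<close>, and by
  the orthogonality relation the same convolution is a multiple of \<open>t\<close>.

  As the form generates the dual of the order, each coordinate form \<open>a e(\<chi>) \<mapsto> \<rho> a $$ (i, j)\<close> is of the shape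
  \<open>f \<mapsto> s (f g)\<close>. The coefficients \<open>b\<close> are those of \<open>g = b e(\<chi>)\<close>.\<close>

lemma symmetrizing_form_multiple_of_character:
  obtains c where "\<And>x. x \<in> carrier G \<Longrightarrow> c * \<chi> x \<in> \<O>"
    "\<And>i j. i < n \<Longrightarrow> j < n \<Longrightarrow> \<exists>b. (\<forall>y\<in>carrier G. b y \<in> \<O>) \<and>
      (\<forall>x\<in>carrier G. c * (\<Sum>y\<in>carrier G. b y * \<chi> (x \<otimes> y)) = \<rho> x $$ (i, j))"
proof -
  interpret M: module "ring_on \<O>" A by (rule module_A)
  obtain s where s: "s \<in> module_hom (ring_on \<O>) A (regular_module (ring_on \<O>))"
    and comm: "\<And>f g. f \<in> carrier A \<Longrightarrow> g \<in> carrier A \<Longrightarrow> s (f \<otimes>\<^bsub>A\<^esub> g) = s (g \<otimes>\<^bsub>A\<^esub> f)"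
    and rep: "\<And>h. h \<in> module_hom (ring_on \<O>) A (regular_module (ring_on \<O>)) \<Longrightarrow> h \<in> extensional (carrier A) \<Longrightarrow>
      \<exists>g\<in>carrier A. \<forall>f\<in>carrier A. h f = s (f \<otimes>\<^bsub>A\<^esub> g)"
    by (rule symmetrizing_form) (rule that)
  define t where "t x = s (elt_image x)" for x
  have t_comm: "t (x \<otimes> y) = t (y \<otimes> x)" if "x \<in> carrier G" "y \<in> carrier G" for x y
    using comm[of "elt_image x" "elt_image y"] that by (simp add: elt_image_in_A elt_image_mult t_def)
  have t_O: "t x \<in> \<O>" if "x \<in> carrier G" for x
    using s elt_image_in_A[OF that] by (auto simp: module_hom_def regular_module_def t_def)
  obtain z where z: "\<And>y. y \<in> carrier G \<Longrightarrow> (\<Sum>x\<in>carrier G. t x * \<chi> (y \<otimes> inv x)) = z * \<chi> y"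
    by (rule class_function_convolution[of t]) (use t_comm that in blast)+
  define c where "c = \<kappa> * z"
  have tc: "t y = c * \<chi> y" if y: "y \<in> carrier G" for y
  proof -
    \<comment> \<open>The orthogonality relation, multiplied by the order of \<open>G\<close> to clear denominators.\<close>
    have "alg_image (\<lambda>x. of_nat n * \<chi> (inv x \<otimes> y)) = of_nat (card (carrier G)) \<odot>\<^bsub>A\<^esub> elt_image y"
    proof
      fix u
      show "alg_image (\<lambda>x. of_nat n * \<chi> (inv x \<otimes> y)) u = (of_nat (card (carrier G)) \<odot>\<^bsub>A\<^esub> elt_image y) u"
      proof (cases "u \<in> carrier G")
        case u: True
        have "alg_image (\<lambda>x. of_nat n * \<chi> (inv x \<otimes> y)) u =
            of_nat n * (\<kappa> * (\<Sum>x\<in>carrier G. \<chi> (inv x \<otimes> y) * \<chi> (inv u \<otimes> x)))"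
          using u by (simp add: alg_image_def elt_image_def sum_distrib_left mult.assoc mult.left_commute)
        also have "\<dots> = of_nat (card (carrier G)) * \<kappa> * \<chi> (inv u \<otimes> y)"
          using convolution_chi[OF y, of "inv u"] u by (simp add: kappa_card)
        finally show ?thesis using u by (simp add: smult_A elt_image_def mult.assoc)
      qed (simp add: alg_image_def elt_image_def smult_A)
    qed
    then have "s (alg_image (\<lambda>x. of_nat n * \<chi> (inv x \<otimes> y))) = of_nat (card (carrier G)) * t y"
      using s elt_image_in_A[OF y] of_nat_O[of "card (carrier G)"] by (simp add: module_hom_def regular_module_def t_def)
    moreover have "s (alg_image (\<lambda>x. of_nat n * \<chi> (inv x \<otimes> y))) = (\<Sum>x\<in>carrier G. of_nat n * \<chi> (inv x \<otimes> y) * t x)"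
      unfolding t_def using y by (intro linear_form_alg_image[OF s] mult_O of_nat_O chi_O) auto
    moreover have "\<dots> = of_nat n * (\<Sum>x\<in>carrier G. t x * \<chi> (y \<otimes> inv x))"
      using y chi_commute by (auto simp: sum_distrib_left intro!: sum.cong)
    ultimately have "of_nat (card (carrier G)) * t y = of_nat n * (z * \<chi> y)" using z[OF y] by simp
    also have "\<dots> = of_nat (card (carrier G)) * (c * \<chi> y)" by (simp add: c_def mult.assoc flip: kappa_card)
    finally show ?thesis using finite_carrier by auto
  qed
  show ?thesis
  proof (rule that[of c])
    show "c * \<chi> x \<in> \<O>" if "x \<in> carrier G" for x using t_O[OF that] tc[OF that] by simp
    fix i j assume ij: "i < n" "j < n"
    obtain g where g: "g \<in> carrier A" "\<And>f. f \<in> carrier A \<Longrightarrow> restrict (entry_form i j) (carrier A) f = s (f \<otimes>\<^bsub>A\<^esub> g)"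
      using rep[OF entry_form_linear[OF ij]] by auto
    obtain b where b: "\<And>y. y \<in> carrier G \<Longrightarrow> b y \<in> \<O>" "g = alg_image b" using g(1) unfolding carrier_A by blast
    have "c * (\<Sum>y\<in>carrier G. b y * \<chi> (x \<otimes> y)) = \<rho> x $$ (i, j)" if x: "x \<in> carrier G" for x
    proof -
      have "elt_image x \<otimes>\<^bsub>A\<^esub> alg_image b = alg_image (\<lambda>y. b (inv x \<otimes> y))"
      proof
        fix u
        show "(elt_image x \<otimes>\<^bsub>A\<^esub> alg_image b) u = alg_image (\<lambda>y. b (inv x \<otimes> y)) u"
        proof (cases "u \<in> carrier G")
          case u: True
          have "(elt_image x \<otimes>\<^bsub>A\<^esub> alg_image b) u = (\<Sum>w\<in>carrier G. \<Sum>y\<in>carrier G. b y * (elt_image x w * elt_image y (inv w \<otimes> u)))"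
            using u by (simp add: mult_A alg_image_def sum_distrib_left mult.left_commute)
          also have "\<dots> = (\<Sum>y\<in>carrier G. b y * (elt_image x \<otimes>\<^bsub>A\<^esub> elt_image y) u)"
            by (subst sum.swap) (use u in \<open>simp add: mult_A sum_distrib_left\<close>)
          also have "\<dots> = (\<Sum>y\<in>carrier G. b y * elt_image (x \<otimes> y) u)" using x by (simp add: elt_image_mult)
          also have "\<dots> = (\<Sum>y\<in>carrier G. b (inv x \<otimes> (x \<otimes> y)) * elt_image (x \<otimes> y) u)"
            using x by (intro sum.cong) (auto simp: m_assoc[symmetric])
          also have "\<dots> = alg_image (\<lambda>y. b (inv x \<otimes> y)) u"
            unfolding alg_image_def by (rule sum_left_translate[OF x, symmetric])
          finally show ?thesis .
        qed (simp add: mult_A alg_image_def elt_image_def)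
      qed
      then have "s (elt_image x \<otimes>\<^bsub>A\<^esub> g) = (\<Sum>y\<in>carrier G. b (inv x \<otimes> y) * t y)"
        unfolding b(2) t_def using x b(1) by (simp add: linear_form_alg_image[OF s])
      also have "\<dots> = (\<Sum>y\<in>carrier G. b (inv x \<otimes> (x \<otimes> y)) * t (x \<otimes> y))"
        by (rule sum_left_translate[OF x])
      also have "\<dots> = (\<Sum>y\<in>carrier G. b y * (c * \<chi> (x \<otimes> y)))"
        using x by (intro sum.cong) (auto simp: m_assoc[symmetric] tc)
      also have "\<dots> = c * (\<Sum>y\<in>carrier G. b y * \<chi> (x \<otimes> y))"
        by (simp add: sum_distrib_left mult.left_commute)
      finally show ?thesis using g(2)[OF elt_image_in_A[OF x]] elt_image_in_A[OF x] entry_form_elt_image[OF x ij] by simp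
    qed
    then show "\<exists>b. (\<forall>y\<in>carrier G. b y \<in> \<O>) \<and>
      (\<forall>x\<in>carrier G. c * (\<Sum>y\<in>carrier G. b y * \<chi> (x \<otimes> y)) = \<rho> x $$ (i, j))"
      using b(1) by (intro exI[of _ b]) auto
  qed
qed

end

section \<open>Characters with symmetric orders\<close>

lemma trace_form_nondegenerate:
  assumes M: "M \<in> carrier_mat n n" and "\<And>x. x \<in> carrier G \<Longrightarrow> mat_trace (\<rho> x * M) = 0"
  shows "M = 0\<^sub>m n n"
  by (rule frobenius_schur[OF group_axioms, of "{()}" "\<lambda>_. n" "\<lambda>_. \<rho>" "\<lambda>_. M"])
    (use assms \<rho> splitting_field_G(1) in \<open>auto simp: splitting_field_def\<close>)

text \<open>The matrix \<open>\<Sum>\<^sub>y b y \<rho> y\<close> and a matrix unit have the same products with all \<open>\<rho> x\<close> under the trace form, which is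
  nondegenerate on the span of the representation.\<close>

lemma matrix_unit_from_form:
  assumes ij: "i < n" "j < n" and b: "\<And>x. x \<in> carrier G \<Longrightarrow> (\<Sum>y\<in>carrier G. b y * \<chi> (x \<otimes> y)) = \<rho> x $$ (i, j)"
    and kl: "k < n" "l < n"
  shows "(\<Sum>y\<in>carrier G. b y * \<rho> y $$ (k, l)) = (if k = j \<and> l = i then 1 else 0)"
proof -
  define M where "M = mat n n (\<lambda>(k, l). (\<Sum>y\<in>carrier G. b y * \<rho> y $$ (k, l)) - (if k = j \<and> l = i then 1 else 0))"
  have "mat_trace (\<rho> x * M) = 0" if x: "x \<in> carrier G" for x
  proof -
    have "mat_trace (\<rho> x * M) = (\<Sum>k<n. \<Sum>l<n. \<rho> x $$ (k, l) * M $$ (l, k))"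
      using rep_entries[OF x] by (simp add: mat_trace_def M_def scalar_prod_def lessThan_atLeast0)
    also have "\<dots> = (\<Sum>k<n. \<Sum>l<n. \<Sum>y\<in>carrier G. b y * (\<rho> x $$ (k, l) * \<rho> y $$ (l, k))) -
        (\<Sum>k<n. \<Sum>l<n. if l = j then (if k = i then \<rho> x $$ (k, l) else 0) else 0)"
      unfolding sum_subtractf[symmetric]
      by (intro sum.cong) (auto simp: M_def right_diff_distrib sum_distrib_left mult.left_commute)
    also have "(\<Sum>k<n. \<Sum>l<n. if l = j then (if k = i then \<rho> x $$ (k, l) else 0) else 0) = \<rho> x $$ (i, j)"
      using ij by simp
    also have "(\<Sum>k<n. \<Sum>l<n. \<Sum>y\<in>carrier G. b y * (\<rho> x $$ (k, l) * \<rho> y $$ (l, k))) =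
        (\<Sum>k<n. \<Sum>y\<in>carrier G. \<Sum>l<n. b y * (\<rho> x $$ (k, l) * \<rho> y $$ (l, k)))"
      by (intro sum.cong sum.swap refl)
    also have "\<dots> = (\<Sum>y\<in>carrier G. \<Sum>k<n. b y * \<rho> (x \<otimes> y) $$ (k, k))"
      by (subst sum.swap) (use x in \<open>simp add: rep_entry_mult sum_distrib_left\<close>)
    also have "\<dots> = (\<Sum>y\<in>carrier G. b y * \<chi> (x \<otimes> y))"
      using x by (simp add: chi_sum sum_distrib_left)
    finally show ?thesis using b[OF x] by simp
  qed
  then have "M = 0\<^sub>m n n" by (intro trace_form_nondegenerate) (simp_all add: M_def)
  then have "M $$ (k, l) = 0" using kl by simp
  then show ?thesis using kl by (simp add: M_def)
qed

text \<open>Let \<open>c\<close> be the scalar by which the symmetrizing form differs from the character. If \<open>c\<close> is integral, the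
  order contains all the matrix units, and the reduction of \<open>\<rho>\<close> is irreducible. Otherwise \<open>1 / c\<close> lies in
  the maximal ideal; since \<open>c \<chi>\<close> has integral values, \<open>\<chi>\<close> vanishes modulo the maximal ideal.\<close>

lemma symmetric_order_dichotomy:
  assumes sym: "symmetric_algebra (ring_on \<O>) (order_algebra \<O> G \<chi>)"
  shows "(\<exists>\<phi> \<in> IBr p \<O> res G. lifts p G \<chi> \<phi>) \<or>
         (\<forall>\<phi> \<in> IBr p \<O> res G. p dvd decomposition_number p \<O> res G \<chi> \<phi>)"
proof -
  define \<tau> where "\<tau> x = map_mat res (\<rho> x)" for x
  have \<tau>: "matrix_rep G n \<tau>" unfolding \<tau>_def by (rule reduction_rep[OF group_axioms irreducible_repD(1)[OF \<rho>] int])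
  have br: "\<chi> x = brauer_character p \<O> res G \<tau> x" if "x \<in> p_regular p G" for x
    using brauer_character_reduction[OF that irreducible_repD(1)[OF \<rho>] int] \<chi> p_regularD(1)[OF that]
    by (simp add: \<tau>_def[abs_def])
  obtain c where c: "\<And>x. x \<in> carrier G \<Longrightarrow> c * \<chi> x \<in> \<O>"
    and b: "\<And>i j. i < n \<Longrightarrow> j < n \<Longrightarrow> \<exists>b. (\<forall>y\<in>carrier G. b y \<in> \<O>) \<and>
      (\<forall>x\<in>carrier G. c * (\<Sum>y\<in>carrier G. b y * \<chi> (x \<otimes> y)) = \<rho> x $$ (i, j))"
    by (rule symmetrizing_form_multiple_of_character[OF sym]) (rule that)
  show ?thesis
  proof (rule valuation_cases[of c])
    assume cO: "c \<in> \<O>"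
    have "irreducible_rep G n \<tau>"
    proof (rule irreducible_of_matrix_units[OF \<tau> irreducible_repD(2)[OF \<rho>] finite_carrier])
      fix i j assume ij: "i < n" "j < n"
      obtain b where bO: "\<forall>y\<in>carrier G. b y \<in> \<O>"
        and bx: "\<forall>x\<in>carrier G. c * (\<Sum>y\<in>carrier G. b y * \<chi> (x \<otimes> y)) = \<rho> x $$ (i, j)"
        using b[OF ij] by blast
      have "(\<Sum>y\<in>carrier G. res (c * b y) * \<tau> y $$ (k, l)) = (if k = j \<and> l = i then 1 else 0)"
        if kl: "k < n" "l < n" for k l
      proof -
        have "(\<Sum>y\<in>carrier G. (c * b y) * \<rho> y $$ (k, l)) = (if k = j \<and> l = i then 1 else 0)"
          using bx by (intro matrix_unit_from_form ij kl) (simp add: sum_distrib_left mult.assoc)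
        then have "res (\<Sum>y\<in>carrier G. (c * b y) * \<rho> y $$ (k, l)) = (if k = j \<and> l = i then 1 else 0)"
          by (simp add: res_one res_zero)
        also have "res (\<Sum>y\<in>carrier G. (c * b y) * \<rho> y $$ (k, l)) = (\<Sum>y\<in>carrier G. res ((c * b y) * \<rho> y $$ (k, l)))"
          using bO cO kl by (intro res_sum mult_O rep_entry_O) auto
        also have "\<dots> = (\<Sum>y\<in>carrier G. res (c * b y) * \<tau> y $$ (k, l))"
        proof (rule sum.cong)
          fix y assume y: "y \<in> carrier G"
          show "res ((c * b y) * \<rho> y $$ (k, l)) = res (c * b y) * \<tau> y $$ (k, l)"
            using y bO cO kl rep_entries[OF y] rep_entry_O[OF y kl] by (subst res_mult) (auto simp: mult_O \<tau>_def)
        qed simp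
        finally show ?thesis .
      qed
      then show "\<exists>a. \<forall>k<n. \<forall>l<n. (\<Sum>y\<in>carrier G. a y * \<tau> y $$ (k, l)) = (if k = j \<and> l = i then 1 else 0)"
        by (intro exI[of _ "\<lambda>y. res (c * b y)"]) blast
    qed
    then have "brauer_character p \<O> res G \<tau> \<in> IBr p \<O> res G" by (auto simp: IBr_def)
    moreover have "lifts p G \<chi> (brauer_character p \<O> res G \<tau>)" using br by (simp add: lifts_def)
    ultimately show ?thesis by blast
  next
    assume u: "c \<noteq> 0" "1 / c \<in> \<O>" "res (1 / c) = 0"
    have "res (\<chi> x) = 0" if "x \<in> p_regular p G" for x
    proof -
      have "\<chi> x = (1 / c) * (c * \<chi> x)" using u(1) by simp
      then show ?thesis using res_mult[OF u(2) c[OF p_regularD(1)[OF that]]] u(3) by simp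
    qed
    then have "\<forall>\<phi> \<in> IBr p \<O> res G. p dvd decomposition_number p \<O> res G \<chi> \<phi>"
      using decomposition_numbers_divisible[OF \<tau> br] by blast
    then show ?thesis by blast
  qed
qed

end

end

theorem theorem1p1:
  fixes p :: nat
    and \<O> :: "'K::field_char_0 set"
    and res :: "'K \<Rightarrow> 'k::field"
    and G :: "('g, 'm) monoid_scheme"
    and \<chi> :: "'g \<Rightarrow> 'K"
  assumes "p_modular_system p \<O> res"
    and "group G" and "finite (carrier G)"
    and "\<And>H. subgroup H G \<Longrightarrow> splitting_field TYPE('K) (G\<lparr>carrier := H\<rparr>)"
    and "\<And>H. subgroup H G \<Longrightarrow> splitting_field TYPE('k) (G\<lparr>carrier := H\<rparr>)"
    and "\<chi> \<in> Irr G"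
    and "symmetric_algebra (ring_on \<O>) (order_algebra \<O> G \<chi>)"
  shows "(\<exists>\<phi> \<in> IBr p \<O> res G. lifts p G \<chi> \<phi>) \<or>
         (\<forall>\<phi> \<in> IBr p \<O> res G. p dvd decomposition_number p \<O> res G \<chi> \<phi>)"
proof -
  interpret p_modular_group p \<O> res G
    using assms(1-5) by (intro p_modular_group.intro p_modular_group_axioms.intro)
  obtain n and \<rho> :: "'g \<Rightarrow> 'K mat" where \<rho>: "irreducible_rep G n \<rho>" and \<chi>: "\<chi> = character G \<rho>"
    using assms(6) by (auto simp: Irr_def)
  note rep = irreducible_repD(1)[OF \<rho>]
  obtain P Q where PQ: "P \<in> carrier_mat n n" "Q \<in> carrier_mat n n" "P * Q = 1\<^sub>m n" "Q * P = 1\<^sub>m n"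
    and int: "\<And>x. x \<in> carrier G \<Longrightarrow> integral_mat (P * \<rho> x * Q)"
    by (rule integral_form[OF assms(2,3) rep]) (rule that)
  show ?thesis
  proof (rule symmetric_order_dichotomy[OF conjugate_irreducible[OF assms(2) \<rho> PQ] int _ assms(7)])
    show "\<chi> x = mat_trace (P * \<rho> x * Q)" if "x \<in> carrier G" for x
      using that conjugate_rep(3)[OF assms(2) rep PQ that] by (simp add: \<chi> character_def)
  qed
qed

end
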